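(* The bicategory $\mathcal L\mathrm{oc}$ of locales, modules and module homomorphisms, with first composition $A\otimes B=A\otimes_Y B$ and identities $\top_X=X$, second composition $A\oplus B=(B^\circ\otimes_Y A^\circ)^\circ\cong A^\circ\rhd B$ and identities $\bot_X=X^\circ$ (for $A\colon X\nrightarrow Y$, $B\colon Y\nrightarrow Z$), and the linear distributions $A\otimes(B\oplus C)\to(A\otimes B)\oplus C$ and $(A\oplus B)\otimes C\to A\oplus(B\otimes C)$ obtained from the evaluation maps by transposition as described in the context, is a linear bicategory.
   Context: Composition is written in diagrammatic order. A locale $X$ is regarded as a commutative quantale with multiplication $\wedge$. An $(X,Y)$-module $A\colon X\nrightarrow Y$ is a suplattice that is a left $X$-module and a right $Y$-module (unital, associative actions preserving suprema in each variable) with $x(ay)=(xa)y$. Module homomorphisms are sup-preserving maps commuting with both actions. $\mathcal L\mathrm{oc}$ has locales as 0-cells, modules as 1-cells and module homomorphisms as 2-cells; the composite of $A\colon X\nrightarrow Y$ and $B\colon Y\nrightarrow Z$ is the suplattice tensor product $A\otimes_Y B$. For $B$ a $(W,Y)$-module and $A$ an $(X,Y)$-module, $B\lhd A$ is the suplattice of right $Y$-module homomorphisms $A\to B$, a $(W,X)$-module by $(wf)(a)=wf(a)$, $(fx)(a)=f(xa)$. Dually, for $C$ an $(X,Z)$-module, $A\rhd C$ is the $(Y,Z)$-module of left $X$-module homomorphisms $A\to C$. There are evaluation maps $(B\lhd A)\otimes_X A\to B$ and $A\otimes_Y(A\rhd C)\to C$, with the usual universal (transposition) properties. For an $(X,Y)$-module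 $A$, the opposite lattice $A^\circ$ is a $(Y,X)$-module: $x$ acts on the right by the right adjoint of $x\cdot-\colon A\to A$, and $y$ acts on the left by the right adjoint of $-\cdot y\colon A\to A$; $(A^\circ)^\circ\cong A$. For $A\colon X\nrightarrow Y$, $B\colon Y\nrightarrow Z$, $C\colon Z\nrightarrow W$ one has $A\otimes(B\oplus C)\cong A\otimes_Y(B^\circ\rhd C)$ and $(A\otimes B)\oplus C\cong(B^\circ\lhd A)\rhd C$; the left distribution is the transpose of $(B^\circ\lhd A)\otimes_X A\otimes_Y(B^\circ\rhd C)\to B^\circ\otimes_Y(B^\circ\rhd C)\to C$ given by evaluations. The right distribution is obtained symmetrically. A linear bicategory has 0-cells, hom-categories $\mathcal B(X,Y)$, and two bicategory structures on these, $(\otimes,\top_X)$ and $(\oplus,\bot_X)$, with natural transformations $\delta^L\colon A\otimes(B\oplus C)\to(A\otimes B)\oplus C$ and $\delta^R\colon(A\oplus B)\otimes C\to A\oplus(B\otimes C)$ satisfying the following coherence conditions of Cockett–Koslowski–Seely (up to associativity and unit isomorphisms $\cong$). Units: (i) $\top\otimes(A\oplus B)\xrightarrow{\delta^L}(\top\otimes A)\oplus B\cong A\oplus B$ is the unit isomorphism; (ii) $(A\oplus B)\otimes\top\xrightarrow{\delta^R}A\oplus(B\otimes\top)\cong A\oplus B$ is the unit isomorphism; (iii) $A\otimes(B\oplus\bot)\xrightarrow{\delta^L}(A\otimes B)\oplus\bot\cong A\otimes B$ equals $A$ tensored with the unit isomorphism; (iv) $(\bot\oplus A)\otimes B\xrightarrow{\delta^R}\bot\oplus(A\otimes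 B)\cong A\otimes B$ equals the unit isomorphism tensored with $B$. Associativity, where in each case the two composites agree up to associators: (v) $(A\otimes B)\otimes(C\oplus D)\to((A\otimes B)\otimes C)\oplus D$ and $A\otimes(B\otimes(C\oplus D))\to A\otimes((B\otimes C)\oplus D)\to(A\otimes(B\otimes C))\oplus D$; (vi) the mirror image of (v) for $\delta^R$ on $(A\oplus B)\otimes(C\otimes D)$; (vii) $A\otimes((B\oplus C)\oplus D)\to(A\otimes(B\oplus C))\oplus D\to((A\otimes B)\oplus C)\oplus D$ and $A\otimes(B\oplus(C\oplus D))\to(A\otimes B)\oplus(C\oplus D)$; (viii) the mirror image of (vii) for $\delta^R$ on $(A\oplus(B\oplus C))\otimes D$; (ix) $A\otimes((B\oplus C)\otimes D)\to A\otimes(B\oplus(C\otimes D))\to(A\otimes B)\oplus(C\otimes D)$ and $(A\otimes(B\oplus C))\otimes D\to((A\otimes B)\oplus C)\otimes D\to(A\otimes B)\oplus(C\otimes D)$; (x) $(A\oplus B)\otimes(C\oplus D)\to((A\oplus B)\otimes C)\oplus D\to(A\oplus(B\otimes C))\oplus D$ and $(A\oplus B)\otimes(C\oplus D)\to A\oplus(B\otimes(C\oplus D))\to A\oplus((B\otimes C)\oplus D)$. *)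

theory Defs
  imports "HOL-Algebra.Complete_Lattice"
begin

section \<open>Locales and modules\<close>

text \<open>
  Locales and suplattices are complete lattices in the sense of HOL-Algebra. All constructions look
  only at elements of the carriers. Composition is written in diagrammatic order throughout.

  The tensor product of modules on \<open>'a\<close> and \<open>'b\<close> lives on \<open>('a \<times> 'b) set\<close>, so the modules of the
  bicategory are spread over all types and do not form a single HOL object. The operations below
  are therefore polymorphic constants, and the axioms of a linear bicategory are equations between
  them that are polymorphic in the carrier types of the locales and modules involved.
\<close>

definition is_locale :: "'x gorder \<Rightarrow> bool" where
  "is_locale X \<longleftrightarrow> complete_lattice X \<and>
     (\<forall>x\<in>carrier X. \<forall>S. S \<subseteq> carrier X \<longrightarrow>
        x \<sqinter>\<^bsub>X\<^esub> (\<Squnion>\<^bsub>X\<^esub> S) = \<Squnion>\<^bsub>X\<^esub> ((\<lambda>s. x \<sqinter>\<^bsub>X\<^esub> s) ` S))"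

record ('a, 'x, 'y) bimod = "'a gorder" +
  src :: "'x gorder"
  tgt :: "'y gorder"
  lact :: "'x \<Rightarrow> 'a \<Rightarrow> 'a"
  ract :: "'a \<Rightarrow> 'y \<Rightarrow> 'a"

definition bimodule :: "'x gorder \<Rightarrow> 'y gorder \<Rightarrow> ('a, 'x, 'y) bimod \<Rightarrow> bool" where
  "bimodule X Y A \<longleftrightarrow>
     is_locale X \<and> is_locale Y \<and> src A = X \<and> tgt A = Y \<and> complete_lattice A \<and>
     (\<forall>x\<in>carrier X. \<forall>a\<in>carrier A. lact A x a \<in> carrier A) \<and>
     (\<forall>a\<in>carrier A. lact A \<top>\<^bsub>X\<^esub> a = a) \<and>
     (\<forall>x\<in>carrier X. \<forall>x'\<in>carrier X. \<forall>a\<in>carrier A.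
        lact A (x \<sqinter>\<^bsub>X\<^esub> x') a = lact A x (lact A x' a)) \<and>
     (\<forall>x\<in>carrier X. \<forall>S. S \<subseteq> carrier A \<longrightarrow>
        lact A x (\<Squnion>\<^bsub>A\<^esub> S) = \<Squnion>\<^bsub>A\<^esub> ((\<lambda>s. lact A x s) ` S)) \<and>
     (\<forall>a\<in>carrier A. \<forall>S. S \<subseteq> carrier X \<longrightarrow>
        lact A (\<Squnion>\<^bsub>X\<^esub> S) a = \<Squnion>\<^bsub>A\<^esub> ((\<lambda>s. lact A s a) ` S)) \<and>
     (\<forall>y\<in>carrier Y. \<forall>a\<in>carrier A. ract A a y \<in> carrier A) \<and>
     (\<forall>a\<in>carrier A. ract A a \<top>\<^bsub>Y\<^esub> = a) \<and>
     (\<forall>y\<in>carrier Y. \<forall>y'\<in>carrier Y. \<forall>a\<in>carrier A.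
        ract A a (y \<sqinter>\<^bsub>Y\<^esub> y') = ract A (ract A a y) y') \<and>
     (\<forall>y\<in>carrier Y. \<forall>S. S \<subseteq> carrier A \<longrightarrow>
        ract A (\<Squnion>\<^bsub>A\<^esub> S) y = \<Squnion>\<^bsub>A\<^esub> ((\<lambda>s. ract A s y) ` S)) \<and>
     (\<forall>a\<in>carrier A. \<forall>S. S \<subseteq> carrier Y \<longrightarrow>
        ract A a (\<Squnion>\<^bsub>Y\<^esub> S) = \<Squnion>\<^bsub>A\<^esub> ((\<lambda>s. ract A a s) ` S)) \<and>
     (\<forall>x\<in>carrier X. \<forall>y\<in>carrier Y. \<forall>a\<in>carrier A.
        lact A x (ract A a y) = ract A (lact A x a) y)"

text \<open>
  Sup-preserving maps commuting with one or both actions. Maps are extensional, so that two of them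
  are equal as soon as they agree on the carrier.
\<close>

definition sup_maps :: "('a, 'm) gorder_scheme \<Rightarrow> ('b, 'n) gorder_scheme \<Rightarrow> ('a \<Rightarrow> 'b) set" where
  "sup_maps A B = {f \<in> carrier A \<rightarrow>\<^sub>E carrier B.
     \<forall>S. S \<subseteq> carrier A \<longrightarrow> f (\<Squnion>\<^bsub>A\<^esub> S) = \<Squnion>\<^bsub>B\<^esub> (f ` S)}"

definition left_homs :: "('a, 'x, 'y) bimod \<Rightarrow> ('b, 'x, 'z) bimod \<Rightarrow> ('a \<Rightarrow> 'b) set" where
  "left_homs A B = {f \<in> sup_maps A B.
     \<forall>x\<in>carrier (src A). \<forall>a\<in>carrier A. f (lact A x a) = lact B x (f a)}"

definition right_homs :: "('a, 'x, 'y) bimod \<Rightarrow> ('b, 'w, 'y) bimod \<Rightarrow> ('a \<Rightarrow> 'b) set" where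
  "right_homs A B = {f \<in> sup_maps A B.
     \<forall>y\<in>carrier (tgt A). \<forall>a\<in>carrier A. f (ract A a y) = ract B (f a) y}"


section \<open>The hom-categories\<close>

record ('a, 'b, 'x, 'y) cell =
  Dom :: "('a, 'x, 'y) bimod"
  Cod :: "('b, 'x, 'y) bimod"
  Map :: "'a \<Rightarrow> 'b"

definition is_cell ::
    "('a, 'b, 'x, 'y) cell \<Rightarrow> ('a, 'x, 'y) bimod \<Rightarrow> ('b, 'x, 'y) bimod \<Rightarrow> bool"
    (\<open>(_ :\<^sub>2 _ \<rightarrow> _)\<close> [51, 51, 51] 50) where
  "(f :\<^sub>2 A \<rightarrow> B) \<longleftrightarrow> Dom f = A \<and> Cod f = B \<and> src A = src B \<and> tgt A = tgt B \<and>
     Map f \<in> left_homs A B \<inter> right_homs A B"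

definition id2 :: "('a, 'x, 'y) bimod \<Rightarrow> ('a, 'a, 'x, 'y) cell" where
  "id2 A = \<lparr>Dom = A, Cod = A, Map = (\<lambda>a\<in>carrier A. a)\<rparr>"

definition vcomp ::
    "('a, 'b, 'x, 'y) cell \<Rightarrow> ('b, 'c, 'x, 'y) cell \<Rightarrow> ('a, 'c, 'x, 'y) cell"
    (infixl \<open>\<Zsemi>\<close> 55) where
  "f \<Zsemi> g = \<lparr>Dom = Dom f, Cod = Cod g, Map = compose (carrier (Dom f)) (Map g) (Map f)\<rparr>"

definition is_iso ::
    "('a, 'b, 'x, 'y) cell \<Rightarrow> ('a, 'x, 'y) bimod \<Rightarrow> ('b, 'x, 'y) bimod \<Rightarrow> bool"
    (\<open>(_ :\<^sub>2 _ \<cong> _)\<close> [51, 51, 51] 50) where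
  "(f :\<^sub>2 A \<cong> B) \<longleftrightarrow> (f :\<^sub>2 A \<rightarrow> B) \<and>
     (\<exists>g. (g :\<^sub>2 B \<rightarrow> A) \<and> f \<Zsemi> g = id2 A \<and> g \<Zsemi> f = id2 B)"

definition inv2 :: "('a, 'b, 'x, 'y) cell \<Rightarrow> ('b, 'a, 'x, 'y) cell" where
  "inv2 f = \<lparr>Dom = Cod f, Cod = Dom f,
     Map = (\<lambda>b\<in>carrier (Cod f). inv_into (carrier (Dom f)) (Map f) b)\<rparr>"


section \<open>The tensor product\<close>

text \<open>
  The free suplattice on \<open>carrier A \<times> carrier B\<close> is its powerset. Its quotient by the relations that
  make \<open>(a, b) \<mapsto> a \<otimes> b\<close> preserve suprema in each variable and satisfy \<open>ay \<otimes> b = a \<otimes> yb\<close> is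
  represented by the subsets that are saturated for these relations, ordered by inclusion; the
  image of a subset in the quotient is the least saturated set containing it. Saturated sets are in
  particular down-closed, and a saturated set \<open>U\<close> is the supremum of all \<open>a \<otimes> b\<close> with \<open>(a, b) \<in> U\<close>.
\<close>

definition saturated :: "('a, 'x, 'y) bimod \<Rightarrow> ('b, 'y, 'z) bimod \<Rightarrow> ('a \<times> 'b) set \<Rightarrow> bool" where
  "saturated A B U \<longleftrightarrow> U \<subseteq> carrier A \<times> carrier B \<and>
     (\<forall>S b. S \<subseteq> carrier A \<and> b \<in> carrier B \<longrightarrow>
        ((\<Squnion>\<^bsub>A\<^esub> S, b) \<in> U \<longleftrightarrow> (\<forall>a\<in>S. (a, b) \<in> U))) \<and>
     (\<forall>a T. a \<in> carrier A \<and> T \<subseteq> carrier B \<longrightarrow>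
        ((a, \<Squnion>\<^bsub>B\<^esub> T) \<in> U \<longleftrightarrow> (\<forall>b\<in>T. (a, b) \<in> U))) \<and>
     (\<forall>a\<in>carrier A. \<forall>y\<in>carrier (tgt A). \<forall>b\<in>carrier B.
        (ract A a y, b) \<in> U \<longleftrightarrow> (a, lact B y b) \<in> U)"

definition saturation ::
    "('a, 'x, 'y) bimod \<Rightarrow> ('b, 'y, 'z) bimod \<Rightarrow> ('a \<times> 'b) set \<Rightarrow> ('a \<times> 'b) set" where
  "saturation A B R = \<Inter>{U. saturated A B U \<and> R \<subseteq> U}"

definition tensor ::
    "('a, 'x, 'y) bimod \<Rightarrow> ('b, 'y, 'z) bimod \<Rightarrow> (('a \<times> 'b) set, 'x, 'z) bimod"
    (infixr \<open>\<otimes>\<close> 70) where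
  "A \<otimes> B = \<lparr>carrier = {U. saturated A B U}, eq = (=), le = (\<subseteq>), src = src A, tgt = tgt B,
     lact = (\<lambda>x U. saturation A B ((\<lambda>(a, b). (lact A x a, b)) ` U)),
     ract = (\<lambda>U z. saturation A B ((\<lambda>(a, b). (a, ract B b z)) ` U))\<rparr>"

definition pure_tensor ::
    "('a, 'x, 'y) bimod \<Rightarrow> ('b, 'y, 'z) bimod \<Rightarrow> 'a \<Rightarrow> 'b \<Rightarrow> ('a \<times> 'b) set" where
  "pure_tensor A B a b = saturation A B {(a, b)}"

text \<open>
  The map out of \<open>A \<otimes> B\<close> that sends \<open>a \<otimes> b\<close> to \<open>\<phi> a b\<close>, for \<open>\<phi>\<close> sup-preserving in each variable and
  balanced over the middle locale.
\<close>

definition tensor_lift :: "('a, 'x, 'y) bimod \<Rightarrow> ('b, 'y, 'z) bimod \<Rightarrow> ('c, 'x, 'z) bimod \<Rightarrow>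
    ('a \<Rightarrow> 'b \<Rightarrow> 'c) \<Rightarrow> (('a \<times> 'b) set, 'c, 'x, 'z) cell" where
  "tensor_lift A B C \<phi> = \<lparr>Dom = A \<otimes> B, Cod = C,
     Map = (\<lambda>U\<in>carrier (A \<otimes> B). \<Squnion>\<^bsub>C\<^esub> ((\<lambda>(a, b). \<phi> a b) ` U))\<rparr>"

definition tensor2 :: "('a, 'c, 'x, 'y) cell \<Rightarrow> ('b, 'd, 'y, 'z) cell \<Rightarrow>
    (('a \<times> 'b) set, ('c \<times> 'd) set, 'x, 'z) cell" (infixr \<open>\<otimes>\<^sub>2\<close> 70) where
  "f \<otimes>\<^sub>2 g = tensor_lift (Dom f) (Dom g) (Cod f \<otimes> Cod g)
     (\<lambda>a b. pure_tensor (Cod f) (Cod g) (Map f a) (Map g b))"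

definition top_cell :: "'x gorder \<Rightarrow> ('x, 'x, 'x) bimod" where
  "top_cell X = \<lparr>carrier = carrier X, eq = (=), le = le X, src = X, tgt = X,
     lact = (\<lambda>x a. x \<sqinter>\<^bsub>X\<^esub> a), ract = (\<lambda>a x. a \<sqinter>\<^bsub>X\<^esub> x)\<rparr>"

definition tensor_assoc ::
    "('a, 'x, 'y) bimod \<Rightarrow> ('b, 'y, 'z) bimod \<Rightarrow> ('c, 'z, 'w) bimod \<Rightarrow>
     ((('a \<times> 'b) set \<times> 'c) set, ('a \<times> ('b \<times> 'c) set) set, 'x, 'w) cell" where
  "tensor_assoc A B C = tensor_lift (A \<otimes> B) C (A \<otimes> (B \<otimes> C))
     (\<lambda>U c. \<Squnion>\<^bsub>A \<otimes> (B \<otimes> C)\<^esub>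
        ((\<lambda>(a, b). pure_tensor A (B \<otimes> C) a (pure_tensor B C b c)) ` U))"

definition tensor_lunit :: "('a, 'x, 'y) bimod \<Rightarrow> (('x \<times> 'a) set, 'a, 'x, 'y) cell" where
  "tensor_lunit A = tensor_lift (top_cell (src A)) A A (\<lambda>x a. lact A x a)"

definition tensor_runit :: "('a, 'x, 'y) bimod \<Rightarrow> (('a \<times> 'y) set, 'a, 'x, 'y) cell" where
  "tensor_runit A = tensor_lift A (top_cell (tgt A)) A (\<lambda>a y. ract A a y)"


section \<open>Opposites\<close>

definition right_adjoint ::
    "('a, 'm) gorder_scheme \<Rightarrow> ('b, 'n) gorder_scheme \<Rightarrow> ('a \<Rightarrow> 'b) \<Rightarrow> 'b \<Rightarrow> 'a" where
  "right_adjoint A B f = (\<lambda>b\<in>carrier B. \<Squnion>\<^bsub>A\<^esub> {a \<in> carrier A. f a \<sqsubseteq>\<^bsub>B\<^esub> b})"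

definition opposite :: "('a, 'x, 'y) bimod \<Rightarrow> ('a, 'y, 'x) bimod" (\<open>_\<degree>\<close> [1000] 1000) where
  "A\<degree> = \<lparr>carrier = carrier A, eq = eq A, le = (\<lambda>a b. b \<sqsubseteq>\<^bsub>A\<^esub> a), src = tgt A, tgt = src A,
     lact = (\<lambda>y. right_adjoint A A (\<lambda>a. ract A a y)),
     ract = (\<lambda>a x. right_adjoint A A (\<lambda>a. lact A x a) a)\<rparr>"

text \<open>A module homomorphism \<open>A \<rightarrow> B\<close> induces \<open>B\<degree> \<rightarrow> A\<degree>\<close>, its right adjoint.\<close>

definition opposite2 :: "('a, 'b, 'x, 'y) cell \<Rightarrow> ('b, 'a, 'y, 'x) cell"
    (\<open>_\<degree>\<^sub>2\<close> [1000] 1000) where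
  "f\<degree>\<^sub>2 = \<lparr>Dom = (Cod f)\<degree>, Cod = (Dom f)\<degree>, Map = right_adjoint (Dom f) (Cod f) (Map f)\<rparr>"

text \<open>
  The isomorphism \<open>A\<degree>\<degree> \<cong> A\<close>. It is the identity on elements, but as records \<open>A\<degree>\<degree>\<close> and \<open>A\<close> may
  differ in the values of the actions outside the carriers.
\<close>

definition double_opposite :: "('a, 'x, 'y) bimod \<Rightarrow> ('a, 'a, 'x, 'y) cell" where
  "double_opposite A = \<lparr>Dom = A\<degree>\<degree>, Cod = A, Map = (\<lambda>a\<in>carrier A. a)\<rparr>"


section \<open>The second composition\<close>

definition par ::
    "('a, 'x, 'y) bimod \<Rightarrow> ('b, 'y, 'z) bimod \<Rightarrow> (('b \<times> 'a) set, 'x, 'z) bimod"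
    (infixr \<open>\<oplus>\<close> 65) where
  "A \<oplus> B = (B\<degree> \<otimes> A\<degree>)\<degree>"

definition par2 :: "('a, 'c, 'x, 'y) cell \<Rightarrow> ('b, 'd, 'y, 'z) cell \<Rightarrow>
    (('b \<times> 'a) set, ('d \<times> 'c) set, 'x, 'z) cell" (infixr \<open>\<oplus>\<^sub>2\<close> 65) where
  "f \<oplus>\<^sub>2 g = (g\<degree>\<^sub>2 \<otimes>\<^sub>2 f\<degree>\<^sub>2)\<degree>\<^sub>2"

definition bot_cell :: "'x gorder \<Rightarrow> ('x, 'x, 'x) bimod" where
  "bot_cell X = (top_cell X)\<degree>"

text \<open>
  The associativity and unit isomorphisms of \<open>\<oplus>\<close> are those of \<open>\<otimes>\<close>, transported along the duality.
\<close>

definition par_assoc ::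
    "('a, 'x, 'y) bimod \<Rightarrow> ('b, 'y, 'z) bimod \<Rightarrow> ('c, 'z, 'w) bimod \<Rightarrow>
     (('c \<times> ('b \<times> 'a) set) set, (('c \<times> 'b) set \<times> 'a) set, 'x, 'w) cell" where
  "par_assoc A B C =
     ((double_opposite (C\<degree> \<otimes> B\<degree>) \<otimes>\<^sub>2 id2 (A\<degree>))
        \<Zsemi> tensor_assoc (C\<degree>) (B\<degree>) (A\<degree>)
        \<Zsemi> (id2 (C\<degree>) \<otimes>\<^sub>2 inv2 (double_opposite (B\<degree> \<otimes> A\<degree>))))\<degree>\<^sub>2"

definition par_lunit :: "('a, 'x, 'y) bimod \<Rightarrow> (('a \<times> 'x) set, 'a, 'x, 'y) cell" where
  "par_lunit A =
     inv2 (((id2 (A\<degree>) \<otimes>\<^sub>2 double_opposite (top_cell (src A))) \<Zsemi> tensor_runit (A\<degree>))\<degree>\<^sub>2)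
       \<Zsemi> double_opposite A"

definition par_runit :: "('a, 'x, 'y) bimod \<Rightarrow> (('y \<times> 'a) set, 'a, 'x, 'y) cell" where
  "par_runit A =
     inv2 (((double_opposite (top_cell (tgt A)) \<otimes>\<^sub>2 id2 (A\<degree>)) \<Zsemi> tensor_lunit (A\<degree>))\<degree>\<^sub>2)
       \<Zsemi> double_opposite A"


section \<open>Hom modules, evaluation and transposition\<close>

definition rhom :: "('b, 'w, 'y) bimod \<Rightarrow> ('a, 'x, 'y) bimod \<Rightarrow> ('a \<Rightarrow> 'b, 'w, 'x) bimod"
    (infixl \<open>\<lhd>\<close> 72) where
  "B \<lhd> A = \<lparr>carrier = right_homs A B, eq = (=), le = (\<lambda>f g. \<forall>a\<in>carrier A. f a \<sqsubseteq>\<^bsub>B\<^esub> g a),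
     src = src B, tgt = src A,
     lact = (\<lambda>w f. \<lambda>a\<in>carrier A. lact B w (f a)),
     ract = (\<lambda>f x. \<lambda>a\<in>carrier A. f (lact A x a))\<rparr>"

definition lhom :: "('a, 'x, 'y) bimod \<Rightarrow> ('c, 'x, 'z) bimod \<Rightarrow> ('a \<Rightarrow> 'c, 'y, 'z) bimod"
    (infixr \<open>\<rhd>\<close> 72) where
  "A \<rhd> C = \<lparr>carrier = left_homs A C, eq = (=), le = (\<lambda>f g. \<forall>a\<in>carrier A. f a \<sqsubseteq>\<^bsub>C\<^esub> g a),
     src = tgt A, tgt = tgt C,
     lact = (\<lambda>y f. \<lambda>a\<in>carrier A. f (ract A a y)),
     ract = (\<lambda>f z. \<lambda>a\<in>carrier A. ract C (f a) z)\<rparr>"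

definition reval :: "('b, 'w, 'y) bimod \<Rightarrow> ('a, 'x, 'y) bimod \<Rightarrow>
    ((('a \<Rightarrow> 'b) \<times> 'a) set, 'b, 'w, 'y) cell" where
  "reval B A = tensor_lift (B \<lhd> A) A B (\<lambda>f a. f a)"

definition leval :: "('a, 'x, 'y) bimod \<Rightarrow> ('c, 'x, 'z) bimod \<Rightarrow>
    (('a \<times> ('a \<Rightarrow> 'c)) set, 'c, 'x, 'z) cell" where
  "leval A C = tensor_lift A (A \<rhd> C) C (\<lambda>a f. f a)"

text \<open>The transpose \<open>M \<rightarrow> C \<lhd> P\<close> of \<open>h: M \<otimes> P \<rightarrow> C\<close>, and the transpose \<open>M \<rightarrow> P \<rhd> C\<close> of \<open>h: P \<otimes> M \<rightarrow> C\<close>.\<close>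

definition rtranspose :: "('m, 'w, 'x) bimod \<Rightarrow> ('p, 'x, 'y) bimod \<Rightarrow>
    (('m \<times> 'p) set, 'c, 'w, 'y) cell \<Rightarrow> ('m, 'p \<Rightarrow> 'c, 'w, 'x) cell" where
  "rtranspose M P h = \<lparr>Dom = M, Cod = Cod h \<lhd> P,
     Map = (\<lambda>m\<in>carrier M. \<lambda>p\<in>carrier P. Map h (pure_tensor M P m p))\<rparr>"

definition ltranspose :: "('p, 'x, 'y) bimod \<Rightarrow> ('m, 'y, 'z) bimod \<Rightarrow>
    (('p \<times> 'm) set, 'c, 'x, 'z) cell \<Rightarrow> ('m, 'p \<Rightarrow> 'c, 'y, 'z) cell" where
  "ltranspose P M h = \<lparr>Dom = M, Cod = P \<rhd> Cod h,
     Map = (\<lambda>m\<in>carrier M. \<lambda>p\<in>carrier P. Map h (pure_tensor P M p m))\<rparr>"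

definition rprecomp :: "('b, 'w, 'y) bimod \<Rightarrow> ('a, 'c, 'x, 'y) cell \<Rightarrow>
    ('c \<Rightarrow> 'b, 'a \<Rightarrow> 'b, 'w, 'x) cell" where
  "rprecomp B f = \<lparr>Dom = B \<lhd> Cod f, Cod = B \<lhd> Dom f,
     Map = (\<lambda>g\<in>carrier (B \<lhd> Cod f). compose (carrier (Dom f)) g (Map f))\<rparr>"

definition lprecomp :: "('a, 'c, 'x, 'y) cell \<Rightarrow> ('b, 'x, 'z) bimod \<Rightarrow>
    ('c \<Rightarrow> 'b, 'a \<Rightarrow> 'b, 'y, 'z) cell" where
  "lprecomp f B = \<lparr>Dom = Cod f \<rhd> B, Cod = Dom f \<rhd> B,
     Map = (\<lambda>g\<in>carrier (Cod f \<rhd> B). compose (carrier (Dom f)) g (Map f))\<rparr>"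


section \<open>Duals of composites as hom modules\<close>

text \<open>
  \<open>B\<degree> \<lhd> A \<cong> (A \<otimes> B)\<degree>\<close> and \<open>B \<rhd> A\<degree> \<cong> (A \<otimes> B)\<degree>\<close>: a homomorphism \<open>f: A \<rightarrow> B\<degree>\<close> corresponds to the largest
  \<open>U\<close> such that \<open>a \<otimes> b\<close> lies below \<open>U\<close> exactly when \<open>b\<close> lies below \<open>f a\<close> in \<open>B\<close>.
\<close>

definition rhom_to_dual :: "('a, 'x, 'y) bimod \<Rightarrow> ('b, 'y, 'z) bimod \<Rightarrow>
    ('a \<Rightarrow> 'b, ('a \<times> 'b) set, 'z, 'x) cell" where
  "rhom_to_dual A B = \<lparr>Dom = B\<degree> \<lhd> A, Cod = (A \<otimes> B)\<degree>,
     Map = (\<lambda>f\<in>carrier (B\<degree> \<lhd> A). {(a, b). a \<in> carrier A \<and> b \<in> carrier B \<and> b \<sqsubseteq>\<^bsub>B\<^esub> f a})\<rparr>"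

definition lhom_to_dual :: "('a, 'x, 'y) bimod \<Rightarrow> ('b, 'y, 'z) bimod \<Rightarrow>
    ('b \<Rightarrow> 'a, ('a \<times> 'b) set, 'z, 'x) cell" where
  "lhom_to_dual A B = \<lparr>Dom = B \<rhd> A\<degree>, Cod = (A \<otimes> B)\<degree>,
     Map = (\<lambda>g\<in>carrier (B \<rhd> A\<degree>). {(a, b). a \<in> carrier A \<and> b \<in> carrier B \<and> a \<sqsubseteq>\<^bsub>A\<^esub> g b})\<rparr>"

text \<open>
  The same two isomorphisms for \<open>(B\<degree> \<otimes> A\<degree>)\<degree> = A \<oplus> B\<close>, with \<open>A\<degree>\<degree>\<close> and \<open>B\<degree>\<degree>\<close> identified with \<open>A\<close> and \<open>B\<close>:
  \<open>A\<degree> \<rhd> B \<cong> A \<oplus> B\<close> and \<open>A \<lhd> B\<degree> \<cong> A \<oplus> B\<close>. The order in the sets is reversed because of the opposites.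
\<close>

definition lhom_to_par :: "('a, 'x, 'y) bimod \<Rightarrow> ('b, 'y, 'z) bimod \<Rightarrow>
    ('a \<Rightarrow> 'b, ('b \<times> 'a) set, 'x, 'z) cell" where
  "lhom_to_par A B = \<lparr>Dom = A\<degree> \<rhd> B, Cod = A \<oplus> B,
     Map = (\<lambda>h\<in>carrier (A\<degree> \<rhd> B). {(b, a). b \<in> carrier B \<and> a \<in> carrier A \<and> h a \<sqsubseteq>\<^bsub>B\<^esub> b})\<rparr>"

definition rhom_to_par :: "('a, 'x, 'y) bimod \<Rightarrow> ('b, 'y, 'z) bimod \<Rightarrow>
    ('b \<Rightarrow> 'a, ('b \<times> 'a) set, 'x, 'z) cell" where
  "rhom_to_par A B = \<lparr>Dom = A \<lhd> B\<degree>, Cod = A \<oplus> B,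
     Map = (\<lambda>h\<in>carrier (A \<lhd> B\<degree>). {(b, a). b \<in> carrier B \<and> a \<in> carrier A \<and> h b \<sqsubseteq>\<^bsub>A\<^esub> a})\<rparr>"


section \<open>The linear distributions\<close>

text \<open>
  The double evaluation \<open>(B\<degree> \<lhd> A) \<otimes> (A \<otimes> (B\<degree> \<rhd> C)) \<rightarrow> B\<degree> \<otimes> (B\<degree> \<rhd> C) \<rightarrow> C\<close> is transposed to
  \<open>A \<otimes> (B\<degree> \<rhd> C) \<rightarrow> (B\<degree> \<lhd> A) \<rhd> C\<close>, and this is conjugated by the isomorphisms \<open>B \<oplus> C \<cong> B\<degree> \<rhd> C\<close> and
  \<open>(A \<otimes> B) \<oplus> C \<cong> (A \<otimes> B)\<degree> \<rhd> C \<cong> (B\<degree> \<lhd> A) \<rhd> C\<close>. Symmetrically on the right, with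
  \<open>(A \<lhd> B\<degree>) \<otimes> C \<otimes> (C \<rhd> B\<degree>) \<rightarrow> (A \<lhd> B\<degree>) \<otimes> B\<degree> \<rightarrow> A\<close>.
\<close>

definition dist_left ::
    "('a, 'x, 'y) bimod \<Rightarrow> ('b, 'y, 'z) bimod \<Rightarrow> ('c, 'z, 'w) bimod \<Rightarrow>
     (('a \<times> ('c \<times> 'b) set) set, ('c \<times> ('a \<times> 'b) set) set, 'x, 'w) cell" (\<open>\<delta>\<^sup>L\<close>) where
  "\<delta>\<^sup>L A B C =
     (id2 A \<otimes>\<^sub>2 inv2 (lhom_to_par B C))
     \<Zsemi> ltranspose (B\<degree> \<lhd> A) (A \<otimes> (B\<degree> \<rhd> C))
         (inv2 (tensor_assoc (B\<degree> \<lhd> A) A (B\<degree> \<rhd> C))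
            \<Zsemi> (reval (B\<degree>) A \<otimes>\<^sub>2 id2 (B\<degree> \<rhd> C))
            \<Zsemi> leval (B\<degree>) C)
     \<Zsemi> lprecomp (inv2 (rhom_to_dual A B)) C
     \<Zsemi> lhom_to_par (A \<otimes> B) C"

definition dist_right ::
    "('a, 'x, 'y) bimod \<Rightarrow> ('b, 'y, 'z) bimod \<Rightarrow> ('c, 'z, 'w) bimod \<Rightarrow>
     ((('b \<times> 'a) set \<times> 'c) set, (('b \<times> 'c) set \<times> 'a) set, 'x, 'w) cell" (\<open>\<delta>\<^sup>R\<close>) where
  "\<delta>\<^sup>R A B C =
     (inv2 (rhom_to_par A B) \<otimes>\<^sub>2 id2 C)
     \<Zsemi> rtranspose ((A \<lhd> B\<degree>) \<otimes> C) (C \<rhd> B\<degree>)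
         (tensor_assoc (A \<lhd> B\<degree>) C (C \<rhd> B\<degree>)
            \<Zsemi> (id2 (A \<lhd> B\<degree>) \<otimes>\<^sub>2 leval C (B\<degree>))
            \<Zsemi> reval A (B\<degree>))
     \<Zsemi> rprecomp A (inv2 (lhom_to_dual B C))
     \<Zsemi> rhom_to_par A (B \<otimes> C)"

end

theory Submission
  imports Defs
begin

text \<open>
  A sup-preserving map out of \<open>A \<otimes> B\<close> is determined by its values on pure tensors, and a sup-preserving map
  into \<open>A \<oplus> B = (B\<degree> \<otimes> A\<degree>)\<degree>\<close> by the values of its right adjoint on the pure tensors of \<open>B\<degree> \<otimes> A\<degree>\<close>, which
  amounts to knowing which pairs \<open>(b, a)\<close> belong to its values. Taking right adjoints therefore reduces the
  second bicategory structure to the first. Write \<open>lres B a U\<close> for the largest \<open>b\<close> and \<open>rres A U b\<close> for the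
  largest \<open>a\<close> with \<open>(a, b) \<in> U\<close>. Unfolding the transpositions gives
  \<open>(c, U) \<in> \<delta>\<^sup>L (a \<otimes> W) \<longleftrightarrow> (c, lres B a U) \<in> W\<close> and \<open>(U, a) \<in> \<delta>\<^sup>R (W \<otimes> c) \<longleftrightarrow> (rres B U c, a) \<in> W\<close>, so that
  each coherence axiom, tested on pure tensors, becomes an identity between residuals, for instance
  \<open>lres C b (lres (B \<otimes> C) a Q) = lres C (a \<otimes> b) Q\<close> up to the associator.
\<close>

section \<open>Suprema and adjoints\<close>

text \<open>Membership is an order statement because \<open>A \<oplus> B\<close> carries reverse
  inclusion: \<open>(b, a) \<in> W\<close> says that \<open>W\<close> lies below the pure tensor of
  \<open>b\<close> and \<open>a\<close>. So pure tensors generate \<open>A \<otimes> B\<close> under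
  suprema and \<open>A \<oplus> B\<close> under infima. The reduction closes up because the adjoints
  of the structural cells of \<open>\<oplus>\<close> send pure tensors to pure tensors, and because
  the residual of the adjoint of \<open>\<delta>\<^sup>L\<close> or \<open>\<delta>\<^sup>R\<close>
  by an element of the outer module is again a pure tensor. Only the axiom on
  \<open>(A \<oplus> B) \<otimes> (C \<oplus> D)\<close> escapes this pattern: one residual there is
  taken by an arbitrary element of \<open>A \<oplus> B\<close>, and the Galois connection between
  \<open>lres\<close> and \<open>rres\<close> has to be used. A technical obstacle shapes many
  statements: \<open>(A \<oplus> B)\<degree>\<close> is the double opposite of
  \<open>B\<degree> \<otimes> A\<degree>\<close>, with the same carrier and order but a different
  record. Sup-preservation is therefore kept separate from the actions, in a form that passes
  between such records.\<close>

lemma complete_lattice_supI: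
  fixes L :: "('a, 'm) gorder_scheme"
  assumes eq: "eq L = (=)"
    and refl: "\<And>x. x \<in> carrier L \<Longrightarrow> x \<sqsubseteq>\<^bsub>L\<^esub> x"
    and trans: "\<And>x y z. \<lbrakk>x \<sqsubseteq>\<^bsub>L\<^esub> y; y \<sqsubseteq>\<^bsub>L\<^esub> z; x \<in> carrier L; y \<in> carrier L; z \<in> carrier L\<rbrakk> \<Longrightarrow> x \<sqsubseteq>\<^bsub>L\<^esub> z"
    and antisym: "\<And>x y. \<lbrakk>x \<sqsubseteq>\<^bsub>L\<^esub> y; y \<sqsubseteq>\<^bsub>L\<^esub> x; x \<in> carrier L; y \<in> carrier L\<rbrakk> \<Longrightarrow> x = y"
    and sups: "\<And>S. S \<subseteq> carrier L \<Longrightarrow> \<exists>s\<in>carrier L. \<forall>z\<in>carrier L. s \<sqsubseteq>\<^bsub>L\<^esub> z \<longleftrightarrow> (\<forall>a\<in>S. a \<sqsubseteq>\<^bsub>L\<^esub> z)"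
  shows "complete_lattice L"
proof -
  interpret partial_order L
    by unfold_locales (use assms in \<open>auto intro: trans antisym\<close>)
  have lub: "\<exists>s. least L s (Upper L S)" if S: "S \<subseteq> carrier L" for S
  proof -
    obtain s where s: "s \<in> carrier L" "\<And>z. z \<in> carrier L \<Longrightarrow> s \<sqsubseteq>\<^bsub>L\<^esub> z \<longleftrightarrow> (\<forall>a\<in>S. a \<sqsubseteq>\<^bsub>L\<^esub> z)"
      using sups[OF S] by blast
    have "\<forall>a\<in>S. a \<sqsubseteq>\<^bsub>L\<^esub> s" using s refl by blast
    then have "least L s (Upper L S)"
      by (intro least_UpperI) (use s S in \<open>auto simp: Upper_def\<close>)
    then show ?thesis ..
  qed
  show ?thesis
  proof (rule complete_latticeI)
    fix S assume S: "S \<subseteq> carrier L"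
    then show "\<exists>s. least L s (Upper L S)" by (rule lub)
    \<comment> \<open>Suprema suffice for completeness: the infimum of \<open>S\<close> is the
      supremum of its lower bounds.\<close>
    have "Lower L S \<subseteq> carrier L" by simp
    from sups[OF this] obtain i where i: "i \<in> carrier L"
      "\<And>z. z \<in> carrier L \<Longrightarrow> i \<sqsubseteq>\<^bsub>L\<^esub> z \<longleftrightarrow> (\<forall>a\<in>Lower L S. a \<sqsubseteq>\<^bsub>L\<^esub> z)"
      by blast
    have "\<forall>a\<in>Lower L S. a \<sqsubseteq>\<^bsub>L\<^esub> i" using i refl by blast
    then have "greatest L i (Lower L S)"
      by (intro greatest_LowerI) (use i S in \<open>auto simp: Lower_def\<close>)
    then show "\<exists>i. greatest L i (Lower L S)" ..
  qed
qed

section \<open>Order facts with the lattice as an explicit hypothesis, since several lattices occur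
  in one argument\<close>

context
  fixes L :: "('a, 'm) gorder_scheme"
  assumes L: "complete_lattice L"
begin

interpretation complete_lattice L by (rule L)

lemma cl_eq: "eq L = (=)"
  by (rule eq_is_equal)

lemma cl_refl: "a \<in> carrier L \<Longrightarrow> a \<sqsubseteq>\<^bsub>L\<^esub> a"
  by simp

lemma cl_trans: "\<lbrakk>a \<sqsubseteq>\<^bsub>L\<^esub> b; b \<sqsubseteq>\<^bsub>L\<^esub> c; a \<in> carrier L; b \<in> carrier L; c \<in> carrier L\<rbrakk> \<Longrightarrow> a \<sqsubseteq>\<^bsub>L\<^esub> c"
  by (rule le_trans)

lemma cl_antisym: "\<lbrakk>a \<sqsubseteq>\<^bsub>L\<^esub> b; b \<sqsubseteq>\<^bsub>L\<^esub> a; a \<in> carrier L; b \<in> carrier L\<rbrakk> \<Longrightarrow> a = b"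
  by (rule le_antisym)

lemma cl_sup_closed: "S \<subseteq> carrier L \<Longrightarrow> \<Squnion>\<^bsub>L\<^esub> S \<in> carrier L"
  by simp

lemma cl_sup_upper: "\<lbrakk>S \<subseteq> carrier L; a \<in> S\<rbrakk> \<Longrightarrow> a \<sqsubseteq>\<^bsub>L\<^esub> \<Squnion>\<^bsub>L\<^esub> S"
  by (rule sup_upper)

lemma cl_sup_le_iff:
  assumes "S \<subseteq> carrier L" "z \<in> carrier L"
  shows "\<Squnion>\<^bsub>L\<^esub> S \<sqsubseteq>\<^bsub>L\<^esub> z \<longleftrightarrow> (\<forall>a\<in>S. a \<sqsubseteq>\<^bsub>L\<^esub> z)"
proof
  assume "\<Squnion>\<^bsub>L\<^esub> S \<sqsubseteq>\<^bsub>L\<^esub> z"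
  then show "\<forall>a\<in>S. a \<sqsubseteq>\<^bsub>L\<^esub> z"
    using assms sup_upper[OF assms(1)] by (meson le_trans subsetD sup_closed)
next
  assume "\<forall>a\<in>S. a \<sqsubseteq>\<^bsub>L\<^esub> z"
  then show "\<Squnion>\<^bsub>L\<^esub> S \<sqsubseteq>\<^bsub>L\<^esub> z" using assms by (intro sup_least) auto
qed

lemma cl_eq_upperI:
  assumes "a \<in> carrier L" "b \<in> carrier L"
    and "\<And>c. c \<in> carrier L \<Longrightarrow> a \<sqsubseteq>\<^bsub>L\<^esub> c \<longleftrightarrow> b \<sqsubseteq>\<^bsub>L\<^esub> c"
  shows "a = b"
  using assms cl_antisym cl_refl by blast

lemma cl_eq_lowerI:
  assumes "a \<in> carrier L" "b \<in> carrier L"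
    and "\<And>c. c \<in> carrier L \<Longrightarrow> c \<sqsubseteq>\<^bsub>L\<^esub> a \<longleftrightarrow> c \<sqsubseteq>\<^bsub>L\<^esub> b"
  shows "a = b"
  using assms cl_antisym cl_refl by blast

lemma cl_sup_eqI:
  assumes "S \<subseteq> carrier L" "b \<in> carrier L"
    and "\<And>c. c \<in> carrier L \<Longrightarrow> b \<sqsubseteq>\<^bsub>L\<^esub> c \<longleftrightarrow> (\<forall>a\<in>S. a \<sqsubseteq>\<^bsub>L\<^esub> c)"
  shows "\<Squnion>\<^bsub>L\<^esub> S = b"
  by (rule cl_eq_upperI) (use assms cl_sup_le_iff in auto)

lemma cl_sup_insert: "\<lbrakk>a \<sqsubseteq>\<^bsub>L\<^esub> b; a \<in> carrier L; b \<in> carrier L\<rbrakk> \<Longrightarrow> \<Squnion>\<^bsub>L\<^esub> {a, b} = b"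
  by (rule cl_sup_eqI) (auto intro: cl_trans)

text \<open>Applied to \<open>T\<close> itself, the hypothesis puts the supremum of \<open>T\<close>
  into \<open>T\<close>; applied to \<open>a\<close> together with that supremum, it makes
  \<open>T\<close> down-closed. So \<open>T\<close> is a principal ideal. This is how sections of
  saturated sets become residuals.\<close>

lemma cl_le_sup_iff_mem:
  assumes T: "T \<subseteq> carrier L" and sup: "\<And>S. S \<subseteq> carrier L \<Longrightarrow> \<Squnion>\<^bsub>L\<^esub> S \<in> T \<longleftrightarrow> S \<subseteq> T" and a: "a \<in> carrier L"
  shows "a \<sqsubseteq>\<^bsub>L\<^esub> \<Squnion>\<^bsub>L\<^esub> T \<longleftrightarrow> a \<in> T"
proof
  assume "a \<sqsubseteq>\<^bsub>L\<^esub> \<Squnion>\<^bsub>L\<^esub> T"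
  then have "\<Squnion>\<^bsub>L\<^esub> {a, \<Squnion>\<^bsub>L\<^esub> T} = \<Squnion>\<^bsub>L\<^esub> T" using a T by (intro cl_sup_insert) (simp_all add: cl_sup_closed)
  then show "a \<in> T" using sup[of "{a, \<Squnion>\<^bsub>L\<^esub> T}"] sup[OF T] a T by (simp add: cl_sup_closed)
qed (rule cl_sup_upper[OF T])

lemma cl_top_closed: "\<top>\<^bsub>L\<^esub> \<in> carrier L"
  by simp

lemma cl_meet_closed: "\<lbrakk>a \<in> carrier L; b \<in> carrier L\<rbrakk> \<Longrightarrow> a \<sqinter>\<^bsub>L\<^esub> b \<in> carrier L"
  by simp

lemma cl_meet_assoc:
  "\<lbrakk>a \<in> carrier L; b \<in> carrier L; c \<in> carrier L\<rbrakk> \<Longrightarrow> (a \<sqinter>\<^bsub>L\<^esub> b) \<sqinter>\<^bsub>L\<^esub> c = a \<sqinter>\<^bsub>L\<^esub> (b \<sqinter>\<^bsub>L\<^esub> c)"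
  by (rule meet_assoc)

lemma cl_le_meet_iff:
  "\<lbrakk>a \<in> carrier L; b \<in> carrier L; c \<in> carrier L\<rbrakk> \<Longrightarrow> c \<sqsubseteq>\<^bsub>L\<^esub> a \<sqinter>\<^bsub>L\<^esub> b \<longleftrightarrow> c \<sqsubseteq>\<^bsub>L\<^esub> a \<and> c \<sqsubseteq>\<^bsub>L\<^esub> b"
  by (meson le_trans meet_closed meet_le meet_left meet_right)

lemma cl_meet_top: "a \<in> carrier L \<Longrightarrow> a \<sqinter>\<^bsub>L\<^esub> \<top>\<^bsub>L\<^esub> = a"
  by (rule cl_eq_lowerI) (simp_all add: cl_le_meet_iff)

end

lemma meet_commute: "a \<sqinter>\<^bsub>L\<^esub> b = b \<sqinter>\<^bsub>L\<^esub> a"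
  by (simp add: meet_def insert_commute)

text \<open>\<open>least\<close> and \<open>Upper\<close> inspect the order only on the carrier, so
  even the choice operator behind the supremum picks the same element. This serves to pass between
  records such as \<open>A\<degree>\<degree>\<close> and \<open>A\<close>.\<close>

lemma sup_eq_if_same_order:
  assumes "carrier L = carrier M" "\<And>a b. a \<in> carrier L \<Longrightarrow> b \<in> carrier L \<Longrightarrow> a \<sqsubseteq>\<^bsub>L\<^esub> b \<longleftrightarrow> a \<sqsubseteq>\<^bsub>M\<^esub> b"
    and "S \<subseteq> carrier L"
  shows "\<Squnion>\<^bsub>L\<^esub> S = \<Squnion>\<^bsub>M\<^esub> S"
proof -
  have "least L x (Upper L S) \<longleftrightarrow> least M x (Upper M S)" for x
    using assms by (auto simp: least_def Upper_def)
  then show ?thesis by (simp add: sup_def)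
qed

text \<open>In contrast to \<open>sup_maps\<close>, extensionality is not demanded and completeness
  of both lattices is included. Composites can thus be written as plain lambda terms, and the
  predicate composes without side conditions.\<close>

definition sup_hom :: "('a, 'm) gorder_scheme \<Rightarrow> ('b, 'n) gorder_scheme \<Rightarrow> ('a \<Rightarrow> 'b) \<Rightarrow> bool" where
  "sup_hom L M f \<longleftrightarrow> complete_lattice L \<and> complete_lattice M \<and> f \<in> carrier L \<rightarrow> carrier M \<and>
     (\<forall>S. S \<subseteq> carrier L \<longrightarrow> f (\<Squnion>\<^bsub>L\<^esub> S) = \<Squnion>\<^bsub>M\<^esub> (f ` S))"

lemma sup_homD:
  assumes "sup_hom L M f"
  shows "complete_lattice L" "complete_lattice M" "\<And>a. a \<in> carrier L \<Longrightarrow> f a \<in> carrier M"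
    "\<And>S. S \<subseteq> carrier L \<Longrightarrow> f (\<Squnion>\<^bsub>L\<^esub> S) = \<Squnion>\<^bsub>M\<^esub> (f ` S)"
  using assms by (auto simp: sup_hom_def)

lemma sup_hom_sup_le_iff:
  assumes f: "sup_hom L M f" and S: "S \<subseteq> carrier L" and z: "z \<in> carrier M"
  shows "f (\<Squnion>\<^bsub>L\<^esub> S) \<sqsubseteq>\<^bsub>M\<^esub> z \<longleftrightarrow> (\<forall>a\<in>S. f a \<sqsubseteq>\<^bsub>M\<^esub> z)"
proof -
  have "f ` S \<subseteq> carrier M" using S sup_homD(3)[OF f] by auto
  then show ?thesis
    using sup_homD(2)[OF f] S z by (simp add: sup_homD(4)[OF f] cl_sup_le_iff)
qed

lemma sup_homI:
  assumes L: "complete_lattice L" and M: "complete_lattice M"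
    and f: "\<And>a. a \<in> carrier L \<Longrightarrow> f a \<in> carrier M"
    and le: "\<And>S z. S \<subseteq> carrier L \<Longrightarrow> z \<in> carrier M \<Longrightarrow> f (\<Squnion>\<^bsub>L\<^esub> S) \<sqsubseteq>\<^bsub>M\<^esub> z \<longleftrightarrow> (\<forall>a\<in>S. f a \<sqsubseteq>\<^bsub>M\<^esub> z)"
  shows "sup_hom L M f"
proof -
  have "f (\<Squnion>\<^bsub>L\<^esub> S) = \<Squnion>\<^bsub>M\<^esub> (f ` S)" if "S \<subseteq> carrier L" for S
    by (rule cl_sup_eqI[symmetric]) (use that M le f L in \<open>auto simp: cl_sup_closed\<close>)
  then show ?thesis using assms by (auto simp: sup_hom_def)
qed

text \<open>Left adjoints preserve suprema. This is the usual route to sup-preservation below: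
  adjoints between tensor products are explicit sets of pairs, whereas suprema of saturated sets are
  closures without a direct description.\<close>

lemma sup_hom_adjI:
  assumes L: "complete_lattice L" and M: "complete_lattice M"
    and f: "\<And>a. a \<in> carrier L \<Longrightarrow> f a \<in> carrier M"
    and g: "\<And>b. b \<in> carrier M \<Longrightarrow> g b \<in> carrier L"
    and le: "\<And>a b. a \<in> carrier L \<Longrightarrow> b \<in> carrier M \<Longrightarrow> f a \<sqsubseteq>\<^bsub>M\<^esub> b \<longleftrightarrow> a \<sqsubseteq>\<^bsub>L\<^esub> g b"
  shows "sup_hom L M f"
proof (rule sup_homI[OF L M f])
  fix S z assume "S \<subseteq> carrier L" "z \<in> carrier M"
  then show "f (\<Squnion>\<^bsub>L\<^esub> S) \<sqsubseteq>\<^bsub>M\<^esub> z \<longleftrightarrow> (\<forall>a\<in>S. f a \<sqsubseteq>\<^bsub>M\<^esub> z)"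
    by (simp add: le g cl_sup_le_iff[OF L] cl_sup_closed[OF L] subset_iff)
qed

lemma sup_hom_mono:
  assumes f: "sup_hom L M f" and ab: "a \<sqsubseteq>\<^bsub>L\<^esub> b" "a \<in> carrier L" "b \<in> carrier L"
  shows "f a \<sqsubseteq>\<^bsub>M\<^esub> f b"
proof -
  note D = sup_homD[OF f]
  have "f b = \<Squnion>\<^bsub>M\<^esub> {f a, f b}"
    using D(4)[of "{a, b}"] ab by (simp add: cl_sup_insert[OF D(1)])
  also have "f a \<sqsubseteq>\<^bsub>M\<^esub> \<dots>" by (rule cl_sup_upper[OF D(2)]) (use D(3) ab in auto)
  finally show ?thesis .
qed

lemma sup_hom_comp:
  assumes "sup_hom L M f" "sup_hom M N g" shows "sup_hom L N (\<lambda>a. g (f a))"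
proof -
  have "g (f (\<Squnion>\<^bsub>L\<^esub> S)) = \<Squnion>\<^bsub>N\<^esub> ((\<lambda>a. g (f a)) ` S)" if "S \<subseteq> carrier L" for S
  proof -
    have "f ` S \<subseteq> carrier M" using that assms by (auto dest: sup_homD(3))
    then show ?thesis using that assms by (simp add: sup_homD(4) image_image)
  qed
  then show ?thesis using assms by (auto simp: sup_hom_def)
qed

text \<open>Suprema of subsets of the carrier stay in the carrier, so values elsewhere do not
  matter. It replaces the restricted \<open>Map\<close> of a cell by the lambda term that defines
  it.\<close>

lemma sup_hom_cong:
  assumes "\<And>a. a \<in> carrier L \<Longrightarrow> f a = g a"
  shows "sup_hom L M f \<longleftrightarrow> sup_hom L M g"
proof (cases "complete_lattice L")
  case True
  have "f (\<Squnion>\<^bsub>L\<^esub> S) = g (\<Squnion>\<^bsub>L\<^esub> S)" "f ` S = g ` S" if "S \<subseteq> carrier L" for S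
    using that assms True by (auto simp: cl_sup_closed intro!: image_cong)
  then show ?thesis using assms by (auto simp: sup_hom_def Pi_iff)
qed (simp add: sup_hom_def)

lemma sup_hom_same_order:
  assumes "complete_lattice L'" "complete_lattice M'"
    and "carrier L' = carrier L" "\<And>a b. a \<in> carrier L \<Longrightarrow> b \<in> carrier L \<Longrightarrow> a \<sqsubseteq>\<^bsub>L'\<^esub> b \<longleftrightarrow> a \<sqsubseteq>\<^bsub>L\<^esub> b"
    and "carrier M' = carrier M" "\<And>a b. a \<in> carrier M \<Longrightarrow> b \<in> carrier M \<Longrightarrow> a \<sqsubseteq>\<^bsub>M'\<^esub> b \<longleftrightarrow> a \<sqsubseteq>\<^bsub>M\<^esub> b"
    and "sup_hom L M f"
  shows "sup_hom L' M' f"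
proof (rule sup_homI)
  fix S z assume S: "S \<subseteq> carrier L'" and z: "z \<in> carrier M'"
  have "\<Squnion>\<^bsub>L'\<^esub> S = \<Squnion>\<^bsub>L\<^esub> S" by (rule sup_eq_if_same_order) (use assms S in auto)
  moreover have "\<Squnion>\<^bsub>L\<^esub> S \<in> carrier L" using S assms by (simp add: cl_sup_closed sup_homD(1))
  ultimately show "f (\<Squnion>\<^bsub>L'\<^esub> S) \<sqsubseteq>\<^bsub>M'\<^esub> z \<longleftrightarrow> (\<forall>a\<in>S. f a \<sqsubseteq>\<^bsub>M'\<^esub> z)"
    using assms S z sup_hom_sup_le_iff[OF assms(7)] by (auto simp: sup_homD(3)[OF assms(7)] subset_iff)
qed (use assms in \<open>auto dest: sup_homD(3)\<close>)

lemma right_adjoint_closed: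
  assumes "sup_hom L M f" "b \<in> carrier M" shows "right_adjoint L M f b \<in> carrier L"
  using assms by (auto simp: right_adjoint_def intro!: cl_sup_closed sup_homD(1))

text \<open>The adjoint functor theorem for suplattices: since \<open>f\<close> preserves the
  supremum that defines the adjoint, that supremum belongs to the set over which it is
  taken.\<close>

lemma le_right_adjoint_iff:
  assumes f: "sup_hom L M f" and a: "a \<in> carrier L" and b: "b \<in> carrier M"
  shows "a \<sqsubseteq>\<^bsub>L\<^esub> right_adjoint L M f b \<longleftrightarrow> f a \<sqsubseteq>\<^bsub>M\<^esub> b"
proof -
  let ?S = "{a \<in> carrier L. f a \<sqsubseteq>\<^bsub>M\<^esub> b}"
  note D = sup_homD[OF f]
  have r: "right_adjoint L M f b = \<Squnion>\<^bsub>L\<^esub> ?S" using b by (simp add: right_adjoint_def)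
  have c: "\<Squnion>\<^bsub>L\<^esub> ?S \<in> carrier L" by (auto intro: cl_sup_closed[OF D(1)])
  have "f (\<Squnion>\<^bsub>L\<^esub> ?S) \<sqsubseteq>\<^bsub>M\<^esub> b"
    by (subst sup_hom_sup_le_iff[OF f]) (use b in auto)
  then have "f a \<sqsubseteq>\<^bsub>M\<^esub> b" if "a \<sqsubseteq>\<^bsub>L\<^esub> \<Squnion>\<^bsub>L\<^esub> ?S"
    using cl_trans[OF D(2) sup_hom_mono[OF f that a c]] D(3) a b c by simp
  moreover have "a \<sqsubseteq>\<^bsub>L\<^esub> \<Squnion>\<^bsub>L\<^esub> ?S" if "f a \<sqsubseteq>\<^bsub>M\<^esub> b"
    by (rule cl_sup_upper[OF D(1)]) (use that a in auto)
  ultimately show ?thesis unfolding r by blast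
qed

lemma right_adjoint_eqI:
  assumes f: "sup_hom L M f" and b: "b \<in> carrier M" and r: "r \<in> carrier L"
    and "\<And>a. a \<in> carrier L \<Longrightarrow> f a \<sqsubseteq>\<^bsub>M\<^esub> b \<longleftrightarrow> a \<sqsubseteq>\<^bsub>L\<^esub> r"
  shows "right_adjoint L M f b = r"
  by (rule cl_eq_lowerI[OF sup_homD(1)[OF f]])
    (use assms right_adjoint_closed in \<open>auto simp: le_right_adjoint_iff\<close>)

lemma sup_hom_id: "complete_lattice L \<Longrightarrow> sup_hom L L (\<lambda>a. a)"
  by (rule sup_homI) (simp_all add: cl_sup_le_iff)

section \<open>Modules\<close>

lemma is_localeD:
  assumes "is_locale X"
  shows "complete_lattice X" "\<And>x. x \<in> carrier X \<Longrightarrow> sup_hom X X (\<lambda>s. x \<sqinter>\<^bsub>X\<^esub> s)"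
  using assms by (auto simp: is_locale_def sup_hom_def cl_meet_closed)

text \<open>
  With source and target read off the record, typing conditions contain no variables besides the module,
  so that the simplifier can discharge them.
\<close>

definition bmod :: "('a, 'x, 'y) bimod \<Rightarrow> bool" where
  "bmod A \<longleftrightarrow> bimodule (src A) (tgt A) A"

lemma bimodule_iff_bmod: "bimodule X Y A \<longleftrightarrow> bmod A \<and> src A = X \<and> tgt A = Y"
  by (auto simp: bmod_def bimodule_def)

lemma bmodI:
  assumes "is_locale (src A)" "is_locale (tgt A)"
    and "\<And>x. x \<in> carrier (src A) \<Longrightarrow> sup_hom A A (lact A x)"
    and "\<And>a. a \<in> carrier A \<Longrightarrow> sup_hom (src A) A (\<lambda>x. lact A x a)"
    and "\<And>a. a \<in> carrier A \<Longrightarrow> lact A \<top>\<^bsub>src A\<^esub> a = a"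
    and "\<And>x x' a. \<lbrakk>x \<in> carrier (src A); x' \<in> carrier (src A); a \<in> carrier A\<rbrakk> \<Longrightarrow>
      lact A (x \<sqinter>\<^bsub>src A\<^esub> x') a = lact A x (lact A x' a)"
    and "\<And>y. y \<in> carrier (tgt A) \<Longrightarrow> sup_hom A A (\<lambda>a. ract A a y)"
    and "\<And>a. a \<in> carrier A \<Longrightarrow> sup_hom (tgt A) A (ract A a)"
    and "\<And>a. a \<in> carrier A \<Longrightarrow> ract A a \<top>\<^bsub>tgt A\<^esub> = a"
    and "\<And>y y' a. \<lbrakk>y \<in> carrier (tgt A); y' \<in> carrier (tgt A); a \<in> carrier A\<rbrakk> \<Longrightarrow>
      ract A a (y \<sqinter>\<^bsub>tgt A\<^esub> y') = ract A (ract A a y) y'"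
    and "\<And>x y a. \<lbrakk>x \<in> carrier (src A); y \<in> carrier (tgt A); a \<in> carrier A\<rbrakk> \<Longrightarrow>
      lact A x (ract A a y) = ract A (lact A x a) y"
  shows "bmod A"
proof -
  \<comment> \<open>Completeness is contained in \<open>sup_hom A A\<close> for the action of any
    one element, here the top of the source.\<close>
  have "complete_lattice A"
    using assms(1,3) cl_top_closed is_localeD(1) sup_homD(1) by blast
  then show ?thesis
    using assms unfolding bmod_def bimodule_def sup_hom_def Pi_iff by simp
qed

context
  fixes A :: "('a, 'x, 'y) bimod"
  assumes A: "bmod A"
begin

lemma bmod_cl: "complete_lattice A"
  and bmod_loc: "is_locale (src A)" "is_locale (tgt A)"
  using A by (auto simp: bmod_def bimodule_def)

lemma bmod_cl_src: "complete_lattice (src A)" and bmod_cl_tgt: "complete_lattice (tgt A)"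
  using bmod_loc by (auto dest: is_localeD)

lemma lact_closed: "\<lbrakk>x \<in> carrier (src A); a \<in> carrier A\<rbrakk> \<Longrightarrow> lact A x a \<in> carrier A"
  and lact_top: "a \<in> carrier A \<Longrightarrow> lact A \<top>\<^bsub>src A\<^esub> a = a"
  and lact_meet: "\<lbrakk>x \<in> carrier (src A); x' \<in> carrier (src A); a \<in> carrier A\<rbrakk> \<Longrightarrow>
      lact A (x \<sqinter>\<^bsub>src A\<^esub> x') a = lact A x (lact A x' a)"
  and ract_closed: "\<lbrakk>y \<in> carrier (tgt A); a \<in> carrier A\<rbrakk> \<Longrightarrow> ract A a y \<in> carrier A"
  and ract_top: "a \<in> carrier A \<Longrightarrow> ract A a \<top>\<^bsub>tgt A\<^esub> = a"
  and ract_meet: "\<lbrakk>y \<in> carrier (tgt A); y' \<in> carrier (tgt A); a \<in> carrier A\<rbrakk> \<Longrightarrow>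
      ract A a (y \<sqinter>\<^bsub>tgt A\<^esub> y') = ract A (ract A a y) y'"
  and lact_ract: "\<lbrakk>x \<in> carrier (src A); y \<in> carrier (tgt A); a \<in> carrier A\<rbrakk> \<Longrightarrow>
      lact A x (ract A a y) = ract A (lact A x a) y"
  using A unfolding bmod_def bimodule_def by simp_all

lemma lact_sup_hom: "x \<in> carrier (src A) \<Longrightarrow> sup_hom A A (lact A x)"
  and lact_sup_hom_src: "a \<in> carrier A \<Longrightarrow> sup_hom (src A) A (\<lambda>x. lact A x a)"
  and ract_sup_hom: "y \<in> carrier (tgt A) \<Longrightarrow> sup_hom A A (\<lambda>a. ract A a y)"
  and ract_sup_hom_tgt: "a \<in> carrier A \<Longrightarrow> sup_hom (tgt A) A (ract A a)"
  using A bmod_cl_src bmod_cl_tgt unfolding bmod_def bimodule_def sup_hom_def Pi_iff by simp_all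

end

lemmas bmod_simps = bmod_cl bmod_loc bmod_cl_src bmod_cl_tgt lact_closed lact_top
  ract_closed ract_top lact_sup_hom lact_sup_hom_src ract_sup_hom ract_sup_hom_tgt

subsection \<open>Opposites\<close>

lemma opposite_simps [simp]:
  "carrier (A\<degree>) = carrier A" "src (A\<degree>) = tgt A" "tgt (A\<degree>) = src A"
  "a \<sqsubseteq>\<^bsub>A\<degree>\<^esub> b \<longleftrightarrow> b \<sqsubseteq>\<^bsub>A\<^esub> a"
  by (simp_all add: opposite_def)

lemma opposite_cl:
  assumes "complete_lattice A"
  shows "complete_lattice (A\<degree>)"
proof (rule complete_lattice_supI)
  fix S assume S: "S \<subseteq> carrier (A\<degree>)"
  let ?i = "\<Squnion>\<^bsub>A\<^esub> {z \<in> carrier A. \<forall>a\<in>S. z \<sqsubseteq>\<^bsub>A\<^esub> a}"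
  have c: "?i \<in> carrier A" by (auto intro: cl_sup_closed[OF assms])
  have "z \<sqsubseteq>\<^bsub>A\<^esub> ?i" if "z \<in> carrier A" "\<forall>a\<in>S. z \<sqsubseteq>\<^bsub>A\<^esub> a" for z
    by (rule cl_sup_upper[OF assms]) (use that in auto)
  moreover have "?i \<sqsubseteq>\<^bsub>A\<^esub> a" if "a \<in> S" for a
    by (subst cl_sup_le_iff[OF assms]) (use S that in auto)
  ultimately show "\<exists>s\<in>carrier (A\<degree>). \<forall>z\<in>carrier (A\<degree>). s \<sqsubseteq>\<^bsub>A\<degree>\<^esub> z \<longleftrightarrow> (\<forall>a\<in>S. a \<sqsubseteq>\<^bsub>A\<degree>\<^esub> z)"
    using c S by (auto intro!: bexI[of _ ?i]) (meson assms cl_trans subsetD)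
qed (use assms in \<open>auto simp: cl_eq cl_refl intro: cl_trans cl_antisym, simp add: opposite_def cl_eq\<close>)

lemma lact_opposite [simp]: "lact (A\<degree>) y = right_adjoint A A (\<lambda>a. ract A a y)"
  and ract_opposite [simp]: "ract (A\<degree>) a x = right_adjoint A A (lact A x) a"
  by (simp_all add: opposite_def)

lemma le_lact_opposite_iff:
  "\<lbrakk>bmod A; y \<in> carrier (tgt A); a \<in> carrier A; b \<in> carrier A\<rbrakk> \<Longrightarrow> a \<sqsubseteq>\<^bsub>A\<^esub> lact (A\<degree>) y b \<longleftrightarrow> ract A a y \<sqsubseteq>\<^bsub>A\<^esub> b"
  by (simp add: le_right_adjoint_iff ract_sup_hom)

lemma le_ract_opposite_iff:
  "\<lbrakk>bmod A; x \<in> carrier (src A); a \<in> carrier A; b \<in> carrier A\<rbrakk> \<Longrightarrow> a \<sqsubseteq>\<^bsub>A\<^esub> ract (A\<degree>) b x \<longleftrightarrow> lact A x a \<sqsubseteq>\<^bsub>A\<^esub> b"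
  by (simp add: le_right_adjoint_iff lact_sup_hom)

declare lact_opposite [simp del] ract_opposite [simp del]

lemma opposite_act_closed:
  assumes "bmod A" "a \<in> carrier A"
  shows "y \<in> carrier (tgt A) \<Longrightarrow> lact (A\<degree>) y a \<in> carrier A"
    and "x \<in> carrier (src A) \<Longrightarrow> ract (A\<degree>) a x \<in> carrier A"
  using assms by (simp_all add: lact_opposite ract_opposite right_adjoint_closed bmod_simps)

text \<open>Tested against elements from below, each law for the adjoint actions becomes the
  corresponding law of \<open>A\<close>. Adjoints reverse composites, which is why the two actions
  change sides.\<close>

lemma opposite_bmod [simp]:
  assumes A: "bmod A" shows "bmod (A\<degree>)"
proof -
  note [simp] = opposite_act_closed[OF A] opposite_cl bmod_simps[OF A]
    le_lact_opposite_iff[OF A] le_ract_opposite_iff[OF A]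
  note eqI = cl_eq_lowerI[OF bmod_cl[OF A]]
  show ?thesis
  proof (rule bmodI)
    fix y assume "y \<in> carrier (src (A\<degree>))"
    then show "sup_hom (A\<degree>) (A\<degree>) (lact (A\<degree>) y)"
      by (intro sup_hom_adjI[where g = "\<lambda>a. ract A a y"]) auto
  next
    fix a assume "a \<in> carrier (A\<degree>)"
    \<comment> \<open>In the locale variable the adjoint is again a residual: the largest
      \<open>y\<close> such that \<open>b\<close> acted on by \<open>y\<close> lies below
      \<open>a\<close>.\<close>
    then show "sup_hom (src (A\<degree>)) (A\<degree>) (\<lambda>y. lact (A\<degree>) y a)"
      by (intro sup_hom_adjI[where g = "\<lambda>b. right_adjoint (tgt A) A (ract A b) a"])
        (auto simp: right_adjoint_closed le_right_adjoint_iff)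
  next
    fix a assume "a \<in> carrier (A\<degree>)"
    then show "lact (A\<degree>) \<top>\<^bsub>src (A\<degree>)\<^esub> a = a"
      by (intro eqI) (auto simp: cl_top_closed)
  next
    fix x x' a assume "x \<in> carrier (src (A\<degree>))" "x' \<in> carrier (src (A\<degree>))" "a \<in> carrier (A\<degree>)"
    then show "lact (A\<degree>) (x \<sqinter>\<^bsub>src (A\<degree>)\<^esub> x') a = lact (A\<degree>) x (lact (A\<degree>) x' a)"
      by (intro eqI) (auto simp: cl_meet_closed ract_meet[OF A])
  next
    fix y assume "y \<in> carrier (tgt (A\<degree>))"
    then show "sup_hom (A\<degree>) (A\<degree>) (\<lambda>a. ract (A\<degree>) a y)"
      by (intro sup_hom_adjI[where g = "lact A y"]) auto
  next
    fix a assume "a \<in> carrier (A\<degree>)"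
    then show "sup_hom (tgt (A\<degree>)) (A\<degree>) (ract (A\<degree>) a)"
      by (intro sup_hom_adjI[where g = "\<lambda>b. right_adjoint (src A) A (\<lambda>x. lact A x b) a"])
        (auto simp: right_adjoint_closed le_right_adjoint_iff)
  next
    fix a assume "a \<in> carrier (A\<degree>)"
    then show "ract (A\<degree>) a \<top>\<^bsub>tgt (A\<degree>)\<^esub> = a"
      by (intro eqI) (auto simp: cl_top_closed)
  next
    fix x x' a assume "x \<in> carrier (tgt (A\<degree>))" "x' \<in> carrier (tgt (A\<degree>))" "a \<in> carrier (A\<degree>)"
    then show "ract (A\<degree>) a (x \<sqinter>\<^bsub>tgt (A\<degree>)\<^esub> x') = ract (A\<degree>) (ract (A\<degree>) a x) x'"
      by (intro eqI) (auto simp: cl_meet_closed lact_meet[OF A, symmetric] meet_commute)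
  next
    fix x y a assume "x \<in> carrier (src (A\<degree>))" "y \<in> carrier (tgt (A\<degree>))" "a \<in> carrier (A\<degree>)"
    then show "lact (A\<degree>) x (ract (A\<degree>) a y) = ract (A\<degree>) (lact (A\<degree>) x a) y"
      by (intro eqI) (auto simp: lact_ract[OF A])
  qed auto
qed

text \<open>The right adjoint, formed in the opposite lattice, of a right adjoint is the original
  map. Equality holds only on the carriers because \<open>right_adjoint\<close> is a restricted
  function.\<close>

lemma opposite_opposite_act:
  assumes "bmod A" "a \<in> carrier A"
  shows "x \<in> carrier (src A) \<Longrightarrow> lact (A\<degree>\<degree>) x a = lact A x a"
    and "y \<in> carrier (tgt A) \<Longrightarrow> ract (A\<degree>\<degree>) a y = ract A a y"
proof -
  note A = assms(1) and a = assms(2)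
  have Ao: "bmod (A\<degree>)" using A by simp
  note [simp] = opposite_act_closed[OF A] opposite_act_closed[OF Ao, simplified] bmod_simps[OF A]
  show "lact (A\<degree>\<degree>) x a = lact A x a" if x: "x \<in> carrier (src A)"
  proof (rule cl_eq_upperI[OF bmod_cl[OF A]])
    fix c assume c: "c \<in> carrier A"
    then show "lact (A\<degree>\<degree>) x a \<sqsubseteq>\<^bsub>A\<^esub> c \<longleftrightarrow> lact A x a \<sqsubseteq>\<^bsub>A\<^esub> c"
      using le_lact_opposite_iff[OF Ao, of x c a] le_ract_opposite_iff[OF A, of x a c] a x by simp
  qed (use a x in auto)
  show "ract (A\<degree>\<degree>) a y = ract A a y" if y: "y \<in> carrier (tgt A)"
  proof (rule cl_eq_upperI[OF bmod_cl[OF A]])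
    fix c assume c: "c \<in> carrier A"
    then show "ract (A\<degree>\<degree>) a y \<sqsubseteq>\<^bsub>A\<^esub> c \<longleftrightarrow> ract A a y \<sqsubseteq>\<^bsub>A\<^esub> c"
      using le_ract_opposite_iff[OF Ao, of y c a] le_lact_opposite_iff[OF A, of y a c] a y by simp
  qed (use a y in auto)
qed

lemma sup_opposite_opposite:
  "S \<subseteq> carrier A \<Longrightarrow> \<Squnion>\<^bsub>A\<degree>\<degree>\<^esub> S = \<Squnion>\<^bsub>A\<^esub> S"
  by (rule sup_eq_if_same_order) auto

declare bmod_simps [simp] cl_top_closed [simp] cl_meet_closed [simp] opposite_act_closed [simp]

section \<open>The tensor product as a module\<close>

text \<open>Only the suplattice structure of the target enters. Equivariance for the outer locales
  is a separate condition in \<open>tensor_lift_ok\<close>, so that the actions on a tensor product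
  can be constructed from bimaps before it is known to be a module.\<close>

definition bimap :: "('a, 'x, 'y) bimod \<Rightarrow> ('b, 'y, 'z) bimod \<Rightarrow> ('c, 'm) gorder_scheme \<Rightarrow>
    ('a \<Rightarrow> 'b \<Rightarrow> 'c) \<Rightarrow> bool" where
  "bimap A B C \<phi> \<longleftrightarrow> (\<forall>b\<in>carrier B. sup_hom A C (\<lambda>a. \<phi> a b)) \<and> (\<forall>a\<in>carrier A. sup_hom B C (\<phi> a)) \<and>
     (\<forall>a\<in>carrier A. \<forall>y\<in>carrier (tgt A). \<forall>b\<in>carrier B. \<phi> (ract A a y) b = \<phi> a (lact B y b))"

lemma bimapI:
  assumes "\<And>b. b \<in> carrier B \<Longrightarrow> sup_hom A C (\<lambda>a. \<phi> a b)"
    and "\<And>a. a \<in> carrier A \<Longrightarrow> sup_hom B C (\<phi> a)"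
    and "\<And>a y b. \<lbrakk>a \<in> carrier A; y \<in> carrier (tgt A); b \<in> carrier B\<rbrakk> \<Longrightarrow> \<phi> (ract A a y) b = \<phi> a (lact B y b)"
  shows "bimap A B C \<phi>"
  using assms by (simp add: bimap_def)

lemma bimapD:
  assumes "bimap A B C \<phi>"
  shows "\<And>b. b \<in> carrier B \<Longrightarrow> sup_hom A C (\<lambda>a. \<phi> a b)"
    and "\<And>a. a \<in> carrier A \<Longrightarrow> sup_hom B C (\<phi> a)"
    and "\<And>a y b. \<lbrakk>a \<in> carrier A; y \<in> carrier (tgt A); b \<in> carrier B\<rbrakk> \<Longrightarrow> \<phi> (ract A a y) b = \<phi> a (lact B y b)"
    and "\<And>a b. \<lbrakk>a \<in> carrier A; b \<in> carrier B\<rbrakk> \<Longrightarrow> \<phi> a b \<in> carrier C"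
  using assms by (auto simp: bimap_def dest: sup_homD(3))

lemma bimap_comp:
  assumes "bimap A B C \<phi>" "sup_hom C D f" shows "bimap A B D (\<lambda>a b. f (\<phi> a b))"
  using assms by (auto simp: bimap_def intro: sup_hom_comp[where g = f])

abbreviation sup_lift :: "('c, 'm) gorder_scheme \<Rightarrow> ('a \<Rightarrow> 'b \<Rightarrow> 'c) \<Rightarrow> ('a \<times> 'b) set \<Rightarrow> 'c" where
  "sup_lift C \<phi> U \<equiv> \<Squnion>\<^bsub>C\<^esub> ((\<lambda>(a, b). \<phi> a b) ` U)"

definition lres :: "('b, 'm) gorder_scheme \<Rightarrow> 'a \<Rightarrow> ('a \<times> 'b) set \<Rightarrow> 'b" where
  "lres B a U = \<Squnion>\<^bsub>B\<^esub> {b \<in> carrier B. (a, b) \<in> U}"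

definition rres :: "('a, 'm) gorder_scheme \<Rightarrow> ('a \<times> 'b) set \<Rightarrow> 'b \<Rightarrow> 'a" where
  "rres A U b = \<Squnion>\<^bsub>A\<^esub> {a \<in> carrier A. (a, b) \<in> U}"

lemma lres_closed [simp]: "complete_lattice B \<Longrightarrow> lres B a U \<in> carrier B"
  by (auto simp: lres_def intro: cl_sup_closed)

lemma rres_closed [simp]: "complete_lattice A \<Longrightarrow> rres A U b \<in> carrier A"
  by (auto simp: rres_def intro: cl_sup_closed)

lemma tensor_simps [simp]:
  "src (A \<otimes> B) = src A" "tgt (A \<otimes> B) = tgt B" "U \<sqsubseteq>\<^bsub>A \<otimes> B\<^esub> V \<longleftrightarrow> U \<subseteq> V"
  "U \<in> carrier (A \<otimes> B) \<longleftrightarrow> saturated A B U"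
  by (simp_all add: tensor_def)

context
  fixes A :: "('a, 'x, 'y) bimod" and B :: "('b, 'y, 'z) bimod"
  assumes A [simp]: "bmod A" and B [simp]: "bmod B" and AB: "tgt A = src B"
begin

lemma saturatedD:
  assumes "saturated A B U"
  shows "U \<subseteq> carrier A \<times> carrier B"
    and "\<And>S b. \<lbrakk>S \<subseteq> carrier A; b \<in> carrier B\<rbrakk> \<Longrightarrow> (\<Squnion>\<^bsub>A\<^esub> S, b) \<in> U \<longleftrightarrow> (\<forall>a\<in>S. (a, b) \<in> U)"
    and "\<And>a T. \<lbrakk>a \<in> carrier A; T \<subseteq> carrier B\<rbrakk> \<Longrightarrow> (a, \<Squnion>\<^bsub>B\<^esub> T) \<in> U \<longleftrightarrow> (\<forall>b\<in>T. (a, b) \<in> U)"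
    and "\<And>a y b. \<lbrakk>a \<in> carrier A; y \<in> carrier (tgt A); b \<in> carrier B\<rbrakk> \<Longrightarrow>
      (ract A a y, b) \<in> U \<longleftrightarrow> (a, lact B y b) \<in> U"
  using assms unfolding saturated_def by simp_all

lemma le_lres_iff:
  assumes "saturated A B U" "a \<in> carrier A" "b \<in> carrier B"
  shows "b \<sqsubseteq>\<^bsub>B\<^esub> lres B a U \<longleftrightarrow> (a, b) \<in> U"
  unfolding lres_def using assms saturatedD(3)[OF assms(1)]
  by (subst cl_le_sup_iff_mem) (auto simp: cl_sup_closed)

lemma le_rres_iff:
  assumes "saturated A B U" "a \<in> carrier A" "b \<in> carrier B"
  shows "a \<sqsubseteq>\<^bsub>A\<^esub> rres A U b \<longleftrightarrow> (a, b) \<in> U"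
  unfolding rres_def using assms saturatedD(2)[OF assms(1)]
  by (subst cl_le_sup_iff_mem) (auto simp: cl_sup_closed)

lemma saturated_full: "saturated A B (carrier A \<times> carrier B)"
  by (auto simp: saturated_def cl_sup_closed AB)

lemma saturated_Inter:
  assumes "F \<noteq> {}" "\<And>U. U \<in> F \<Longrightarrow> saturated A B U"
  shows "saturated A B (\<Inter>F)"
proof -
  have "\<Inter>F \<subseteq> carrier A \<times> carrier B" using assms saturatedD(1) by blast
  then show ?thesis unfolding saturated_def
    by (simp add: saturatedD(2-4)[OF assms(2)] ball_conj_distrib) blast
qed

lemma saturated_saturation:
  "R \<subseteq> carrier A \<times> carrier B \<Longrightarrow> saturated A B (saturation A B R)"
  unfolding saturation_def by (rule saturated_Inter) (use saturated_full in auto)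

lemma saturation_subset_iff:
  "saturated A B V \<Longrightarrow> saturation A B R \<subseteq> V \<longleftrightarrow> R \<subseteq> V"
  unfolding saturation_def by blast

text \<open>Compatibility with suprema in one variable means that every section is a principal
  ideal, so it is enough to name a generator \<open>r\<close>. In all applications \<open>r\<close>
  is an adjoint or a residual.\<close>

lemma saturatedI:
  assumes "\<And>a b. (a, b) \<in> U \<Longrightarrow> a \<in> carrier A \<and> b \<in> carrier B"
    and "\<And>b. b \<in> carrier B \<Longrightarrow> \<exists>r\<in>carrier A. \<forall>a\<in>carrier A. (a, b) \<in> U \<longleftrightarrow> a \<sqsubseteq>\<^bsub>A\<^esub> r"
    and "\<And>a. a \<in> carrier A \<Longrightarrow> \<exists>r\<in>carrier B. \<forall>b\<in>carrier B. (a, b) \<in> U \<longleftrightarrow> b \<sqsubseteq>\<^bsub>B\<^esub> r"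
    and "\<And>a y b. \<lbrakk>a \<in> carrier A; y \<in> carrier (tgt A); b \<in> carrier B\<rbrakk> \<Longrightarrow>
      (ract A a y, b) \<in> U \<longleftrightarrow> (a, lact B y b) \<in> U"
  shows "saturated A B U"
  unfolding saturated_def
proof (intro conjI allI ballI impI; (elim conjE)?)
  fix S b assume S: "S \<subseteq> carrier A" and b: "b \<in> carrier B"
  obtain r where "r \<in> carrier A" "\<forall>a\<in>carrier A. (a, b) \<in> U \<longleftrightarrow> a \<sqsubseteq>\<^bsub>A\<^esub> r"
    using assms(2)[OF b] by blast
  then show "(\<Squnion>\<^bsub>A\<^esub> S, b) \<in> U \<longleftrightarrow> (\<forall>a\<in>S. (a, b) \<in> U)"
    using S by (simp add: cl_sup_closed cl_sup_le_iff subset_iff)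
next
  fix a T assume a: "a \<in> carrier A" and T: "T \<subseteq> carrier B"
  obtain r where "r \<in> carrier B" "\<forall>b\<in>carrier B. (a, b) \<in> U \<longleftrightarrow> b \<sqsubseteq>\<^bsub>B\<^esub> r"
    using assms(3)[OF a] by blast
  then show "(a, \<Squnion>\<^bsub>B\<^esub> T) \<in> U \<longleftrightarrow> (\<forall>b\<in>T. (a, b) \<in> U)"
    using T by (simp add: cl_sup_closed cl_sup_le_iff subset_iff)
qed (use assms in auto)

text \<open>The set is the value at \<open>c\<close> of the right adjoint of the map that
  \<open>\<phi>\<close> induces on \<open>A \<otimes> B\<close>. Its sections are generated by the
  adjoints of \<open>\<phi>\<close> in each variable.\<close>

lemma bimap_saturated:
  fixes C :: "('c, 'm) gorder_scheme"
  assumes \<phi>: "bimap A B C \<phi>" and c: "c \<in> carrier C"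
  shows "saturated A B {(a, b). a \<in> carrier A \<and> b \<in> carrier B \<and> \<phi> a b \<sqsubseteq>\<^bsub>C\<^esub> c}"
proof (rule saturatedI)
  fix b assume b: "b \<in> carrier B"
  show "\<exists>r\<in>carrier A. \<forall>a\<in>carrier A.
    (a, b) \<in> {(a, b). a \<in> carrier A \<and> b \<in> carrier B \<and> \<phi> a b \<sqsubseteq>\<^bsub>C\<^esub> c} \<longleftrightarrow> a \<sqsubseteq>\<^bsub>A\<^esub> r"
    using bimapD(1)[OF \<phi> b] b c
    by (intro bexI[of _ "right_adjoint A C (\<lambda>a. \<phi> a b) c"])
      (auto simp: le_right_adjoint_iff right_adjoint_closed)
next
  fix a assume a: "a \<in> carrier A"
  show "\<exists>r\<in>carrier B. \<forall>b\<in>carrier B.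
    (a, b) \<in> {(a, b). a \<in> carrier A \<and> b \<in> carrier B \<and> \<phi> a b \<sqsubseteq>\<^bsub>C\<^esub> c} \<longleftrightarrow> b \<sqsubseteq>\<^bsub>B\<^esub> r"
    using bimapD(2)[OF \<phi> a] a c
    by (intro bexI[of _ "right_adjoint B C (\<phi> a) c"])
      (auto simp: le_right_adjoint_iff right_adjoint_closed)
qed (use bimapD(3)[OF \<phi>] in \<open>auto simp: AB\<close>)

lemma tensor_cl: "complete_lattice (A \<otimes> B)"
proof (rule complete_lattice_supI)
  fix F assume "F \<subseteq> carrier (A \<otimes> B)"
  then have F: "\<And>U. U \<in> F \<Longrightarrow> saturated A B U" by auto
  have "\<Union>F \<subseteq> carrier A \<times> carrier B" using saturatedD(1)[OF F] by blast
  then show "\<exists>s\<in>carrier (A \<otimes> B). \<forall>z\<in>carrier (A \<otimes> B). s \<sqsubseteq>\<^bsub>A \<otimes> B\<^esub> z \<longleftrightarrow> (\<forall>a\<in>F. a \<sqsubseteq>\<^bsub>A \<otimes> B\<^esub> z)"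
    by (intro bexI[of _ "saturation A B (\<Union>F)"]) (auto simp: saturated_saturation saturation_subset_iff)
qed (auto simp: tensor_def)

lemma pure_closed: "\<lbrakk>a \<in> carrier A; b \<in> carrier B\<rbrakk> \<Longrightarrow> saturated A B (pure_tensor A B a b)"
  unfolding pure_tensor_def by (rule saturated_saturation) auto

lemma pure_le_iff: "saturated A B U \<Longrightarrow> pure_tensor A B a b \<subseteq> U \<longleftrightarrow> (a, b) \<in> U"
  unfolding pure_tensor_def by (simp add: saturation_subset_iff)

text \<open>The residuals are exactly the right adjoints of tensoring with a fixed element, which
  gives sup-preservation in each variable.\<close>

lemma pure_bimap: "bimap A B (A \<otimes> B) (pure_tensor A B)"
proof (rule bimapI)
  fix b assume b: "b \<in> carrier B"
  then show "sup_hom A (A \<otimes> B) (\<lambda>a. pure_tensor A B a b)"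
    by (intro sup_hom_adjI[where g = "\<lambda>U. rres A U b"])
      (auto simp: tensor_cl pure_closed pure_le_iff rres_closed le_rres_iff)
next
  fix a assume a: "a \<in> carrier A"
  then show "sup_hom B (A \<otimes> B) (pure_tensor A B a)"
    by (intro sup_hom_adjI[where g = "lres B a"])
      (auto simp: tensor_cl pure_closed pure_le_iff lres_closed le_lres_iff)
next
  fix a y b assume *: "a \<in> carrier A" "y \<in> carrier (tgt A)" "b \<in> carrier B"
  then show "pure_tensor A B (ract A a y) b = pure_tensor A B a (lact B y b)"
    by (intro cl_eq_upperI[OF tensor_cl]) (auto simp: pure_closed pure_le_iff saturatedD(4) AB)
qed

lemma sup_lift_le_iff:
  fixes C :: "('c, 'm) gorder_scheme"
  assumes \<phi>: "bimap A B C \<phi>" and C: "complete_lattice C"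
    and U: "U \<subseteq> carrier A \<times> carrier B" and c: "c \<in> carrier C"
  shows "sup_lift C \<phi> U \<sqsubseteq>\<^bsub>C\<^esub> c \<longleftrightarrow> (\<forall>(a, b)\<in>U. \<phi> a b \<sqsubseteq>\<^bsub>C\<^esub> c)"
  by (subst cl_sup_le_iff[OF C]) (use U c bimapD(4)[OF \<phi>] in auto)

text \<open>Suprema commute with suprema. The lemma handles the variable complementary to
  \<open>U\<close>: a locale element acting on a fixed \<open>U\<close>, or the third factor of an
  iterated tensor product.\<close>

lemma sup_hom_sup_lift:
  fixes C :: "('c, 'm) gorder_scheme"
  assumes L: "complete_lattice L" and C: "complete_lattice C" and U: "saturated A B U"
    and \<phi>: "\<And>l. l \<in> carrier L \<Longrightarrow> bimap A B C (\<phi> l)"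
    and sp: "\<And>a b. \<lbrakk>a \<in> carrier A; b \<in> carrier B\<rbrakk> \<Longrightarrow> sup_hom L C (\<lambda>l. \<phi> l a b)"
  shows "sup_hom L C (\<lambda>l. sup_lift C (\<phi> l) U)"
proof (rule sup_homI[OF L C])
  note sub = saturatedD(1)[OF U]
  show "sup_lift C (\<phi> l) U \<in> carrier C" if "l \<in> carrier L" for l
    by (rule cl_sup_closed[OF C]) (use sub bimapD(4)[OF \<phi>[OF that]] in auto)
  fix S z assume S: "S \<subseteq> carrier L" and z: "z \<in> carrier C"
  have "(\<forall>(a, b)\<in>U. \<phi> (\<Squnion>\<^bsub>L\<^esub> S) a b \<sqsubseteq>\<^bsub>C\<^esub> z) \<longleftrightarrow> (\<forall>l\<in>S. \<forall>(a, b)\<in>U. \<phi> l a b \<sqsubseteq>\<^bsub>C\<^esub> z)"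
    using sub sup_hom_sup_le_iff[OF sp S z] by fast
  then show "sup_lift C (\<phi> (\<Squnion>\<^bsub>L\<^esub> S)) U \<sqsubseteq>\<^bsub>C\<^esub> z \<longleftrightarrow> (\<forall>l\<in>S. sup_lift C (\<phi> l) U \<sqsubseteq>\<^bsub>C\<^esub> z)"
    using S z by (simp add: sup_lift_le_iff[OF \<phi> C sub] cl_sup_closed[OF L] subset_iff)
qed

lemma sup_lift_sup_hom:
  fixes C :: "('c, 'm) gorder_scheme"
  assumes \<phi>: "bimap A B C \<phi>" and C: "complete_lattice C"
  shows "sup_hom (A \<otimes> B) C (sup_lift C \<phi>)"
proof (rule sup_hom_adjI[where g = "\<lambda>c. {(a, b). a \<in> carrier A \<and> b \<in> carrier B \<and> \<phi> a b \<sqsubseteq>\<^bsub>C\<^esub> c}"])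
  fix U assume "U \<in> carrier (A \<otimes> B)"
  then have U: "U \<subseteq> carrier A \<times> carrier B" using saturatedD(1) by auto
  then show "sup_lift C \<phi> U \<in> carrier C"
    by (intro cl_sup_closed[OF C]) (auto intro: bimapD(4)[OF \<phi>])
  fix c assume "c \<in> carrier C"
  then show "sup_lift C \<phi> U \<sqsubseteq>\<^bsub>C\<^esub> c \<longleftrightarrow>
      U \<sqsubseteq>\<^bsub>A \<otimes> B\<^esub> {(a, b). a \<in> carrier A \<and> b \<in> carrier B \<and> \<phi> a b \<sqsubseteq>\<^bsub>C\<^esub> c}"
    using U by (subst sup_lift_le_iff[OF \<phi> C]) auto
qed (auto simp: C tensor_cl bimap_saturated[OF \<phi>])

text \<open>The saturated set \<open>pure_tensor A B a b\<close> contains many pairs besides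
  \<open>(a, b)\<close>. Comparison with the saturated set of all pairs on which
  \<open>\<phi>\<close> stays below \<open>c\<close> reduces the supremum to its generating
  pair.\<close>

lemma sup_lift_pure:
  fixes C :: "('c, 'm) gorder_scheme"
  assumes \<phi>: "bimap A B C \<phi>" and C: "complete_lattice C" and a: "a \<in> carrier A" and b: "b \<in> carrier B"
  shows "sup_lift C \<phi> (pure_tensor A B a b) = \<phi> a b"
proof (rule cl_eq_upperI[OF C])
  note s = saturatedD(1)[OF pure_closed[OF a b]]
  show "sup_lift C \<phi> (pure_tensor A B a b) \<in> carrier C"
    by (rule sup_homD(3)[OF sup_lift_sup_hom[OF \<phi> C]]) (simp add: pure_closed a b)
  show "\<phi> a b \<in> carrier C" by (rule bimapD(4)[OF \<phi> a b])
  fix c assume c: "c \<in> carrier C"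
  have "sup_lift C \<phi> (pure_tensor A B a b) \<sqsubseteq>\<^bsub>C\<^esub> c \<longleftrightarrow>
      pure_tensor A B a b \<subseteq> {(a, b). a \<in> carrier A \<and> b \<in> carrier B \<and> \<phi> a b \<sqsubseteq>\<^bsub>C\<^esub> c}"
    using s by (subst sup_lift_le_iff[OF \<phi> C s c]) auto
  also have "\<dots> \<longleftrightarrow> \<phi> a b \<sqsubseteq>\<^bsub>C\<^esub> c"
    by (simp add: pure_le_iff bimap_saturated[OF \<phi> c] a b)
  finally show "sup_lift C \<phi> (pure_tensor A B a b) \<sqsubseteq>\<^bsub>C\<^esub> c \<longleftrightarrow> \<phi> a b \<sqsubseteq>\<^bsub>C\<^esub> c" .
qed

lemma tensor_sup_pures:
  assumes U: "saturated A B U"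
  shows "sup_lift (A \<otimes> B) (pure_tensor A B) U = U"
proof (rule cl_sup_eqI[OF tensor_cl])
  fix V assume "V \<in> carrier (A \<otimes> B)"
  then show "U \<sqsubseteq>\<^bsub>A \<otimes> B\<^esub> V \<longleftrightarrow> (\<forall>W\<in>(\<lambda>(a, b). pure_tensor A B a b) ` U. W \<sqsubseteq>\<^bsub>A \<otimes> B\<^esub> V)"
    by (simp add: pure_le_iff case_prod_unfold) blast
qed (use U saturatedD(1)[OF U] in \<open>auto simp: pure_closed\<close>)

lemma sup_hom_eq_sup_lift:
  fixes C :: "('c, 'm) gorder_scheme"
  assumes f: "sup_hom (A \<otimes> B) C f" and U: "saturated A B U"
  shows "f U = sup_lift C (\<lambda>a b. f (pure_tensor A B a b)) U"
proof -
  have "(\<lambda>(a, b). pure_tensor A B a b) ` U \<subseteq> carrier (A \<otimes> B)"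
    using saturatedD(1)[OF U] by (auto simp: pure_closed)
  from sup_homD(4)[OF f this] show ?thesis
    using tensor_sup_pures[OF U] by (simp add: image_image case_prod_unfold)
qed

lemma sup_hom_tensor_ext:
  fixes C :: "('c, 'm) gorder_scheme"
  assumes f: "sup_hom (A \<otimes> B) C f" and g: "sup_hom (A \<otimes> B) C g"
    and eq: "\<And>a b. \<lbrakk>a \<in> carrier A; b \<in> carrier B\<rbrakk> \<Longrightarrow> f (pure_tensor A B a b) = g (pure_tensor A B a b)"
    and U: "saturated A B U"
  shows "f U = g U"
proof -
  have "(\<lambda>(a, b). f (pure_tensor A B a b)) ` U = (\<lambda>(a, b). g (pure_tensor A B a b)) ` U"
    using saturatedD(1)[OF U] eq by (intro image_cong) auto
  then show ?thesis
    by (simp add: sup_hom_eq_sup_lift[OF f U] sup_hom_eq_sup_lift[OF g U])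
qed

section \<open>The outer actions on a tensor product and on its opposite\<close>

lemma saturated_preimage:
  assumes u: "sup_hom A A u" and v: "sup_hom B B v" and V: "saturated A B V"
    and uy: "\<And>y a. y \<in> carrier (tgt A) \<Longrightarrow> a \<in> carrier A \<Longrightarrow> u (ract A a y) = ract A (u a) y"
    and vy: "\<And>y b. y \<in> carrier (src B) \<Longrightarrow> b \<in> carrier B \<Longrightarrow> v (lact B y b) = lact B y (v b)"
  shows "saturated A B {(a, b). a \<in> carrier A \<and> b \<in> carrier B \<and> (u a, v b) \<in> V}"
proof (rule saturatedI)
  note [simp] = sup_homD(3)[OF u] sup_homD(3)[OF v] right_adjoint_closed[OF u] right_adjoint_closed[OF v]
    le_right_adjoint_iff[OF u] le_right_adjoint_iff[OF v]
  let ?W = "{(a, b). a \<in> carrier A \<and> b \<in> carrier B \<and> (u a, v b) \<in> V}"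
  show "\<exists>r\<in>carrier A. \<forall>a\<in>carrier A. (a, b) \<in> ?W \<longleftrightarrow> a \<sqsubseteq>\<^bsub>A\<^esub> r" if "b \<in> carrier B" for b
    using that le_rres_iff[OF V] by (intro bexI[of _ "right_adjoint A A u (rres A V (v b))"]) simp_all
  show "\<exists>r\<in>carrier B. \<forall>b\<in>carrier B. (a, b) \<in> ?W \<longleftrightarrow> b \<sqsubseteq>\<^bsub>B\<^esub> r" if "a \<in> carrier A" for a
    using that le_lres_iff[OF V] by (intro bexI[of _ "right_adjoint B B v (lres B (u a) V)"]) simp_all
  fix a y b assume "a \<in> carrier A" "y \<in> carrier (tgt A)" "b \<in> carrier B"
  then show "(ract A a y, b) \<in> ?W \<longleftrightarrow> (a, lact B y b) \<in> ?W"
    using saturatedD(4)[OF V, of "u a" y "v b"] by (simp add: uy vy AB)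
qed auto

text \<open>\<open>u\<close> and \<open>v\<close> stand for an action on one factor and the identity
  on the other, so both outer actions are treated at once. Taking the preimage under the product of
  \<open>u\<close> and \<open>v\<close> is right adjoint to saturating the image. This single
  adjunction gives sup-preservation, the action on the opposite module and the value on pure
  tensors.\<close>

lemma saturation_image:
  assumes u: "sup_hom A A u" and v: "sup_hom B B v"
    and uy: "\<And>y a. y \<in> carrier (tgt A) \<Longrightarrow> a \<in> carrier A \<Longrightarrow> u (ract A a y) = ract A (u a) y"
    and vy: "\<And>y b. y \<in> carrier (src B) \<Longrightarrow> b \<in> carrier B \<Longrightarrow> v (lact B y b) = lact B y (v b)"
  shows "sup_hom (A \<otimes> B) (A \<otimes> B) (\<lambda>U. saturation A B ((\<lambda>(a, b). (u a, v b)) ` U))" (is "sup_hom _ _ ?f")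
    and "saturated A B V \<Longrightarrow> right_adjoint (A \<otimes> B) (A \<otimes> B) (\<lambda>U. saturation A B ((\<lambda>(a, b). (u a, v b)) ` U)) V =
      {(a, b). a \<in> carrier A \<and> b \<in> carrier B \<and> (u a, v b) \<in> V}"
    and "\<lbrakk>a \<in> carrier A; b \<in> carrier B\<rbrakk> \<Longrightarrow>
      saturation A B ((\<lambda>(a, b). (u a, v b)) ` pure_tensor A B a b) = pure_tensor A B (u a) (v b)"
proof -
  let ?g = "\<lambda>V. {(a, b). a \<in> carrier A \<and> b \<in> carrier B \<and> (u a, v b) \<in> V}"
  note g = saturated_preimage[OF u v _ uy vy]
  have c: "saturated A B (?f U)" if "saturated A B U" for U
    using saturatedD(1)[OF that] sup_homD(3)[OF u] sup_homD(3)[OF v] by (intro saturated_saturation) auto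
  have le: "?f U \<subseteq> V \<longleftrightarrow> U \<subseteq> ?g V" if "saturated A B U" "saturated A B V" for U V
    using saturatedD(1)[OF that(1)] by (subst saturation_subset_iff[OF that(2)]) auto
  show f: "sup_hom (A \<otimes> B) (A \<otimes> B) ?f"
    by (rule sup_hom_adjI[where g = ?g]) (simp_all add: tensor_cl c g le del: mem_Collect_eq)
  show "right_adjoint (A \<otimes> B) (A \<otimes> B) ?f V = ?g V" if "saturated A B V"
    by (rule right_adjoint_eqI[OF f]) (simp_all add: g le that)
  assume ab: "a \<in> carrier A" "b \<in> carrier B"
  note uv = sup_homD(3)[OF u ab(1)] sup_homD(3)[OF v ab(2)]
  show "?f (pure_tensor A B a b) = pure_tensor A B (u a) (v b)"
  proof (rule cl_eq_upperI[OF tensor_cl])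
    fix V assume "V \<in> carrier (A \<otimes> B)"
    then have V: "saturated A B V" by simp
    show "?f (pure_tensor A B a b) \<sqsubseteq>\<^bsub>A \<otimes> B\<^esub> V \<longleftrightarrow> pure_tensor A B (u a) (v b) \<sqsubseteq>\<^bsub>A \<otimes> B\<^esub> V"
      using ab by (simp add: le pure_closed V pure_le_iff g)
  qed (use ab uv in \<open>simp_all add: pure_closed c\<close>)
qed

lemma lact_tensor: "lact (A \<otimes> B) x = (\<lambda>U. saturation A B ((\<lambda>(a, b). (lact A x a, b)) ` U))"
  and ract_tensor: "ract (A \<otimes> B) U z = saturation A B ((\<lambda>(a, b). (a, ract B b z)) ` U)"
  by (simp_all add: tensor_def)

lemma lact_tensor_sup_hom: "x \<in> carrier (src A) \<Longrightarrow> sup_hom (A \<otimes> B) (A \<otimes> B) (lact (A \<otimes> B) x)"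
  and ract_tensor_dual: "\<lbrakk>x \<in> carrier (src A); saturated A B V\<rbrakk> \<Longrightarrow>
    ract ((A \<otimes> B)\<degree>) V x = {(a, b). a \<in> carrier A \<and> b \<in> carrier B \<and> (lact A x a, b) \<in> V}"
  and lact_pure: "\<lbrakk>x \<in> carrier (src A); a \<in> carrier A; b \<in> carrier B\<rbrakk> \<Longrightarrow>
    lact (A \<otimes> B) x (pure_tensor A B a b) = pure_tensor A B (lact A x a) b"
  unfolding ract_opposite lact_tensor by (rule saturation_image; simp add: sup_hom_id lact_ract)+

lemma ract_tensor_sup_hom: "z \<in> carrier (tgt B) \<Longrightarrow> sup_hom (A \<otimes> B) (A \<otimes> B) (\<lambda>U. ract (A \<otimes> B) U z)"
  and lact_tensor_dual: "\<lbrakk>z \<in> carrier (tgt B); saturated A B V\<rbrakk> \<Longrightarrow>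
    lact ((A \<otimes> B)\<degree>) z V = {(a, b). a \<in> carrier A \<and> b \<in> carrier B \<and> (a, ract B b z) \<in> V}"
  and ract_pure: "\<lbrakk>z \<in> carrier (tgt B); a \<in> carrier A; b \<in> carrier B\<rbrakk> \<Longrightarrow>
    ract (A \<otimes> B) (pure_tensor A B a b) z = pure_tensor A B a (ract B b z)"
  unfolding lact_opposite ract_tensor by (rule saturation_image; simp add: sup_hom_id lact_ract)+

text \<open>The action is a saturation whose dependence on \<open>x\<close> is not visibly additive.
  Expanding \<open>U\<close> into pure tensors moves \<open>x\<close> onto the first factor, where
  additivity is a module law of \<open>A\<close>.\<close>

lemma lact_tensor_sup_hom_src:
  assumes "saturated A B U"
  shows "sup_hom (src A) (A \<otimes> B) (\<lambda>x. lact (A \<otimes> B) x U)"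
proof -
  have "bimap A B (A \<otimes> B) (\<lambda>a b. lact (A \<otimes> B) x (pure_tensor A B a b))" if "x \<in> carrier (src A)" for x
    by (rule bimap_comp[OF pure_bimap lact_tensor_sup_hom[OF that]])
  moreover have "sup_hom (src A) (A \<otimes> B) (\<lambda>x. lact (A \<otimes> B) x (pure_tensor A B a b))"
    if "a \<in> carrier A" "b \<in> carrier B" for a b
    using sup_hom_comp[OF lact_sup_hom_src[OF A that(1)] bimapD(1)[OF pure_bimap that(2)]] that
    by (subst sup_hom_cong[OF lact_pure]) simp_all
  ultimately have "sup_hom (src A) (A \<otimes> B) (\<lambda>x. sup_lift (A \<otimes> B) (\<lambda>a b. lact (A \<otimes> B) x (pure_tensor A B a b)) U)"
    by (intro sup_hom_sup_lift) (simp_all add: assms tensor_cl)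
  then show ?thesis
    by (subst sup_hom_cong[OF sup_hom_eq_sup_lift[OF lact_tensor_sup_hom assms]])
qed

lemma ract_tensor_sup_hom_tgt:
  assumes "saturated A B U"
  shows "sup_hom (tgt B) (A \<otimes> B) (ract (A \<otimes> B) U)"
proof -
  have "bimap A B (A \<otimes> B) (\<lambda>a b. ract (A \<otimes> B) (pure_tensor A B a b) z)" if "z \<in> carrier (tgt B)" for z
    by (rule bimap_comp[OF pure_bimap ract_tensor_sup_hom[OF that]])
  moreover have "sup_hom (tgt B) (A \<otimes> B) (\<lambda>z. ract (A \<otimes> B) (pure_tensor A B a b) z)"
    if "a \<in> carrier A" "b \<in> carrier B" for a b
    using sup_hom_comp[OF ract_sup_hom_tgt[OF B that(2)] bimapD(2)[OF pure_bimap that(1)]] that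
    by (subst sup_hom_cong[OF ract_pure]) simp_all
  ultimately have "sup_hom (tgt B) (A \<otimes> B) (\<lambda>z. sup_lift (A \<otimes> B) (\<lambda>a b. ract (A \<otimes> B) (pure_tensor A B a b) z) U)"
    by (intro sup_hom_sup_lift) (simp_all add: assms tensor_cl)
  then show ?thesis
    by (subst sup_hom_cong[OF sup_hom_eq_sup_lift[OF ract_tensor_sup_hom assms]])
qed

lemma tensor_bmod: "bmod (A \<otimes> B)"
proof (rule bmodI)
  note [simp] = tensor_cl pure_closed lact_pure ract_pure
    lact_tensor_sup_hom ract_tensor_sup_hom lact_tensor_sup_hom_src ract_tensor_sup_hom_tgt
  note id = sup_hom_id[OF tensor_cl]
  note comp = sup_hom_comp[OF lact_tensor_sup_hom lact_tensor_sup_hom]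
    sup_hom_comp[OF ract_tensor_sup_hom ract_tensor_sup_hom]
    sup_hom_comp[OF lact_tensor_sup_hom ract_tensor_sup_hom]
    sup_hom_comp[OF ract_tensor_sup_hom lact_tensor_sup_hom]
  show "lact (A \<otimes> B) \<top>\<^bsub>src (A \<otimes> B)\<^esub> U = U" if U: "U \<in> carrier (A \<otimes> B)" for U
  proof -
    \<comment> \<open>Writing the right-hand side as a function applied to \<open>U\<close> lets the
      extensionality rule see two sup-preserving maps, to be compared on pure tensors.\<close>
    have "lact (A \<otimes> B) \<top>\<^bsub>src A\<^esub> U = (\<lambda>U. U) U"
      by (rule sup_hom_tensor_ext[OF lact_tensor_sup_hom id]) (use U in auto)
    then show ?thesis by simp
  qed
  show "ract (A \<otimes> B) U \<top>\<^bsub>tgt (A \<otimes> B)\<^esub> = U" if U: "U \<in> carrier (A \<otimes> B)" for U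
  proof -
    have "ract (A \<otimes> B) U \<top>\<^bsub>tgt B\<^esub> = (\<lambda>U. U) U"
      by (rule sup_hom_tensor_ext[OF ract_tensor_sup_hom id]) (use U in auto)
    then show ?thesis by simp
  qed
  show "lact (A \<otimes> B) (x \<sqinter>\<^bsub>src (A \<otimes> B)\<^esub> x') U = lact (A \<otimes> B) x (lact (A \<otimes> B) x' U)"
    if "x \<in> carrier (src (A \<otimes> B))" "x' \<in> carrier (src (A \<otimes> B))" "U \<in> carrier (A \<otimes> B)" for x x' U
    unfolding tensor_simps
    by (rule sup_hom_tensor_ext[OF lact_tensor_sup_hom comp(1)]) (use that in \<open>auto simp: lact_meet\<close>)
  show "ract (A \<otimes> B) U (x \<sqinter>\<^bsub>tgt (A \<otimes> B)\<^esub> x') = ract (A \<otimes> B) (ract (A \<otimes> B) U x) x'"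
    if "x \<in> carrier (tgt (A \<otimes> B))" "x' \<in> carrier (tgt (A \<otimes> B))" "U \<in> carrier (A \<otimes> B)" for x x' U
    unfolding tensor_simps
    by (rule sup_hom_tensor_ext[OF ract_tensor_sup_hom comp(2)]) (use that in \<open>auto simp: ract_meet\<close>)
  show "lact (A \<otimes> B) x (ract (A \<otimes> B) U y) = ract (A \<otimes> B) (lact (A \<otimes> B) x U) y"
    if "x \<in> carrier (src (A \<otimes> B))" "y \<in> carrier (tgt (A \<otimes> B))" "U \<in> carrier (A \<otimes> B)" for x y U
    by (rule sup_hom_tensor_ext[OF comp(4) comp(3)]) (use that in \<open>auto\<close>)
qed (simp_all add: tensor_cl lact_tensor_sup_hom ract_tensor_sup_hom lact_tensor_sup_hom_src ract_tensor_sup_hom_tgt)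

end

declare tensor_bmod [simp] pure_closed [simp] lact_pure [simp] ract_pure [simp]

text \<open>From here on \<open>U \<in> carrier (A \<otimes> B)\<close> is the normal form of saturation.\<close>

declare tensor_simps(4) [simp del]

lemma saturated_iff [simp]: "saturated A B U \<longleftrightarrow> U \<in> carrier (A \<otimes> B)"
  by (simp add: tensor_simps)

lemma pure_in_tensor [simp]:
  "\<lbrakk>bmod A; bmod B; tgt A = src B; a \<in> carrier A; b \<in> carrier B\<rbrakk> \<Longrightarrow> pure_tensor A B a b \<in> carrier (A \<otimes> B)"
  using pure_closed[of A B a b] by simp

section \<open>Module homomorphisms as 2-cells\<close>

text \<open>A predicate of the cell alone, including the module laws of its two ends: the simplifier
  can discharge it without guessing a domain and a codomain. The equivalence with the typing
  judgement is \<open>is_cell_iff\<close>.\<close>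

definition cell_ok :: "('a, 'b, 'x, 'y) cell \<Rightarrow> bool" where
  "cell_ok f \<longleftrightarrow> bmod (Dom f) \<and> bmod (Cod f) \<and> src (Dom f) = src (Cod f) \<and> tgt (Dom f) = tgt (Cod f) \<and>
     sup_hom (Dom f) (Cod f) (Map f) \<and> Map f \<in> extensional (carrier (Dom f)) \<and>
     (\<forall>x\<in>carrier (src (Cod f)). \<forall>a\<in>carrier (Dom f). Map f (lact (Dom f) x a) = lact (Cod f) x (Map f a)) \<and>
     (\<forall>y\<in>carrier (tgt (Cod f)). \<forall>a\<in>carrier (Dom f). Map f (ract (Dom f) a y) = ract (Cod f) (Map f a) y)"

lemma is_cell_iff:
  "bmod A \<Longrightarrow> bmod B \<Longrightarrow> (f :\<^sub>2 A \<rightarrow> B) \<longleftrightarrow> cell_ok f \<and> Dom f = A \<and> Cod f = B"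
  unfolding is_cell_def cell_ok_def left_homs_def right_homs_def sup_maps_def sup_hom_def PiE_def
  by auto

lemma cell_okD:
  assumes "cell_ok f"
  shows "bmod (Dom f)" "bmod (Cod f)" "src (Dom f) = src (Cod f)" "tgt (Dom f) = tgt (Cod f)"
    and "sup_hom (Dom f) (Cod f) (Map f)" "Map f \<in> extensional (carrier (Dom f))"
    and "\<And>x a. \<lbrakk>x \<in> carrier (src (Cod f)); a \<in> carrier (Dom f)\<rbrakk> \<Longrightarrow> Map f (lact (Dom f) x a) = lact (Cod f) x (Map f a)"
    and "\<And>y a. \<lbrakk>y \<in> carrier (tgt (Cod f)); a \<in> carrier (Dom f)\<rbrakk> \<Longrightarrow> Map f (ract (Dom f) a y) = ract (Cod f) (Map f a) y"
  using assms by (auto simp: cell_ok_def)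

lemma cell_closed [simp]:
  "\<lbrakk>cell_ok f; carrier (Cod f) = C; a \<in> carrier (Dom f)\<rbrakk> \<Longrightarrow> Map f a \<in> C"
  by (auto dest: cell_okD(5) sup_homD(3))

lemma cell_eqI:
  assumes "cell_ok f" "cell_ok g" "Dom f = Dom g" "Cod f = Cod g"
    and "\<And>a. a \<in> carrier (Dom f) \<Longrightarrow> Map f a = Map g a"
  shows "f = g"
proof -
  have "Map f = Map g"
    by (rule extensionalityI[of _ "carrier (Dom f)"]) (use assms cell_okD(6)[of g] in \<open>auto dest: cell_okD\<close>)
  then show ?thesis using assms by (cases f; cases g) simp
qed

lemma id2_simps [simp]:
  "Dom (id2 A) = A" "Cod (id2 A) = A" "a \<in> carrier A \<Longrightarrow> Map (id2 A) a = a"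
  by (simp_all add: id2_def)

lemma vcomp_simps [simp]:
  "Dom (f \<Zsemi> g) = Dom f" "Cod (f \<Zsemi> g) = Cod g"
  "a \<in> carrier (Dom f) \<Longrightarrow> Map (f \<Zsemi> g) a = Map g (Map f a)"
  by (simp_all add: vcomp_def compose_eq)

lemma id2_ok [simp]: "bmod A \<Longrightarrow> cell_ok (id2 A)"
  unfolding cell_ok_def
  by (simp add: sup_hom_cong[where f = "Map (id2 A)" and g = "\<lambda>a. a"] sup_hom_id) (simp add: id2_def)

lemma vcomp_ok [simp]:
  assumes "cell_ok f" "cell_ok g" "Cod f = Dom g" shows "cell_ok (f \<Zsemi> g)"
  using cell_okD[OF assms(1)] cell_okD[OF assms(2)] assms(1,3)
    sup_hom_comp[OF cell_okD(5)[OF assms(1)], of "Cod g" "Map g"]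
    sup_hom_cong[of "Dom f" "Map (f \<Zsemi> g)" "\<lambda>a. Map g (Map f a)" "Cod g"]
  by (simp add: cell_ok_def) (simp add: vcomp_def compose_def)

declare cell_okD(1-4) [simp]

lemma id2_vcomp: "cell_ok f \<Longrightarrow> Dom f = A \<Longrightarrow> id2 A \<Zsemi> f = f"
  by (rule cell_eqI) auto

lemma vcomp_id2: "cell_ok f \<Longrightarrow> Cod f = B \<Longrightarrow> f \<Zsemi> id2 B = f"
  by (rule cell_eqI) auto

lemma vcomp_assoc:
  "\<lbrakk>cell_ok f; cell_ok g; cell_ok h; Cod f = Dom g; Cod g = Dom h\<rbrakk> \<Longrightarrow> f \<Zsemi> g \<Zsemi> h = f \<Zsemi> (g \<Zsemi> h)"
  by (rule cell_eqI) auto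

subsection \<open>Invertible 2-cells\<close>

text \<open>Bijectivity replaces the existence of an inverse cell, since the set-theoretic inverse
  is automatically a homomorphism by \<open>inv2_ok\<close>. Agreement with the categorical notion
  is \<open>is_iso_iff\<close>.\<close>

definition iso_ok :: "('a, 'b, 'x, 'y) cell \<Rightarrow> bool" where
  "iso_ok f \<longleftrightarrow> cell_ok f \<and> bij_betw (Map f) (carrier (Dom f)) (carrier (Cod f))"

lemma inv2_simps [simp]: "Dom (inv2 f) = Cod f" "Cod (inv2 f) = Dom f"
  by (simp_all add: inv2_def)

lemma iso_cell_ok [simp]: "iso_ok f \<Longrightarrow> cell_ok f"
  by (simp add: iso_ok_def)

lemma inv2_Map [simp]:
  assumes "iso_ok f"
  shows "a \<in> carrier (Dom f) \<Longrightarrow> Map (inv2 f) (Map f a) = a"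
    and "b \<in> carrier (Cod f) \<Longrightarrow> Map f (Map (inv2 f) b) = b"
  using assms by (auto simp: inv2_def iso_ok_def bij_betw_def f_inv_into_f)

lemma inv2_eqI: "\<lbrakk>iso_ok f; a \<in> carrier (Dom f); Map f a = b\<rbrakk> \<Longrightarrow> Map (inv2 f) b = a"
  by auto

lemma inv2_closed:
  assumes "iso_ok f" "b \<in> carrier (Cod f)" shows "Map (inv2 f) b \<in> carrier (Dom f)"
  using assms by (auto simp: inv2_def iso_ok_def bij_betw_def inv_into_into)

text \<open>Each law for the inverse is checked after applying the injective map \<open>f\<close>,
  where it becomes the corresponding law for \<open>f\<close>.\<close>

lemma inv2_ok [simp]:
  assumes f: "iso_ok f" shows "cell_ok (inv2 f)"
proof -
  note D = cell_okD[OF iso_cell_ok[OF f]]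
  note [simp] = inv2_closed[OF f] D(1,2)
  have "sup_hom (Cod f) (Dom f) (Map (inv2 f))"
  proof -
    have "Map (inv2 f) (\<Squnion>\<^bsub>Cod f\<^esub> S) = \<Squnion>\<^bsub>Dom f\<^esub> (Map (inv2 f) ` S)" if S: "S \<subseteq> carrier (Cod f)" for S
    proof (rule inv2_eqI[OF f])
      have sub: "Map (inv2 f) ` S \<subseteq> carrier (Dom f)" using S by auto
      then show "\<Squnion>\<^bsub>Dom f\<^esub> (Map (inv2 f) ` S) \<in> carrier (Dom f)" by (simp add: cl_sup_closed)
      have "Map f ` Map (inv2 f) ` S = S" using S f by (force simp: image_image)
      then show "Map f (\<Squnion>\<^bsub>Dom f\<^esub> (Map (inv2 f) ` S)) = \<Squnion>\<^bsub>Cod f\<^esub> S"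
        using sup_homD(4)[OF D(5) sub] by simp
    qed
    then show ?thesis by (auto simp: sup_hom_def)
  qed
  moreover have "Map (inv2 f) (lact (Cod f) x b) = lact (Dom f) x (Map (inv2 f) b)"
    if "x \<in> carrier (src (Cod f))" "b \<in> carrier (Cod f)" for x b
    by (rule inv2_eqI[OF f]) (use that f in \<open>simp_all add: D(7)\<close>)
  moreover have "Map (inv2 f) (ract (Cod f) b y) = ract (Dom f) (Map (inv2 f) b) y"
    if "y \<in> carrier (tgt (Cod f))" "b \<in> carrier (Cod f)" for y b
    by (rule inv2_eqI[OF f]) (use that f in \<open>simp_all add: D(8)\<close>)
  moreover have "Map (inv2 f) \<in> extensional (carrier (Cod f))" by (simp add: inv2_def)
  ultimately show ?thesis using D(1-4) unfolding cell_ok_def by simp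
qed

lemma iso_okI_bij:
  assumes "cell_ok f"
    and "\<And>b. b \<in> carrier (Cod f) \<Longrightarrow> g b \<in> carrier (Dom f)"
    and "\<And>a. a \<in> carrier (Dom f) \<Longrightarrow> g (Map f a) = a"
    and "\<And>b. b \<in> carrier (Cod f) \<Longrightarrow> Map f (g b) = b"
  shows "iso_ok f"
  using assms unfolding iso_ok_def by (auto intro!: bij_betw_byWitness[where f' = g])

lemma iso_okI:
  assumes "cell_ok f" "cell_ok g" "Dom g = Cod f" "Cod g = Dom f"
    and "f \<Zsemi> g = id2 (Dom f)" and "g \<Zsemi> f = id2 (Cod f)"
  shows "iso_ok f"
proof (rule iso_okI_bij[where g = "Map g", OF assms(1)])
  fix a assume "a \<in> carrier (Dom f)"
  then show "Map g (Map f a) = a" using vcomp_simps(3)[of a f g] assms(5) by simp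
next
  fix b assume "b \<in> carrier (Cod f)"
  then show "Map f (Map g b) = b" "Map g b \<in> carrier (Dom f)" using vcomp_simps(3)[of b g f] assms(2-4,6) by simp_all
qed

lemma vcomp_inv2: "iso_ok f \<Longrightarrow> Cod f = B \<Longrightarrow> inv2 f \<Zsemi> f = id2 B"
  and inv2_vcomp: "iso_ok f \<Longrightarrow> Dom f = A \<Longrightarrow> f \<Zsemi> inv2 f = id2 A"
  by (rule cell_eqI; auto dest: iso_cell_ok cell_okD)+

lemma is_iso_iff:
  assumes [simp]: "bmod A" "bmod B"
  shows "(f :\<^sub>2 A \<cong> B) \<longleftrightarrow> iso_ok f \<and> Dom f = A \<and> Cod f = B"
proof
  assume "f :\<^sub>2 A \<cong> B"
  then show "iso_ok f \<and> Dom f = A \<and> Cod f = B"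
    unfolding is_iso_def is_cell_iff[OF assms] is_cell_iff[OF assms(2,1)] by (auto intro: iso_okI)
next
  assume "iso_ok f \<and> Dom f = A \<and> Cod f = B"
  then show "f :\<^sub>2 A \<cong> B"
    unfolding is_iso_def is_cell_iff[OF assms] is_cell_iff[OF assms(2,1)]
    by (auto simp: vcomp_inv2 inv2_vcomp intro!: exI[of _ "inv2 f"])
qed

lemma vcomp_iso [simp]:
  "\<lbrakk>iso_ok f; iso_ok g; Cod f = Dom g\<rbrakk> \<Longrightarrow> iso_ok (f \<Zsemi> g)"
  by (rule iso_okI_bij[where g = "Map (inv2 g \<Zsemi> inv2 f)"]) (auto simp: inv2_closed)

lemma inv2_iso [simp]: "iso_ok f \<Longrightarrow> iso_ok (inv2 f)"
  by (rule iso_okI_bij[where g = "Map f"]) auto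

lemma id2_iso [simp]: "bmod A \<Longrightarrow> iso_ok (id2 A)"
  by (rule iso_okI_bij[where g = "\<lambda>a. a"]) auto

section \<open>The first bicategory structure\<close>

lemma tensor_lift_simps [simp]: "Dom (tensor_lift A B C \<phi>) = A \<otimes> B" "Cod (tensor_lift A B C \<phi>) = C"
  "U \<in> carrier (A \<otimes> B) \<Longrightarrow> Map (tensor_lift A B C \<phi>) U = sup_lift C \<phi> U"
  by (simp_all add: tensor_lift_def)

lemma tensor_cell_ext:
  assumes "cell_ok f" "cell_ok g" "Dom f = A \<otimes> B" "Dom g = A \<otimes> B" "Cod f = Cod g"
    and "bmod A" "bmod B" "tgt A = src B"
    and "\<And>a b. \<lbrakk>a \<in> carrier A; b \<in> carrier B\<rbrakk> \<Longrightarrow> Map f (pure_tensor A B a b) = Map g (pure_tensor A B a b)"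
  shows "f = g"
proof (rule cell_eqI)
  fix U assume U: "U \<in> carrier (Dom f)"
  show "Map f U = Map g U"
    by (rule sup_hom_tensor_ext[OF assms(6-8), of "Cod f"])
      (use assms U cell_okD(5)[of f] cell_okD(5)[of g] in auto)
qed (use assms in auto)

lemma tensor_lift_pure:
  assumes "bmod A" "bmod B" "tgt A = src B" "complete_lattice C" "bimap A B C \<phi>"
    and "a \<in> carrier A" "b \<in> carrier B"
  shows "Map (tensor_lift A B C \<phi>) (pure_tensor A B a b) = \<phi> a b"
  using assms by (simp add: sup_lift_pure)

text \<open>For a fixed locale element, acting before and acting after the induced map are both
  sup-preserving, so the equivariance of \<open>\<phi>\<close> on pure tensors extends to the whole
  tensor product.\<close>

lemma tensor_lift_ok:
  assumes [simp]: "bmod A" "bmod B" and AB: "tgt A = src B"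
    and C [simp]: "bmod C" "src C = src A" "tgt C = tgt B"
    and \<phi>: "bimap A B C \<phi>"
    and l: "\<And>x a b. \<lbrakk>x \<in> carrier (src A); a \<in> carrier A; b \<in> carrier B\<rbrakk> \<Longrightarrow> \<phi> (lact A x a) b = lact C x (\<phi> a b)"
    and r: "\<And>z a b. \<lbrakk>z \<in> carrier (tgt B); a \<in> carrier A; b \<in> carrier B\<rbrakk> \<Longrightarrow> \<phi> a (ract B b z) = ract C (\<phi> a b) z"
  shows "cell_ok (tensor_lift A B C \<phi>)"
proof -
  let ?f = "sup_lift C \<phi>"
  have f: "sup_hom (A \<otimes> B) C ?f" by (rule sup_lift_sup_hom) (simp_all add: AB \<phi>)
  have AB' [simp]: "bmod (A \<otimes> B)" using AB by simp
  have "?f (lact (A \<otimes> B) x U) = lact C x (?f U)"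
    if x: "x \<in> carrier (src A)" and U: "U \<in> carrier (A \<otimes> B)" for x U
  proof (rule sup_hom_tensor_ext[where A = A and B = B])
    show "sup_hom (A \<otimes> B) C (\<lambda>U. ?f (lact (A \<otimes> B) x U))"
      by (rule sup_hom_comp[OF lact_sup_hom f]) (simp_all add: x)
    show "sup_hom (A \<otimes> B) C (\<lambda>U. lact C x (?f U))"
      by (rule sup_hom_comp[OF f lact_sup_hom]) (simp_all add: x)
  qed (use U x in \<open>simp_all add: AB \<phi> sup_lift_pure l\<close>)
  moreover have "?f (ract (A \<otimes> B) U z) = ract C (?f U) z"
    if z: "z \<in> carrier (tgt B)" and U: "U \<in> carrier (A \<otimes> B)" for z U
  proof (rule sup_hom_tensor_ext[where A = A and B = B])
    show "sup_hom (A \<otimes> B) C (\<lambda>U. ?f (ract (A \<otimes> B) U z))"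
      by (rule sup_hom_comp[OF ract_sup_hom f]) (simp_all add: z)
    show "sup_hom (A \<otimes> B) C (\<lambda>U. ract C (?f U) z)"
      by (rule sup_hom_comp[OF f ract_sup_hom]) (simp_all add: z)
  qed (use U z in \<open>simp_all add: AB \<phi> sup_lift_pure r\<close>)
  moreover have "sup_hom (A \<otimes> B) C (Map (tensor_lift A B C \<phi>))"
    using f by (subst sup_hom_cong[where g = ?f]) auto
  ultimately show ?thesis
    unfolding cell_ok_def by (auto simp: AB) (simp add: tensor_lift_def)
qed

lemma tensor2_simps [simp]: "Dom (f \<otimes>\<^sub>2 g) = Dom f \<otimes> Dom g" "Cod (f \<otimes>\<^sub>2 g) = Cod f \<otimes> Cod g"
  by (simp_all add: tensor2_def)

lemma sup_hom_pure:
  assumes "bmod A" "bmod B" "tgt A = src B"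
  shows "b \<in> carrier B \<Longrightarrow> sup_hom A (A \<otimes> B) (\<lambda>a. pure_tensor A B a b)"
    and "a \<in> carrier A \<Longrightarrow> sup_hom B (A \<otimes> B) (pure_tensor A B a)"
  using pure_bimap[OF assms] by (auto dest: bimapD)

lemma pure_balanced:
  assumes "bmod A" "bmod B" "tgt A = src B" "a \<in> carrier A" "y \<in> carrier (src B)" "b \<in> carrier B"
  shows "pure_tensor A B (ract A a y) b = pure_tensor A B a (lact B y b)"
  using bimapD(3)[OF pure_bimap[OF assms(1-3)]] assms by simp

lemma tensor2_bimap:
  assumes f: "cell_ok f" and g: "cell_ok g" and fg: "tgt (Cod f) = src (Cod g)"
  shows "bimap (Dom f) (Dom g) (Cod f \<otimes> Cod g) (\<lambda>a b. pure_tensor (Cod f) (Cod g) (Map f a) (Map g b))"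
proof (rule bimapI)
  note [simp] = cell_okD[OF f] cell_okD[OF g]
  fix b assume b: "b \<in> carrier (Dom g)"
  show "sup_hom (Dom f) (Cod f \<otimes> Cod g) (\<lambda>a. pure_tensor (Cod f) (Cod g) (Map f a) (Map g b))"
    by (rule sup_hom_comp[OF cell_okD(5)[OF f] sup_hom_pure(1)]) (use f g fg b in auto)
next
  note [simp] = cell_okD[OF f] cell_okD[OF g]
  fix a assume a: "a \<in> carrier (Dom f)"
  show "sup_hom (Dom g) (Cod f \<otimes> Cod g) (\<lambda>b. pure_tensor (Cod f) (Cod g) (Map f a) (Map g b))"
    by (rule sup_hom_comp[OF cell_okD(5)[OF g] sup_hom_pure(2)]) (use f g fg a in auto)
next
  note [simp] = cell_okD(1-4,7,8)[OF f] cell_okD(1-4,7,8)[OF g]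
  fix a y b assume "a \<in> carrier (Dom f)" "y \<in> carrier (tgt (Dom f))" "b \<in> carrier (Dom g)"
  then show "pure_tensor (Cod f) (Cod g) (Map f (ract (Dom f) a y)) (Map g b) =
      pure_tensor (Cod f) (Cod g) (Map f a) (Map g (lact (Dom g) y b))"
    using f g fg by (simp add: pure_balanced)
qed

lemma tensor2_pure [simp]:
  assumes f: "cell_ok f" and g: "cell_ok g" and fg: "tgt (Cod f) = src (Cod g)"
    and "Dom f = A" "Dom g = B" "a \<in> carrier A" "b \<in> carrier B"
  shows "Map (f \<otimes>\<^sub>2 g) (pure_tensor A B a b) = pure_tensor (Cod f) (Cod g) (Map f a) (Map g b)"
  unfolding tensor2_def using assms tensor2_bimap[OF f g fg] cell_okD[OF f] cell_okD[OF g]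
  by (simp add: sup_lift_pure)

lemma tensor2_ok [simp]:
  assumes f: "cell_ok f" and g: "cell_ok g" and fg: "tgt (Cod f) = src (Cod g)"
  shows "cell_ok (f \<otimes>\<^sub>2 g)"
  unfolding tensor2_def
  by (rule tensor_lift_ok) (use f g fg cell_okD[OF f] cell_okD[OF g] tensor2_bimap[OF f g fg] in auto)

lemma tensor2_id2: "\<lbrakk>bmod A; bmod B; tgt A = src B\<rbrakk> \<Longrightarrow> id2 A \<otimes>\<^sub>2 id2 B = id2 (A \<otimes> B)"
  by (rule tensor_cell_ext[where A = A and B = B]) simp_all

lemma tensor2_vcomp:
  assumes f: "cell_ok f" "cell_ok f'" "Cod f = Dom f'" and g: "cell_ok g" "cell_ok g'" "Cod g = Dom g'"
    and fg: "tgt (Cod f) = src (Cod g)" "tgt (Cod f') = src (Cod g')"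
  shows "(f \<Zsemi> f') \<otimes>\<^sub>2 (g \<Zsemi> g') = (f \<otimes>\<^sub>2 g) \<Zsemi> (f' \<otimes>\<^sub>2 g')"
proof (rule tensor_cell_ext[where A = "Dom f" and B = "Dom g"])
  show "tgt (Dom f) = src (Dom g)" using assms by simp
qed (use assms in simp_all)

lemma tensor2_iso [simp]:
  assumes "iso_ok f" "iso_ok g" "tgt (Cod f) = src (Cod g)" shows "iso_ok (f \<otimes>\<^sub>2 g)"
proof -
  have *: "tgt (Dom f) = src (Dom g)" using assms by (auto dest: cell_okD(3,4) iso_cell_ok)
  have [simp]: "bmod (Dom f)" "bmod (Dom g)" "bmod (Cod f)" "bmod (Cod g)"
    using assms by (auto dest: cell_okD iso_cell_ok)
  show ?thesis
    by (rule iso_okI[where g = "inv2 f \<otimes>\<^sub>2 inv2 g"])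
      (use assms * in \<open>simp_all add: tensor2_vcomp[symmetric] vcomp_inv2 inv2_vcomp tensor2_id2\<close>)
qed

subsection \<open>Maps out of iterated tensor products\<close>

text \<open>Fixing either outer variable leaves a bimap in the other two. Together these two
  conditions give sup-preservation in all three variables and balancing over both middle locales,
  hence extension to either bracketing.\<close>

definition trimap :: "('a, 'x, 'y) bimod \<Rightarrow> ('b, 'y, 'z) bimod \<Rightarrow> ('c, 'z, 'w) bimod \<Rightarrow>
    ('e, 'm) gorder_scheme \<Rightarrow> ('a \<Rightarrow> 'b \<Rightarrow> 'c \<Rightarrow> 'e) \<Rightarrow> bool" where
  "trimap A B C E \<psi> \<longleftrightarrow> (\<forall>c\<in>carrier C. bimap A B E (\<lambda>a b. \<psi> a b c)) \<and> (\<forall>a\<in>carrier A. bimap B C E (\<psi> a))"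

lemma trimap_bimap_left:
  assumes A [simp]: "bmod A" and B [simp]: "bmod B" and C [simp]: "bmod C"
    and AB [simp]: "tgt A = src B" and BC: "tgt B = src C"
    and E [simp]: "complete_lattice E" and \<psi>: "trimap A B C E \<psi>"
  shows "bimap (A \<otimes> B) C E (\<lambda>U c. sup_lift E (\<lambda>a b. \<psi> a b c) U)"
proof (rule bimapI)
  have b1: "bimap A B E (\<lambda>a b. \<psi> a b c)" if "c \<in> carrier C" for c using \<psi> that by (simp add: trimap_def)
  have b2: "bimap B C E (\<psi> a)" if "a \<in> carrier A" for a using \<psi> that by (simp add: trimap_def)
  note sl = sup_lift_sup_hom[OF A B AB b1 E]
  {
    fix c assume "c \<in> carrier C"
    then show "sup_hom (A \<otimes> B) E (sup_lift E (\<lambda>a b. \<psi> a b c))" by (rule sl)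
  next
    fix U assume U: "U \<in> carrier (A \<otimes> B)"
    show "sup_hom C E (\<lambda>c. sup_lift E (\<lambda>a b. \<psi> a b c) U)"
      by (rule sup_hom_sup_lift) (use U b1 bimapD(2)[OF b2] in simp_all)
  next
    fix U y c assume U: "U \<in> carrier (A \<otimes> B)" and y: "y \<in> carrier (tgt (A \<otimes> B))" and c: "c \<in> carrier C"
    \<comment> \<open>Balancing over the middle locale of \<open>B\<close> and \<open>C\<close> is
      compared as a statement about sup-preserving maps in \<open>U\<close>; on a pure tensor of
      \<open>a\<close> and \<open>b\<close> it is the balancing of \<open>b\<close> against
      \<open>c\<close>.\<close>
    show "sup_lift E (\<lambda>a b. \<psi> a b c) (ract (A \<otimes> B) U y) = sup_lift E (\<lambda>a b. \<psi> a b (lact C y c)) U"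
    proof (rule sup_hom_tensor_ext[where A = A and B = B and
          f = "\<lambda>U. sup_lift E (\<lambda>a b. \<psi> a b c) (ract (A \<otimes> B) U y)"])
      show "sup_hom (A \<otimes> B) E (\<lambda>U. sup_lift E (\<lambda>a b. \<psi> a b c) (ract (A \<otimes> B) U y))"
        by (rule sup_hom_comp[OF _ sl]) (use y c in auto)
      show "sup_hom (A \<otimes> B) E (sup_lift E (\<lambda>a b. \<psi> a b (lact C y c)))"
        by (rule sl) (use y c BC in auto)
      fix a b assume "a \<in> carrier A" "b \<in> carrier B"
      then show "sup_lift E (\<lambda>a b. \<psi> a b c) (ract (A \<otimes> B) (pure_tensor A B a b) y) =
          sup_lift E (\<lambda>a b. \<psi> a b (lact C y c)) (pure_tensor A B a b)"
        using y c BC bimapD(3)[OF b2, of a b y c]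
        by (simp add: sup_lift_pure[OF A B AB b1 E])
    qed (use U in auto)
  }
qed

lemma trimap_bimap_right:
  assumes A [simp]: "bmod A" and B [simp]: "bmod B" and C [simp]: "bmod C"
    and AB: "tgt A = src B" and BC [simp]: "tgt B = src C"
    and E [simp]: "complete_lattice E" and \<psi>: "trimap A B C E \<psi>"
  shows "bimap A (B \<otimes> C) E (\<lambda>a V. sup_lift E (\<psi> a) V)"
proof (rule bimapI)
  have b1: "bimap A B E (\<lambda>a b. \<psi> a b c)" if "c \<in> carrier C" for c using \<psi> that by (simp add: trimap_def)
  have b2: "bimap B C E (\<psi> a)" if "a \<in> carrier A" for a using \<psi> that by (simp add: trimap_def)
  note sl = sup_lift_sup_hom[OF B C BC b2 E]
  {
    fix a assume "a \<in> carrier A"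
    then show "sup_hom (B \<otimes> C) E (sup_lift E (\<psi> a))" by (rule sl)
  next
    fix V assume V: "V \<in> carrier (B \<otimes> C)"
    show "sup_hom A E (\<lambda>a. sup_lift E (\<psi> a) V)"
      by (rule sup_hom_sup_lift) (use V b2 bimapD(1)[OF b1] in simp_all)
  next
    fix a y V assume a: "a \<in> carrier A" and y: "y \<in> carrier (tgt A)" and V: "V \<in> carrier (B \<otimes> C)"
    show "sup_lift E (\<psi> (ract A a y)) V = sup_lift E (\<psi> a) (lact (B \<otimes> C) y V)"
    proof (rule sup_hom_tensor_ext[where A = B and B = C and
          g = "\<lambda>V. sup_lift E (\<psi> a) (lact (B \<otimes> C) y V)"])
      show "sup_hom (B \<otimes> C) E (\<lambda>V. sup_lift E (\<psi> a) (lact (B \<otimes> C) y V))"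
        by (rule sup_hom_comp[OF _ sl]) (use y a AB in auto)
      show "sup_hom (B \<otimes> C) E (sup_lift E (\<psi> (ract A a y)))"
        by (rule sl) (use y a in auto)
      fix b c assume "b \<in> carrier B" "c \<in> carrier C"
      then show "sup_lift E (\<psi> (ract A a y)) (pure_tensor B C b c) =
          sup_lift E (\<psi> a) (lact (B \<otimes> C) y (pure_tensor B C b c))"
        using y a AB bimapD(3)[OF b1, of c a y b]
        by (simp add: sup_lift_pure[OF B C BC b2 E])
    qed (use V in auto)
  }
qed

context
  fixes A :: "('a, 'x, 'y) bimod" and B :: "('b, 'y, 'z) bimod" and C :: "('c, 'z, 'w) bimod"
  assumes A [simp]: "bmod A" and B [simp]: "bmod B" and C [simp]: "bmod C"
    and AB [simp]: "tgt A = src B" and BC [simp]: "tgt B = src C"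
begin

lemma trimap_right: "trimap A B C (A \<otimes> (B \<otimes> C)) (\<lambda>a b c. pure_tensor A (B \<otimes> C) a (pure_tensor B C b c))"
  unfolding trimap_def
proof (intro conjI ballI)
  fix c assume c: "c \<in> carrier C"
  show "bimap A B (A \<otimes> (B \<otimes> C)) (\<lambda>a b. pure_tensor A (B \<otimes> C) a (pure_tensor B C b c))"
  proof (rule bimapI)
    fix b assume "b \<in> carrier B"
    then show "sup_hom A (A \<otimes> (B \<otimes> C)) (\<lambda>a. pure_tensor A (B \<otimes> C) a (pure_tensor B C b c))"
      using c by (simp add: sup_hom_pure)
  next
    fix a assume "a \<in> carrier A"
    then show "sup_hom B (A \<otimes> (B \<otimes> C)) (\<lambda>b. pure_tensor A (B \<otimes> C) a (pure_tensor B C b c))"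
      using c by (intro sup_hom_comp[OF sup_hom_pure(1) sup_hom_pure(2)]) auto
  qed (use c in \<open>simp add: pure_balanced\<close>)
next
  fix a assume a: "a \<in> carrier A"
  show "bimap B C (A \<otimes> (B \<otimes> C)) (\<lambda>b c. pure_tensor A (B \<otimes> C) a (pure_tensor B C b c))"
    by (rule bimap_comp[OF pure_bimap sup_hom_pure(2)]) (use a in auto)
qed

lemma trimap_left: "trimap A B C ((A \<otimes> B) \<otimes> C) (\<lambda>a b c. pure_tensor (A \<otimes> B) C (pure_tensor A B a b) c)"
  unfolding trimap_def
proof (intro conjI ballI)
  fix a assume a: "a \<in> carrier A"
  show "bimap B C ((A \<otimes> B) \<otimes> C) (\<lambda>b c. pure_tensor (A \<otimes> B) C (pure_tensor A B a b) c)"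
  proof (rule bimapI)
    fix c assume "c \<in> carrier C"
    then show "sup_hom B ((A \<otimes> B) \<otimes> C) (\<lambda>b. pure_tensor (A \<otimes> B) C (pure_tensor A B a b) c)"
      using a by (intro sup_hom_comp[OF sup_hom_pure(2) sup_hom_pure(1)]) auto
  next
    fix b assume "b \<in> carrier B"
    then show "sup_hom C ((A \<otimes> B) \<otimes> C) (\<lambda>c. pure_tensor (A \<otimes> B) C (pure_tensor A B a b) c)"
      using a by (simp add: sup_hom_pure)
  next
    fix b y c assume "b \<in> carrier B" "y \<in> carrier (tgt B)" "c \<in> carrier C"
    then show "pure_tensor (A \<otimes> B) C (pure_tensor A B a (ract B b y)) c =
        pure_tensor (A \<otimes> B) C (pure_tensor A B a b) (lact C y c)"
      using a by (simp add: pure_balanced[symmetric])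
  qed
next
  fix c assume c: "c \<in> carrier C"
  show "bimap A B ((A \<otimes> B) \<otimes> C) (\<lambda>a b. pure_tensor (A \<otimes> B) C (pure_tensor A B a b) c)"
    by (rule bimap_comp[OF pure_bimap sup_hom_pure(1)]) (use c in auto)
qed

lemma tensor3_ext_left:
  assumes f: "sup_hom ((A \<otimes> B) \<otimes> C) E f" and g: "sup_hom ((A \<otimes> B) \<otimes> C) E g"
    and "\<And>a b c. \<lbrakk>a \<in> carrier A; b \<in> carrier B; c \<in> carrier C\<rbrakk> \<Longrightarrow>
      f (pure_tensor (A \<otimes> B) C (pure_tensor A B a b) c) = g (pure_tensor (A \<otimes> B) C (pure_tensor A B a b) c)"
    and U: "U \<in> carrier ((A \<otimes> B) \<otimes> C)"
  shows "f U = g U"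
proof (rule sup_hom_tensor_ext[OF _ _ _ f g])
  fix V c assume V: "V \<in> carrier (A \<otimes> B)" and c: "c \<in> carrier C"
  show "f (pure_tensor (A \<otimes> B) C V c) = g (pure_tensor (A \<otimes> B) C V c)"
    by (rule sup_hom_tensor_ext[where A = A and B = B, OF A B AB
          sup_hom_comp[OF sup_hom_pure(1) f] sup_hom_comp[OF sup_hom_pure(1) g]])
      (use assms V c in auto)
qed (use U in auto)

lemma tensor3_ext_right:
  assumes f: "sup_hom (A \<otimes> (B \<otimes> C)) E f" and g: "sup_hom (A \<otimes> (B \<otimes> C)) E g"
    and "\<And>a b c. \<lbrakk>a \<in> carrier A; b \<in> carrier B; c \<in> carrier C\<rbrakk> \<Longrightarrow>
      f (pure_tensor A (B \<otimes> C) a (pure_tensor B C b c)) = g (pure_tensor A (B \<otimes> C) a (pure_tensor B C b c))"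
    and U: "U \<in> carrier (A \<otimes> (B \<otimes> C))"
  shows "f U = g U"
proof (rule sup_hom_tensor_ext[OF _ _ _ f g])
  fix a V assume V: "V \<in> carrier (B \<otimes> C)" and a: "a \<in> carrier A"
  show "f (pure_tensor A (B \<otimes> C) a V) = g (pure_tensor A (B \<otimes> C) a V)"
    by (rule sup_hom_tensor_ext[where A = B and B = C, OF B C BC
          sup_hom_comp[OF sup_hom_pure(2) f] sup_hom_comp[OF sup_hom_pure(2) g]])
      (use assms V a in auto)
qed (use U in auto)

lemma tensor3_cell_ext_left:
  assumes "cell_ok f" "cell_ok g" "Dom f = (A \<otimes> B) \<otimes> C" "Dom g = (A \<otimes> B) \<otimes> C" "Cod f = Cod g"
    and "\<And>a b c. \<lbrakk>a \<in> carrier A; b \<in> carrier B; c \<in> carrier C\<rbrakk> \<Longrightarrow>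
      Map f (pure_tensor (A \<otimes> B) C (pure_tensor A B a b) c) = Map g (pure_tensor (A \<otimes> B) C (pure_tensor A B a b) c)"
  shows "f = g"
proof (rule cell_eqI)
  fix U assume U: "U \<in> carrier (Dom f)"
  show "Map f U = Map g U"
    by (rule tensor3_ext_left[of "Cod f"]) (use assms U cell_okD(5)[of f] cell_okD(5)[of g] in auto)
qed (use assms in auto)

lemma tensor_assoc_simps: "Dom (tensor_assoc A B C) = (A \<otimes> B) \<otimes> C" "Cod (tensor_assoc A B C) = A \<otimes> (B \<otimes> C)"
  by (simp_all add: tensor_assoc_def)

lemma tensor_assoc_pure:
  assumes "a \<in> carrier A" "b \<in> carrier B" "c \<in> carrier C"
  shows "Map (tensor_assoc A B C) (pure_tensor (A \<otimes> B) C (pure_tensor A B a b) c) =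
    pure_tensor A (B \<otimes> C) a (pure_tensor B C b c)"
proof -
  have *: "bimap A B (A \<otimes> (B \<otimes> C)) (\<lambda>a b. pure_tensor A (B \<otimes> C) a (pure_tensor B C b c))"
    using trimap_right assms by (simp add: trimap_def)
  show ?thesis unfolding tensor_assoc_def
    by (subst tensor_lift_pure[OF _ _ _ _ trimap_bimap_left[OF A B C AB BC _ trimap_right]])
      (use assms * in \<open>simp_all add: sup_lift_pure\<close>)
qed

lemma tensor_assoc_ok: "cell_ok (tensor_assoc A B C)"
proof -
  let ?E = "A \<otimes> (B \<otimes> C)"
  let ?\<psi> = "\<lambda>c U. sup_lift ?E (\<lambda>a b. pure_tensor A (B \<otimes> C) a (pure_tensor B C b c)) U"
  have b: "bimap A B ?E (\<lambda>a b. pure_tensor A (B \<otimes> C) a (pure_tensor B C b c))" if "c \<in> carrier C" for c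
    using trimap_right that by (simp add: trimap_def)
  have s: "sup_hom (A \<otimes> B) ?E (?\<psi> c)" if "c \<in> carrier C" for c
    by (rule sup_lift_sup_hom[OF A B AB b]) (simp_all add: that)
  note p = sup_lift_pure[OF A B AB b]
  show ?thesis unfolding tensor_assoc_def
  proof (rule tensor_lift_ok)
    show "bimap (A \<otimes> B) C ?E (\<lambda>U c. ?\<psi> c U)" by (rule trimap_bimap_left[OF _ _ _ _ _ _ trimap_right]) auto
  next
    fix x U c assume x: "x \<in> carrier (src (A \<otimes> B))" and U: "U \<in> carrier (A \<otimes> B)" and c: "c \<in> carrier C"
    show "?\<psi> c (lact (A \<otimes> B) x U) = lact ?E x (?\<psi> c U)"
      by (rule sup_hom_tensor_ext[OF A B AB sup_hom_comp[OF lact_sup_hom s[OF c]] sup_hom_comp[OF s[OF c] lact_sup_hom]])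
        (use x U c in \<open>simp_all add: p\<close>)
  next
    fix w U c assume w: "w \<in> carrier (tgt C)" and U: "U \<in> carrier (A \<otimes> B)" and c: "c \<in> carrier C"
    then have wc: "ract C c w \<in> carrier C" by simp
    show "?\<psi> (ract C c w) U = ract ?E (?\<psi> c U) w"
      by (rule sup_hom_tensor_ext[OF A B AB s[OF wc] sup_hom_comp[OF s[OF c] ract_sup_hom]])
        (use w U c in \<open>simp_all add: p\<close>)
  qed auto
qed

lemma tensor_assoc_iso: "iso_ok (tensor_assoc A B C)"
proof -
  let ?L = "(A \<otimes> B) \<otimes> C" and ?R = "A \<otimes> (B \<otimes> C)"
  let ?f = "Map (tensor_assoc A B C)"
  \<comment> \<open>The inverse comes from the universal property of the other bracketing: first
    extend in the pair from \<open>B\<close> and \<open>C\<close> for each \<open>a\<close>, then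
    extend in the remaining pair. Both composites fix triple pure tensors, which generate.\<close>
  define g where "g = sup_lift ?L (\<lambda>a. sup_lift ?L (\<lambda>b c. pure_tensor (A \<otimes> B) C (pure_tensor A B a b) c))"
  note [simp] = tensor_assoc_simps tensor_assoc_pure tensor_assoc_ok
  have bi: "bimap A (B \<otimes> C) ?L (\<lambda>a. sup_lift ?L (\<lambda>b c. pure_tensor (A \<otimes> B) C (pure_tensor A B a b) c))"
    by (rule trimap_bimap_right[OF _ _ _ _ _ _ trimap_left]) simp_all
  have g: "sup_hom ?R ?L g" unfolding g_def by (rule sup_lift_sup_hom[OF _ _ _ bi]) simp_all
  have g_pure [simp]: "g (pure_tensor A (B \<otimes> C) a (pure_tensor B C b c)) = pure_tensor (A \<otimes> B) C (pure_tensor A B a b) c"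
    if "a \<in> carrier A" "b \<in> carrier B" "c \<in> carrier C" for a b c
    unfolding g_def using that trimap_left
    by (subst sup_lift_pure[OF _ _ _ bi]) (simp_all add: sup_lift_pure trimap_def)
  have f: "sup_hom ?L ?R ?f" using cell_okD(5)[OF tensor_assoc_ok] by simp
  have gf: "(\<lambda>U. g (?f U)) U = (\<lambda>U. U) U" if "U \<in> carrier ?L" for U
    by (rule tensor3_ext_left[OF sup_hom_comp[OF f g] sup_hom_id]) (use that in simp_all)
  have fg: "(\<lambda>U. ?f (g U)) U = (\<lambda>U. U) U" if "U \<in> carrier ?R" for U
    by (rule tensor3_ext_right[OF sup_hom_comp[OF g f] sup_hom_id]) (use that in simp_all)
  show ?thesis
    by (rule iso_okI_bij[OF tensor_assoc_ok, where g = g]) (use gf fg sup_homD(3)[OF g] in simp_all)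
qed

end

declare tensor_assoc_iso [simp] tensor_assoc_simps [simp] tensor_assoc_pure [simp]

lemma inv2_tensor_assoc_pure [simp]:
  assumes "bmod A" "bmod B" "bmod C" "tgt A = src B" "tgt B = src C"
    and "a \<in> carrier A" "b \<in> carrier B" "c \<in> carrier C"
  shows "Map (inv2 (tensor_assoc A B C)) (pure_tensor A (B \<otimes> C) a (pure_tensor B C b c)) =
    pure_tensor (A \<otimes> B) C (pure_tensor A B a b) c"
  by (rule inv2_eqI) (use assms in simp_all)

subsection \<open>Units\<close>

declare is_localeD(1) [simp]

lemma act_top [simp]:
  assumes "bmod A" "a \<in> carrier A"
  shows "src A = X \<Longrightarrow> lact A \<top>\<^bsub>X\<^esub> a = a" and "tgt A = Y \<Longrightarrow> ract A a \<top>\<^bsub>Y\<^esub> = a"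
  using assms by auto

lemma top_cell_simps [simp]:
  "carrier (top_cell X) = carrier X" "src (top_cell X) = X" "tgt (top_cell X) = X"
  "x \<sqsubseteq>\<^bsub>top_cell X\<^esub> y \<longleftrightarrow> x \<sqsubseteq>\<^bsub>X\<^esub> y" "lact (top_cell X) = (\<lambda>x a. x \<sqinter>\<^bsub>X\<^esub> a)" "ract (top_cell X) = (\<lambda>a x. a \<sqinter>\<^bsub>X\<^esub> x)"
  by (simp_all add: top_cell_def)

lemma top_cell_bmod [simp]:
  assumes "is_locale X" shows "bmod (top_cell X)"
proof -
  have X: "complete_lattice X" using assms by (rule is_localeD)
  then have T: "complete_lattice (top_cell X)"
  proof (intro complete_lattice_supI)
    fix S assume "S \<subseteq> carrier (top_cell X)"
    then show "\<exists>s\<in>carrier (top_cell X). \<forall>z\<in>carrier (top_cell X). s \<sqsubseteq>\<^bsub>top_cell X\<^esub> z \<longleftrightarrow> (\<forall>a\<in>S. a \<sqsubseteq>\<^bsub>top_cell X\<^esub> z)"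
      using X by (intro bexI[of _ "\<Squnion>\<^bsub>X\<^esub> S"]) (simp_all add: cl_sup_le_iff cl_sup_closed)
  qed (use X in \<open>auto simp: top_cell_def cl_refl intro: cl_trans cl_antisym\<close>)
  \<comment> \<open>\<open>X\<close> and \<open>top_cell X\<close> are records of different types
    with the same order, so the distributive law of the locale is transported rather than proved
    again.\<close>
  have m: "sup_hom (top_cell X) (top_cell X) (\<lambda>a. x \<sqinter>\<^bsub>X\<^esub> a)" "sup_hom X (top_cell X) (\<lambda>a. x \<sqinter>\<^bsub>X\<^esub> a)"
    if "x \<in> carrier X" for x
    by (rule sup_hom_same_order[OF _ _ _ _ _ _ is_localeD(2)[OF assms that]]; simp add: T X)+
  have m': "sup_hom (top_cell X) (top_cell X) (\<lambda>a. a \<sqinter>\<^bsub>X\<^esub> x)" "sup_hom X (top_cell X) (\<lambda>a. a \<sqinter>\<^bsub>X\<^esub> x)"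
    if "x \<in> carrier X" for x
    using m[OF that] by (simp_all only: meet_commute[of X x])
  show ?thesis
  proof (rule bmodI)
    fix a assume a: "a \<in> carrier (top_cell X)"
    show "lact (top_cell X) \<top>\<^bsub>src (top_cell X)\<^esub> a = a"
      using a X by (simp add: cl_meet_top meet_commute[of X "\<top>\<^bsub>X\<^esub>"])
    show "sup_hom (src (top_cell X)) (top_cell X) (\<lambda>x. lact (top_cell X) x a)"
      using m'(2) a by simp
    show "sup_hom (tgt (top_cell X)) (top_cell X) (ract (top_cell X) a)"
      using m(2)[of a] a by simp
  next
    fix x assume "x \<in> carrier (src (top_cell X))"
    then show "sup_hom (top_cell X) (top_cell X) (lact (top_cell X) x)"
      using m(1)[of x] by simp
  qed (use assms X m m' in \<open>simp_all add: cl_meet_assoc cl_meet_top\<close>)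
qed

lemma tensor_lunit_simps [simp]: "Dom (tensor_lunit A) = top_cell (src A) \<otimes> A" "Cod (tensor_lunit A) = A"
  and tensor_runit_simps [simp]: "Dom (tensor_runit A) = A \<otimes> top_cell (tgt A)" "Cod (tensor_runit A) = A"
  by (simp_all add: tensor_lunit_def tensor_runit_def)

context
  fixes A :: "('a, 'x, 'y) bimod"
  assumes A [simp]: "bmod A"
begin

lemma lact_bimap: "bimap (top_cell (src A)) A A (lact A)"
proof (rule bimapI)
  fix a assume a: "a \<in> carrier A"
  show "sup_hom (top_cell (src A)) A (\<lambda>x. lact A x a)"
    by (rule sup_hom_same_order[OF _ _ _ _ _ _ lact_sup_hom_src[OF A a]]) simp_all
qed (simp_all add: lact_meet)

lemma ract_bimap: "bimap A (top_cell (tgt A)) A (ract A)"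
proof (rule bimapI)
  fix a assume a: "a \<in> carrier A"
  show "sup_hom (top_cell (tgt A)) A (ract A a)"
    by (rule sup_hom_same_order[OF _ _ _ _ _ _ ract_sup_hom_tgt[OF A a]]) simp_all
qed (simp_all add: ract_meet)

lemma tensor_lunit_pure:
  "\<lbrakk>src A = X; x \<in> carrier X; a \<in> carrier A\<rbrakk> \<Longrightarrow> Map (tensor_lunit A) (pure_tensor (top_cell X) A x a) = lact A x a"
  by (auto simp: tensor_lunit_def sup_lift_pure lact_bimap)

lemma tensor_runit_pure:
  "\<lbrakk>tgt A = Y; y \<in> carrier Y; a \<in> carrier A\<rbrakk> \<Longrightarrow> Map (tensor_runit A) (pure_tensor A (top_cell Y) a y) = ract A a y"
  by (auto simp: tensor_runit_def sup_lift_pure ract_bimap)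

lemma tensor_lunit_ok: "cell_ok (tensor_lunit A)"
  unfolding tensor_lunit_def by (rule tensor_lift_ok) (simp_all add: lact_bimap lact_meet lact_ract)

lemma tensor_runit_ok: "cell_ok (tensor_runit A)"
  unfolding tensor_runit_def by (rule tensor_lift_ok) (simp_all add: ract_bimap ract_meet lact_ract)

text \<open>The inverse tensors with the top element: balancing over the source locale gives
  \<open>\<top> \<otimes> xa = x \<otimes> a\<close>.\<close>

lemma tensor_lunit_iso: "iso_ok (tensor_lunit A)"
proof (rule iso_okI_bij[OF tensor_lunit_ok, where g = "pure_tensor (top_cell (src A)) A \<top>\<^bsub>src A\<^esub>"])
  let ?T = "top_cell (src A)"
  fix U assume U: "U \<in> carrier (Dom (tensor_lunit A))"
  have "(\<lambda>U. pure_tensor ?T A \<top>\<^bsub>src A\<^esub> (Map (tensor_lunit A) U)) U = (\<lambda>U. U) U"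
  proof (rule sup_hom_tensor_ext[where A = ?T and B = A])
    show "sup_hom (?T \<otimes> A) (?T \<otimes> A) (\<lambda>U. pure_tensor ?T A \<top>\<^bsub>src A\<^esub> (Map (tensor_lunit A) U))"
      by (rule sup_hom_comp[OF cell_okD(5)[OF tensor_lunit_ok, simplified]]) (simp add: sup_hom_pure)
    show "pure_tensor ?T A \<top>\<^bsub>src A\<^esub> (Map (tensor_lunit A) (pure_tensor ?T A x a)) = pure_tensor ?T A x a"
      if "x \<in> carrier ?T" "a \<in> carrier A" for x a
      using that pure_balanced[of ?T A "\<top>\<^bsub>src A\<^esub>" x a]
      by (simp add: tensor_lunit_pure meet_commute[of "src A" "\<top>\<^bsub>src A\<^esub>"] cl_meet_top)
  qed (use U in \<open>simp_all add: sup_hom_id\<close>)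
  then show "pure_tensor ?T A \<top>\<^bsub>src A\<^esub> (Map (tensor_lunit A) U) = U" by simp
qed (simp_all add: tensor_lunit_pure)

lemma tensor_runit_iso: "iso_ok (tensor_runit A)"
proof (rule iso_okI_bij[OF tensor_runit_ok, where g = "\<lambda>a. pure_tensor A (top_cell (tgt A)) a \<top>\<^bsub>tgt A\<^esub>"])
  let ?T = "top_cell (tgt A)"
  fix U assume U: "U \<in> carrier (Dom (tensor_runit A))"
  have "(\<lambda>U. pure_tensor A ?T (Map (tensor_runit A) U) \<top>\<^bsub>tgt A\<^esub>) U = (\<lambda>U. U) U"
  proof (rule sup_hom_tensor_ext[where A = A and B = ?T])
    show "sup_hom (A \<otimes> ?T) (A \<otimes> ?T) (\<lambda>U. pure_tensor A ?T (Map (tensor_runit A) U) \<top>\<^bsub>tgt A\<^esub>)"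
      by (rule sup_hom_comp[OF cell_okD(5)[OF tensor_runit_ok, simplified]]) (simp add: sup_hom_pure)
    show "pure_tensor A ?T (Map (tensor_runit A) (pure_tensor A ?T a y)) \<top>\<^bsub>tgt A\<^esub> = pure_tensor A ?T a y"
      if "y \<in> carrier ?T" "a \<in> carrier A" for y a
      using that pure_balanced[of A ?T a y "\<top>\<^bsub>tgt A\<^esub>"]
      by (simp add: tensor_runit_pure cl_meet_top)
  qed (use U in \<open>simp_all add: sup_hom_id\<close>)
  then show "pure_tensor A ?T (Map (tensor_runit A) U) \<top>\<^bsub>tgt A\<^esub> = U" by simp
qed (simp_all add: tensor_runit_pure)

end

declare tensor_lunit_iso [simp] tensor_runit_iso [simp] tensor_lunit_pure [simp] tensor_runit_pure [simp]

subsection \<open>Pentagon and triangle\<close>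

lemma tensor_pentagon:
  assumes [simp]: "bmod A" "bmod B" "bmod C" "bmod D"
    and AB [simp]: "tgt A = src B" and BC [simp]: "tgt B = src C" and CD [simp]: "tgt C = src D"
  shows "(tensor_assoc A B C \<otimes>\<^sub>2 id2 D) \<Zsemi> tensor_assoc A (B \<otimes> C) D \<Zsemi> (id2 A \<otimes>\<^sub>2 tensor_assoc B C D)
    = tensor_assoc (A \<otimes> B) C D \<Zsemi> tensor_assoc A B (C \<otimes> D)" (is "?f = ?g")
proof (rule tensor3_cell_ext_left[where A = "A \<otimes> B" and B = C and C = D])
  have ok: "cell_ok ?f" "cell_ok ?g" by simp_all
  fix U c d assume U: "U \<in> carrier (A \<otimes> B)" and c: "c \<in> carrier C" and d: "d \<in> carrier D"
  \<comment> \<open>Extensionality for triple tensors has been used with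
    \<open>A \<otimes> B\<close> as a single factor. Inserting the fixed \<open>c\<close> and
    \<open>d\<close> is sup-preserving in \<open>U\<close>, so a further use of extensionality
    splits \<open>U\<close> into pure tensors of \<open>A\<close> and \<open>B\<close>.\<close>
  let ?p = "\<lambda>U. pure_tensor ((A \<otimes> B) \<otimes> C) D (pure_tensor (A \<otimes> B) C U c) d"
  have p: "sup_hom (A \<otimes> B) (((A \<otimes> B) \<otimes> C) \<otimes> D) ?p"
    by (rule sup_hom_comp[OF sup_hom_pure(1) sup_hom_pure(1)]) (use c d in simp_all)
  show "Map ?f (?p U) = Map ?g (?p U)"
    by (rule sup_hom_tensor_ext[where A = A and B = B, OF _ _ _
          sup_hom_comp[OF p cell_okD(5)[OF ok(1), simplified]] sup_hom_comp[OF p cell_okD(5)[OF ok(2), simplified]]])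
      (use U c d in simp_all)
qed simp_all

text \<open>On the generators \<open>a\<close>, \<open>y\<close>, \<open>b\<close> this is the
  relation \<open>ay \<otimes> b = a \<otimes> yb\<close>.\<close>

lemma tensor_triangle:
  assumes [simp]: "bmod A" "bmod B" and AB [simp]: "tgt A = Y" "src B = Y"
  shows "tensor_assoc A (top_cell Y) B \<Zsemi> (id2 A \<otimes>\<^sub>2 tensor_lunit B) = tensor_runit A \<otimes>\<^sub>2 id2 B"
proof -
  have [simp]: "is_locale Y" using bmod_loc(2)[of A] by simp
  show ?thesis
    by (rule tensor3_cell_ext_left[where A = A and B = "top_cell Y" and C = B]) (simp_all add: pure_balanced)
qed

lemma tensor_assoc_natural:
  assumes [simp]: "cell_ok f" "cell_ok g" "cell_ok h" "tgt (Cod f) = src (Cod g)" "tgt (Cod g) = src (Cod h)"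
  shows "((f \<otimes>\<^sub>2 g) \<otimes>\<^sub>2 h) \<Zsemi> tensor_assoc (Cod f) (Cod g) (Cod h)
    = tensor_assoc (Dom f) (Dom g) (Dom h) \<Zsemi> (f \<otimes>\<^sub>2 (g \<otimes>\<^sub>2 h))"
  by (rule tensor3_cell_ext_left[where A = "Dom f" and B = "Dom g" and C = "Dom h"]) simp_all

lemma tensor_lunit_natural:
  assumes [simp]: "cell_ok f"
  shows "(id2 (top_cell (src (Cod f))) \<otimes>\<^sub>2 f) \<Zsemi> tensor_lunit (Cod f) = tensor_lunit (Dom f) \<Zsemi> f"
  by (rule tensor_cell_ext[where A = "top_cell (src (Cod f))" and B = "Dom f"]) (simp_all add: cell_okD(7))

lemma tensor_runit_natural:
  assumes [simp]: "cell_ok f"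
  shows "(f \<otimes>\<^sub>2 id2 (top_cell (tgt (Cod f)))) \<Zsemi> tensor_runit (Cod f) = tensor_runit (Dom f) \<Zsemi> f"
  by (rule tensor_cell_ext[where A = "Dom f" and B = "top_cell (tgt (Cod f))"]) (simp_all add: cell_okD(8))

section \<open>Duality\<close>

lemma opposite2_simps [simp]: "Dom (f\<degree>\<^sub>2) = (Cod f)\<degree>" "Cod (f\<degree>\<^sub>2) = (Dom f)\<degree>"
  by (simp_all add: opposite2_def)

lemma opposite2_closed:
  "\<lbrakk>cell_ok f; b \<in> carrier (Cod f)\<rbrakk> \<Longrightarrow> Map (f\<degree>\<^sub>2) b \<in> carrier (Dom f)"
  by (simp add: opposite2_def right_adjoint_closed cell_okD(5))

lemma le_opposite2_iff:
  "\<lbrakk>cell_ok f; a \<in> carrier (Dom f); b \<in> carrier (Cod f)\<rbrakk> \<Longrightarrow>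
    a \<sqsubseteq>\<^bsub>Dom f\<^esub> Map (f\<degree>\<^sub>2) b \<longleftrightarrow> Map f a \<sqsubseteq>\<^bsub>Cod f\<^esub> b"
  by (simp add: opposite2_def le_right_adjoint_iff cell_okD(5))

lemma opposite2_eqI:
  assumes "cell_ok f" "b \<in> carrier (Cod f)" "r \<in> carrier (Dom f)"
    and "\<And>a. a \<in> carrier (Dom f) \<Longrightarrow> Map f a \<sqsubseteq>\<^bsub>Cod f\<^esub> b \<longleftrightarrow> a \<sqsubseteq>\<^bsub>Dom f\<^esub> r"
  shows "Map (f\<degree>\<^sub>2) b = r"
  unfolding opposite2_def using right_adjoint_eqI[OF cell_okD(5)[OF assms(1)] assms(2-4)] by simp

text \<open>Taking adjoints on both sides of an equivariance law of \<open>f\<close> gives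
  equivariance of the adjoint for the adjoint actions. Sup-preservation holds because, for the
  reversed orders, \<open>f\<close> itself is the right adjoint.\<close>

lemma opposite2_ok [simp]:
  assumes f: "cell_ok f" shows "cell_ok (f\<degree>\<^sub>2)"
proof -
  note [simp] = opposite2_closed[OF f] le_opposite2_iff[OF f]
  have ad: "Map f a \<sqsubseteq>\<^bsub>Cod f\<^esub> b \<longleftrightarrow> a \<sqsubseteq>\<^bsub>Dom f\<^esub> Map (f\<degree>\<^sub>2) b"
    if "a \<in> carrier (Dom f)" "b \<in> carrier (Cod f)" for a b using that f by simp
  have "sup_hom ((Cod f)\<degree>) ((Dom f)\<degree>) (Map (f\<degree>\<^sub>2))"
    by (rule sup_hom_adjI[where g = "Map f"]) (use f in \<open>simp_all add: opposite_cl\<close>)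
  moreover have "Map (f\<degree>\<^sub>2) (lact ((Cod f)\<degree>) y b) = lact ((Dom f)\<degree>) y (Map (f\<degree>\<^sub>2) b)"
    if "y \<in> carrier (tgt (Cod f))" "b \<in> carrier (Cod f)" for y b
    by (rule opposite2_eqI) (use that f in \<open>simp_all add: le_lact_opposite_iff cell_okD(8)[OF f, symmetric]\<close>)
  moreover have "Map (f\<degree>\<^sub>2) (ract ((Cod f)\<degree>) b x) = ract ((Dom f)\<degree>) (Map (f\<degree>\<^sub>2) b) x"
    if "x \<in> carrier (src (Cod f))" "b \<in> carrier (Cod f)" for x b
    by (rule opposite2_eqI) (use that f in \<open>simp_all add: le_ract_opposite_iff cell_okD(7)[OF f, symmetric]\<close>)
  moreover have "Map (f\<degree>\<^sub>2) \<in> extensional (carrier (Cod f))"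
    by (simp add: opposite2_def right_adjoint_def)
  ultimately show ?thesis using f cell_okD(1-4)[OF f] unfolding cell_ok_def[of "f\<degree>\<^sub>2"] by simp
qed

lemma opposite2_id2 [simp]: "bmod A \<Longrightarrow> (id2 A)\<degree>\<^sub>2 = id2 (A\<degree>)"
  by (rule cell_eqI) (simp_all, rule opposite2_eqI, simp_all)

lemma opposite2_vcomp:
  assumes [simp]: "cell_ok f" "cell_ok g" "Cod f = Dom g"
  shows "(f \<Zsemi> g)\<degree>\<^sub>2 = g\<degree>\<^sub>2 \<Zsemi> f\<degree>\<^sub>2"
proof (rule cell_eqI)
  fix c assume "c \<in> carrier (Dom ((f \<Zsemi> g)\<degree>\<^sub>2))"
  then have [simp]: "c \<in> carrier (Cod g)" by simp
  have [simp]: "Map (g\<degree>\<^sub>2) c \<in> carrier (Dom g)" by (simp add: opposite2_closed)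
  have "Map ((f \<Zsemi> g)\<degree>\<^sub>2) c = Map (f\<degree>\<^sub>2) (Map (g\<degree>\<^sub>2) c)"
    by (rule opposite2_eqI)
      (simp_all add: opposite2_closed le_opposite2_iff[of f, simplified] le_opposite2_iff[of g, simplified])
  then show "Map ((f \<Zsemi> g)\<degree>\<^sub>2) c = Map (g\<degree>\<^sub>2 \<Zsemi> f\<degree>\<^sub>2) c" by simp
qed simp_all

lemma opposite2_vcomp_Map [simp]:
  assumes "cell_ok f" "cell_ok g" "Cod f = Dom g" "c \<in> carrier (Cod g)"
  shows "Map ((f \<Zsemi> g)\<degree>\<^sub>2) c = Map (f\<degree>\<^sub>2) (Map (g\<degree>\<^sub>2) c)"
  using assms by (simp add: opposite2_vcomp)

text \<open>The adjoint taken in the reversed orders is the left adjoint of the right adjoint, that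
  is, \<open>f\<close>. The statement is pointwise because the two cells have different ends as
  records.\<close>

lemma opposite2_opposite2 [simp]:
  assumes f: "cell_ok f" and a: "a \<in> carrier (Dom f)"
  shows "Map (f\<degree>\<^sub>2\<degree>\<^sub>2) a = Map f a"
  by (rule opposite2_eqI) (use f a in \<open>simp_all add: le_opposite2_iff\<close>)

lemma opposite2_inject:
  assumes "cell_ok f" "cell_ok g" "Dom f = Dom g" "Cod f = Cod g" "f\<degree>\<^sub>2 = g\<degree>\<^sub>2"
  shows "f = g"
  by (rule cell_eqI) (use assms opposite2_opposite2[of f] opposite2_opposite2[of g] in simp_all)

lemma opposite2_iso [simp]: "iso_ok f \<Longrightarrow> iso_ok (f\<degree>\<^sub>2)"
  by (rule iso_okI[where g = "(inv2 f)\<degree>\<^sub>2"]) (simp_all add: opposite2_vcomp[symmetric] vcomp_inv2 inv2_vcomp)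

lemma opposite2_inv2:
  assumes f: "iso_ok f" and a: "a \<in> carrier (Dom f)"
  shows "Map ((inv2 f)\<degree>\<^sub>2) a = Map (inv2 (f\<degree>\<^sub>2)) a"
proof -
  have "Map ((inv2 f \<Zsemi> f)\<degree>\<^sub>2) b = b" if "b \<in> carrier (Cod f)" for b
    using f that by (simp add: vcomp_inv2)
  have "Map ((f \<Zsemi> inv2 f)\<degree>\<^sub>2) a = a"
    using f a by (simp add: inv2_vcomp del: opposite2_vcomp_Map)
  then have "Map (f\<degree>\<^sub>2) (Map ((inv2 f)\<degree>\<^sub>2) a) = a"
    using f a by simp
  then show ?thesis
    by (intro inv2_eqI[symmetric]) (use f a in simp_all)
qed

lemma double_opposite_simps [simp]:
  "Dom (double_opposite A) = A\<degree>\<degree>" "Cod (double_opposite A) = A"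
  "a \<in> carrier A \<Longrightarrow> Map (double_opposite A) a = a"
  by (simp_all add: double_opposite_def)

text \<open>Used to read a cell out of \<open>(A \<oplus> B)\<degree>\<close> as a sup-preserving
  map out of the tensor product \<open>B\<degree> \<otimes> A\<degree>\<close>.\<close>

lemma sup_hom_double_opposite:
  assumes "complete_lattice A"
  shows "sup_hom (A\<degree>\<degree>) C f \<longleftrightarrow> sup_hom A C f"
proof
  have *: "complete_lattice (A\<degree>\<degree>)" using assms by (simp add: opposite_cl)
  { assume f: "sup_hom (A\<degree>\<degree>) C f"
    show "sup_hom A C f"
      by (rule sup_hom_same_order[OF _ _ _ _ _ _ f]) (use assms sup_homD(2)[OF f] in simp_all) }
  { assume f: "sup_hom A C f"
    show "sup_hom (A\<degree>\<degree>) C f"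
      by (rule sup_hom_same_order[OF _ _ _ _ _ _ f]) (use * sup_homD(2)[OF f] in simp_all) }
qed

lemma double_opposite_iso [simp]:
  assumes A: "bmod A" shows "iso_ok (double_opposite A)"
proof (rule iso_okI_bij[where g = "\<lambda>a. a"])
  have "sup_hom A A (Map (double_opposite A))"
    by (subst sup_hom_cong[where g = "\<lambda>a. a"]) (use A in \<open>simp_all add: sup_hom_id\<close>)
  then have "sup_hom (A\<degree>\<degree>) A (Map (double_opposite A))"
    using A by (simp add: sup_hom_double_opposite)
  moreover have "Map (double_opposite A) \<in> extensional (carrier A)" by (simp add: double_opposite_def)
  ultimately show "cell_ok (double_opposite A)"
    unfolding cell_ok_def using A by (simp add: opposite_opposite_act)
qed simp_all

lemma inv2_double_opposite [simp]: "bmod A \<Longrightarrow> a \<in> carrier A \<Longrightarrow> Map (inv2 (double_opposite A)) a = a"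
  by (rule inv2_eqI) simp_all

lemma opposite2_double_opposite [simp]:
  "bmod A \<Longrightarrow> a \<in> carrier A \<Longrightarrow> Map ((double_opposite A)\<degree>\<^sub>2) a = a"
  by (rule opposite2_eqI) simp_all

section \<open>The second bicategory structure\<close>

lemma par_simps [simp]:
  "carrier (A \<oplus> B) = carrier (B\<degree> \<otimes> A\<degree>)" "src (A \<oplus> B) = src A" "tgt (A \<oplus> B) = tgt B"
  "U \<sqsubseteq>\<^bsub>A \<oplus> B\<^esub> V \<longleftrightarrow> V \<subseteq> U"
  by (simp_all add: par_def)

lemma par_bmod [simp]: "\<lbrakk>bmod A; bmod B; tgt A = src B\<rbrakk> \<Longrightarrow> bmod (A \<oplus> B)"
  by (simp add: par_def)

lemma bot_cell_simps [simp]: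
  "carrier (bot_cell X) = carrier X" "src (bot_cell X) = X" "tgt (bot_cell X) = X"
  by (simp_all add: bot_cell_def)

lemma bot_cell_bmod [simp]: "is_locale X \<Longrightarrow> bmod (bot_cell X)"
  by (simp add: bot_cell_def)

lemma par2_simps [simp]: "Dom (f \<oplus>\<^sub>2 g) = Dom f \<oplus> Dom g" "Cod (f \<oplus>\<^sub>2 g) = Cod f \<oplus> Cod g"
  by (simp_all add: par2_def par_def)

lemma par2_ok [simp]: "\<lbrakk>cell_ok f; cell_ok g; tgt (Cod f) = src (Cod g)\<rbrakk> \<Longrightarrow> cell_ok (f \<oplus>\<^sub>2 g)"
  by (simp add: par2_def)

lemma opposite2_par2_pure [simp]:
  assumes "cell_ok f" "cell_ok g" "tgt (Cod f) = src (Cod g)" "Cod f = A'" "Cod g = B'"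
    "a \<in> carrier A'" "b \<in> carrier B'"
  shows "Map ((f \<oplus>\<^sub>2 g)\<degree>\<^sub>2) (pure_tensor (B'\<degree>) (A'\<degree>) b a) =
    pure_tensor ((Dom g)\<degree>) ((Dom f)\<degree>) (Map (g\<degree>\<^sub>2) b) (Map (f\<degree>\<^sub>2) a)"
  using assms cell_okD(1-4)[OF assms(1)] cell_okD(1-4)[OF assms(2)] by (simp add: par2_def)

lemma sup_hom_par_ext:
  assumes "bmod A" "bmod B" "tgt A = src B"
    and f: "sup_hom ((A \<oplus> B)\<degree>) E f" and g: "sup_hom ((A \<oplus> B)\<degree>) E g"
    and eq: "\<And>a b. \<lbrakk>a \<in> carrier A; b \<in> carrier B\<rbrakk> \<Longrightarrow>
      f (pure_tensor (B\<degree>) (A\<degree>) b a) = g (pure_tensor (B\<degree>) (A\<degree>) b a)"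
    and U: "U \<in> carrier (B\<degree> \<otimes> A\<degree>)"
  shows "f U = g U"
proof (rule sup_hom_tensor_ext[where A = "B\<degree>" and B = "A\<degree>"])
  show "sup_hom (B\<degree> \<otimes> A\<degree>) E f" "sup_hom (B\<degree> \<otimes> A\<degree>) E g"
    using f g assms(1-3) by (simp_all add: par_def sup_hom_double_opposite)
qed (use assms in simp_all)

lemma par_cell_ext:
  assumes "cell_ok f" "cell_ok g" "Dom f = Dom g" "Cod f = A \<oplus> B" "Cod g = A \<oplus> B"
    and "bmod A" "bmod B" "tgt A = src B"
    and eq: "\<And>a b. \<lbrakk>a \<in> carrier A; b \<in> carrier B\<rbrakk> \<Longrightarrow>
      Map (f\<degree>\<^sub>2) (pure_tensor (B\<degree>) (A\<degree>) b a) = Map (g\<degree>\<^sub>2) (pure_tensor (B\<degree>) (A\<degree>) b a)"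
  shows "f = g"
proof (rule opposite2_inject)
  show "f\<degree>\<^sub>2 = g\<degree>\<^sub>2"
  proof (rule cell_eqI)
    fix U assume U: "U \<in> carrier (Dom (f\<degree>\<^sub>2))"
    show "Map (f\<degree>\<^sub>2) U = Map (g\<degree>\<^sub>2) U"
      by (rule sup_hom_par_ext[OF assms(6-8)]) 
        (use U assms cell_okD(5)[of "f\<degree>\<^sub>2"] cell_okD(5)[of "g\<degree>\<^sub>2"] in simp_all)
  qed (use assms in simp_all)
qed (use assms in simp_all)

lemma par3_cell_ext:
  assumes "cell_ok f" "cell_ok g" "Dom f = Dom g" "Cod f = A \<oplus> (B \<oplus> C)" "Cod g = A \<oplus> (B \<oplus> C)"
    and [simp]: "bmod A" "bmod B" "bmod C" "tgt A = src B" "tgt B = src C"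
    and eq: "\<And>a b c. \<lbrakk>a \<in> carrier A; b \<in> carrier B; c \<in> carrier C\<rbrakk> \<Longrightarrow>
      Map (f\<degree>\<^sub>2) (pure_tensor ((B \<oplus> C)\<degree>) (A\<degree>) (pure_tensor (C\<degree>) (B\<degree>) c b) a) =
      Map (g\<degree>\<^sub>2) (pure_tensor ((B \<oplus> C)\<degree>) (A\<degree>) (pure_tensor (C\<degree>) (B\<degree>) c b) a)"
  shows "f = g"
proof (rule par_cell_ext[OF assms(1-5)])
  have fg: "sup_hom ((B \<oplus> C)\<degree> \<otimes> A\<degree>) ((Dom g)\<degree>) (Map (f\<degree>\<^sub>2))"
    "sup_hom ((B \<oplus> C)\<degree> \<otimes> A\<degree>) ((Dom g)\<degree>) (Map (g\<degree>\<^sub>2))"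
    using assms(1-5) cell_okD(5)[of "f\<degree>\<^sub>2"] cell_okD(5)[of "g\<degree>\<^sub>2"]
    by (simp_all add: par_def[of A "B \<oplus> C"] sup_hom_double_opposite)
  fix a V assume a: "a \<in> carrier A" and V: "V \<in> carrier (B \<oplus> C)"
  have p: "sup_hom ((B \<oplus> C)\<degree>) ((B \<oplus> C)\<degree> \<otimes> A\<degree>) (\<lambda>V. pure_tensor ((B \<oplus> C)\<degree>) (A\<degree>) V a)"
    by (rule sup_hom_pure(1)) (use a in simp_all)
  show "Map (f\<degree>\<^sub>2) (pure_tensor ((B \<oplus> C)\<degree>) (A\<degree>) V a) = Map (g\<degree>\<^sub>2) (pure_tensor ((B \<oplus> C)\<degree>) (A\<degree>) V a)"
    by (rule sup_hom_par_ext[OF _ _ _ sup_hom_comp[OF p fg(1)] sup_hom_comp[OF p fg(2)]])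
      (use a V eq in simp_all)
qed simp_all

lemma par2_id2: "\<lbrakk>bmod A; bmod B; tgt A = src B\<rbrakk> \<Longrightarrow> id2 A \<oplus>\<^sub>2 id2 B = id2 (A \<oplus> B)"
  by (rule par_cell_ext[where A = A and B = B]) simp_all

lemma par2_vcomp:
  assumes "cell_ok f" "cell_ok f'" "Cod f = Dom f'" "cell_ok g" "cell_ok g'" "Cod g = Dom g'"
    "tgt (Cod f') = src (Cod g')"
  shows "(f \<Zsemi> f') \<oplus>\<^sub>2 (g \<Zsemi> g') = (f \<oplus>\<^sub>2 g) \<Zsemi> (f' \<oplus>\<^sub>2 g')"
  by (rule par_cell_ext[where A = "Cod f'" and B = "Cod g'"]) (use assms in \<open>simp_all add: opposite2_closed\<close>)

lemma par_assoc_simps [simp]: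
  "Dom (par_assoc A B C) = (A \<oplus> B) \<oplus> C" "Cod (par_assoc A B C) = A \<oplus> (B \<oplus> C)"
  by (simp_all add: par_assoc_def par_def)

context
  fixes A :: "('a, 'x, 'y) bimod" and B :: "('b, 'y, 'z) bimod" and C :: "('c, 'z, 'w) bimod"
  assumes A [simp]: "bmod A" and B [simp]: "bmod B" and C [simp]: "bmod C"
    and AB [simp]: "tgt A = src B" and BC [simp]: "tgt B = src C"
begin

lemma par_assoc_iso: "iso_ok (par_assoc A B C)"
  by (simp add: par_assoc_def)

text \<open>\<open>par_assoc\<close> is an adjoint by definition, so its own adjoint is the
  associator of \<open>\<otimes>\<close> on the opposites, up to double opposites that are the
  identity on elements. Hence pure tensors go to pure tensors.\<close>

lemma opposite2_par_assoc_pure: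
  assumes "a \<in> carrier A" "b \<in> carrier B" "c \<in> carrier C"
  shows "Map ((par_assoc A B C)\<degree>\<^sub>2) (pure_tensor ((B \<oplus> C)\<degree>) (A\<degree>) (pure_tensor (C\<degree>) (B\<degree>) c b) a) =
    pure_tensor (C\<degree>) ((A \<oplus> B)\<degree>) c (pure_tensor (B\<degree>) (A\<degree>) b a)"
  using assms by (simp add: par_assoc_def par_def)

end

declare par_assoc_iso [simp] opposite2_par_assoc_pure [simp]

lemma par_lunit_simps [simp]: "Dom (par_lunit A) = bot_cell (src A) \<oplus> A" "Cod (par_lunit A) = A"
  and par_runit_simps [simp]: "Dom (par_runit A) = A \<oplus> bot_cell (tgt A)" "Cod (par_runit A) = A"
  by (simp_all add: par_lunit_def par_runit_def par_def bot_cell_def)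

lemma par_lunit_iso [simp]: "bmod A \<Longrightarrow> iso_ok (par_lunit A)"
  and par_runit_iso [simp]: "bmod A \<Longrightarrow> iso_ok (par_runit A)"
  by (simp_all add: par_lunit_def par_runit_def)

text \<open>The unit of \<open>\<oplus>\<close> is the inverse of an adjoint, so its adjoint is the
  inverse of the right unit of \<open>\<otimes>\<close> at \<open>A\<degree>\<close>, which tensors
  with \<open>\<top>\<close>. In the reversed order of \<open>bot_cell\<close> this
  \<open>\<top>\<close> is the least element.\<close>

lemma opposite2_par_lunit [simp]:
  assumes A: "bmod A" and a: "a \<in> carrier A"
  shows "Map ((par_lunit A)\<degree>\<^sub>2) a = pure_tensor (A\<degree>) ((bot_cell (src A))\<degree>) a \<top>\<^bsub>src A\<^esub>"
proof -
  let ?l = "(id2 (A\<degree>) \<otimes>\<^sub>2 double_opposite (top_cell (src A))) \<Zsemi> tensor_runit (A\<degree>)"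
  have "Map ((inv2 (?l\<degree>\<^sub>2))\<degree>\<^sub>2) a = Map (inv2 (?l\<degree>\<^sub>2\<degree>\<^sub>2)) a"
    by (rule opposite2_inv2) (use A a in simp_all)
  also have "\<dots> = pure_tensor (A\<degree>) ((bot_cell (src A))\<degree>) a \<top>\<^bsub>src A\<^esub>"
    by (rule inv2_eqI) (use A a in \<open>simp_all add: bot_cell_def\<close>)
  finally show ?thesis using A a by (simp add: par_lunit_def)
qed

lemma opposite2_par_runit [simp]:
  assumes A: "bmod A" and a: "a \<in> carrier A"
  shows "Map ((par_runit A)\<degree>\<^sub>2) a = pure_tensor ((bot_cell (tgt A))\<degree>) (A\<degree>) \<top>\<^bsub>tgt A\<^esub> a"
proof -
  let ?l = "(double_opposite (top_cell (tgt A)) \<otimes>\<^sub>2 id2 (A\<degree>)) \<Zsemi> tensor_lunit (A\<degree>)"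
  have "Map ((inv2 (?l\<degree>\<^sub>2))\<degree>\<^sub>2) a = Map (inv2 (?l\<degree>\<^sub>2\<degree>\<^sub>2)) a"
    by (rule opposite2_inv2) (use A a in simp_all)
  also have "\<dots> = pure_tensor ((bot_cell (tgt A))\<degree>) (A\<degree>) \<top>\<^bsub>tgt A\<^esub> a"
    by (rule inv2_eqI) (use A a in \<open>simp_all add: bot_cell_def\<close>)
  finally show ?thesis using A a by (simp add: par_runit_def)
qed

lemma par_assoc_natural:
  assumes [simp]: "cell_ok f" "cell_ok g" "cell_ok h" "tgt (Cod f) = src (Cod g)" "tgt (Cod g) = src (Cod h)"
  shows "((f \<oplus>\<^sub>2 g) \<oplus>\<^sub>2 h) \<Zsemi> par_assoc (Cod f) (Cod g) (Cod h)
    = par_assoc (Dom f) (Dom g) (Dom h) \<Zsemi> (f \<oplus>\<^sub>2 (g \<oplus>\<^sub>2 h))"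
  by (rule par3_cell_ext[where A = "Cod f" and B = "Cod g" and C = "Cod h"]) (simp_all add: opposite2_closed)

lemma par_lunit_natural:
  assumes [simp]: "cell_ok f"
  shows "(id2 (bot_cell (src (Cod f))) \<oplus>\<^sub>2 f) \<Zsemi> par_lunit (Cod f) = par_lunit (Dom f) \<Zsemi> f"
  by (rule opposite2_inject; (rule cell_eqI)?) (simp_all add: opposite2_closed)

lemma par_runit_natural:
  assumes [simp]: "cell_ok f"
  shows "(f \<oplus>\<^sub>2 id2 (bot_cell (tgt (Cod f)))) \<Zsemi> par_runit (Cod f) = par_runit (Dom f) \<Zsemi> f"
  by (rule opposite2_inject; (rule cell_eqI)?) (simp_all add: opposite2_closed)

lemma par_triangle:
  assumes [simp]: "bmod A" "bmod B" and AB [simp]: "tgt A = Y" "src B = Y"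
  shows "par_assoc A (bot_cell Y) B \<Zsemi> (id2 A \<oplus>\<^sub>2 par_lunit B) = par_runit A \<oplus>\<^sub>2 id2 B"
proof -
  have [simp]: "is_locale Y" using bmod_loc(2)[of A] by simp
  show ?thesis
    by (rule par_cell_ext[where A = A and B = B]) simp_all
qed

lemma par_pentagon:
  assumes [simp]: "bmod A" "bmod B" "bmod C" "bmod D"
    and AB [simp]: "tgt A = src B" and BC [simp]: "tgt B = src C" and CD [simp]: "tgt C = src D"
  shows "(par_assoc A B C \<oplus>\<^sub>2 id2 D) \<Zsemi> par_assoc A (B \<oplus> C) D \<Zsemi> (id2 A \<oplus>\<^sub>2 par_assoc B C D)
    = par_assoc (A \<oplus> B) C D \<Zsemi> par_assoc A B (C \<oplus> D)" (is "?f = ?g")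
proof (rule par3_cell_ext[where A = A and B = B and C = "C \<oplus> D"])
  have ok: "cell_ok ?f" "cell_ok ?g" by simp_all
  have fg: "sup_hom ((B \<oplus> (C \<oplus> D))\<degree> \<otimes> A\<degree>) ((((A \<oplus> B) \<oplus> C) \<oplus> D)\<degree>) (Map (?f\<degree>\<^sub>2))"
    "sup_hom ((B \<oplus> (C \<oplus> D))\<degree> \<otimes> A\<degree>) ((((A \<oplus> B) \<oplus> C) \<oplus> D)\<degree>) (Map (?g\<degree>\<^sub>2))"
    using cell_okD(5)[OF opposite2_ok[OF ok(1)]] cell_okD(5)[OF opposite2_ok[OF ok(2)]]
    by (simp_all add: par_def[of A "B \<oplus> (C \<oplus> D)"] sup_hom_double_opposite)
  fix a b V assume a: "a \<in> carrier A" and b: "b \<in> carrier B" and V: "V \<in> carrier (C \<oplus> D)"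
  let ?p = "\<lambda>V. pure_tensor ((B \<oplus> (C \<oplus> D))\<degree>) (A\<degree>) (pure_tensor ((C \<oplus> D)\<degree>) (B\<degree>) V b) a"
  have p1: "sup_hom ((C \<oplus> D)\<degree>) ((C \<oplus> D)\<degree> \<otimes> B\<degree>) (\<lambda>V. pure_tensor ((C \<oplus> D)\<degree>) (B\<degree>) V b)"
    by (rule sup_hom_pure(1)) (use b in simp_all)
  have p2: "sup_hom ((B \<oplus> (C \<oplus> D))\<degree>) ((B \<oplus> (C \<oplus> D))\<degree> \<otimes> A\<degree>)
      (\<lambda>V. pure_tensor ((B \<oplus> (C \<oplus> D))\<degree>) (A\<degree>) V a)"
    by (rule sup_hom_pure(1)) (use a in simp_all)
  \<comment> \<open>\<open>p1\<close> ends in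
    \<open>(C \<oplus> D)\<degree> \<otimes> B\<degree>\<close>, while \<open>p2\<close> starts at
    the double opposite of that module. The common order makes the two maps composable.\<close>
  then have "sup_hom ((C \<oplus> D)\<degree> \<otimes> B\<degree>) ((B \<oplus> (C \<oplus> D))\<degree> \<otimes> A\<degree>)
      (\<lambda>V. pure_tensor ((B \<oplus> (C \<oplus> D))\<degree>) (A\<degree>) V a)"
    unfolding par_def[of B "C \<oplus> D"] by (simp add: sup_hom_double_opposite)
  from sup_hom_comp[OF p1 this] have p: "sup_hom ((C \<oplus> D)\<degree>) ((B \<oplus> (C \<oplus> D))\<degree> \<otimes> A\<degree>) ?p" .
  show "Map (?f\<degree>\<^sub>2) (?p V) = Map (?g\<degree>\<^sub>2) (?p V)"
    by (rule sup_hom_par_ext[OF _ _ _ sup_hom_comp[OF p fg(1)] sup_hom_comp[OF p fg(2)]])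
      (use a b V in simp_all)
qed simp_all

section \<open>Hom modules\<close>

lemma rhom_simps [simp]:
  "carrier (B \<lhd> A) = right_homs A B" "src (B \<lhd> A) = src B" "tgt (B \<lhd> A) = src A"
  "f \<sqsubseteq>\<^bsub>B \<lhd> A\<^esub> g \<longleftrightarrow> (\<forall>a\<in>carrier A. f a \<sqsubseteq>\<^bsub>B\<^esub> g a)"
  "lact (B \<lhd> A) w f = (\<lambda>a\<in>carrier A. lact B w (f a))"
  "ract (B \<lhd> A) f x = (\<lambda>a\<in>carrier A. f (lact A x a))"
  by (simp_all add: rhom_def)

lemma lhom_simps [simp]:
  "carrier (A \<rhd> C) = left_homs A C" "src (A \<rhd> C) = tgt A" "tgt (A \<rhd> C) = tgt C"
  "f \<sqsubseteq>\<^bsub>A \<rhd> C\<^esub> g \<longleftrightarrow> (\<forall>a\<in>carrier A. f a \<sqsubseteq>\<^bsub>C\<^esub> g a)"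
  "lact (A \<rhd> C) y f = (\<lambda>a\<in>carrier A. f (ract A a y))"
  "ract (A \<rhd> C) f z = (\<lambda>a\<in>carrier A. ract C (f a) z)"
  by (simp_all add: lhom_def)

lemma sup_maps_iff:
  assumes "complete_lattice A" "complete_lattice B"
  shows "f \<in> sup_maps A B \<longleftrightarrow> sup_hom A B f \<and> f \<in> extensional (carrier A)"
  using assms by (auto simp: sup_maps_def sup_hom_def PiE_def)

lemma sup_hom_restrict:
  "sup_hom A B (\<lambda>a\<in>carrier A. f a) \<longleftrightarrow> sup_hom A B f"
  by (rule sup_hom_cong) simp

context
  fixes A :: "('a, 'x, 'y) bimod" and B :: "('b, 'w, 'y) bimod"
  assumes A [simp]: "bmod A" and B [simp]: "bmod B" and AB [simp]: "tgt A = tgt B"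
begin

lemma right_homs_iff:
  "f \<in> right_homs A B \<longleftrightarrow> sup_hom A B f \<and> f \<in> extensional (carrier A) \<and>
     (\<forall>y\<in>carrier (tgt B). \<forall>a\<in>carrier A. f (ract A a y) = ract B (f a) y)"
  by (auto simp: right_homs_def sup_maps_iff)

lemma right_homs_closed: "\<lbrakk>f \<in> right_homs A B; a \<in> carrier A\<rbrakk> \<Longrightarrow> f a \<in> carrier B"
  by (auto simp: right_homs_iff dest: sup_homD)

lemma right_homs_eqI:
  "\<lbrakk>f \<in> right_homs A B; g \<in> right_homs A B; \<And>a. a \<in> carrier A \<Longrightarrow> f a = g a\<rbrakk> \<Longrightarrow> f = g"
  by (auto simp: right_homs_iff intro: extensionalityI)

text \<open>Suprema of homomorphisms are pointwise: suprema commute with suprema, and the action on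
  \<open>B\<close> preserves them.\<close>

lemma right_homs_sup:
  assumes F: "F \<subseteq> right_homs A B"
  shows "(\<lambda>a\<in>carrier A. \<Squnion>\<^bsub>B\<^esub> ((\<lambda>f. f a) ` F)) \<in> right_homs A B"
proof -
  have c: "(\<lambda>f. f a) ` F \<subseteq> carrier B" if "a \<in> carrier A" for a
    using F that right_homs_closed by auto
  have h: "sup_hom A B f" if "f \<in> F" for f using F that by (auto simp: right_homs_iff)
  have "sup_hom A B (\<lambda>a. \<Squnion>\<^bsub>B\<^esub> ((\<lambda>f. f a) ` F))"
  proof (rule sup_homI)
    fix S z assume S: "S \<subseteq> carrier A" and z: "z \<in> carrier B"
    have "(\<forall>f\<in>F. f (\<Squnion>\<^bsub>A\<^esub> S) \<sqsubseteq>\<^bsub>B\<^esub> z) \<longleftrightarrow> (\<forall>a\<in>S. \<forall>f\<in>F. f a \<sqsubseteq>\<^bsub>B\<^esub> z)"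
      using sup_hom_sup_le_iff[OF h S z] by auto
    moreover have "\<Squnion>\<^bsub>B\<^esub> ((\<lambda>f. f a) ` F) \<sqsubseteq>\<^bsub>B\<^esub> z \<longleftrightarrow> (\<forall>f\<in>F. f a \<sqsubseteq>\<^bsub>B\<^esub> z)" if "a \<in> carrier A" for a
      by (subst cl_sup_le_iff[OF _ c[OF that] z]) simp_all
    ultimately show "\<Squnion>\<^bsub>B\<^esub> ((\<lambda>f. f (\<Squnion>\<^bsub>A\<^esub> S)) ` F) \<sqsubseteq>\<^bsub>B\<^esub> z \<longleftrightarrow> (\<forall>a\<in>S. \<Squnion>\<^bsub>B\<^esub> ((\<lambda>f. f a) ` F) \<sqsubseteq>\<^bsub>B\<^esub> z)"
      using S by (simp add: cl_sup_closed subset_iff)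
  qed (simp_all add: cl_sup_closed c)
  moreover have "\<Squnion>\<^bsub>B\<^esub> ((\<lambda>f. f (ract A a y)) ` F) = ract B (\<Squnion>\<^bsub>B\<^esub> ((\<lambda>f. f a) ` F)) y"
    if "y \<in> carrier (tgt B)" "a \<in> carrier A" for a y
  proof -
    have "(\<lambda>f. f (ract A a y)) ` F = (\<lambda>f. ract B (f a) y) ` F"
      using F that by (intro image_cong) (auto simp: right_homs_iff)
    then show ?thesis
      using sup_homD(4)[OF ract_sup_hom[OF B that(1)] c[OF that(2)]] by (simp add: image_image)
  qed
  ultimately show ?thesis by (simp add: right_homs_iff sup_hom_restrict)
qed

lemma rhom_sup_le_iff:
  assumes F: "F \<subseteq> right_homs A B" and z: "z \<in> right_homs A B"
  shows "(\<forall>a\<in>carrier A. \<Squnion>\<^bsub>B\<^esub> ((\<lambda>f. f a) ` F) \<sqsubseteq>\<^bsub>B\<^esub> z a) \<longleftrightarrow> (\<forall>f\<in>F. \<forall>a\<in>carrier A. f a \<sqsubseteq>\<^bsub>B\<^esub> z a)"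
proof -
  have "\<Squnion>\<^bsub>B\<^esub> ((\<lambda>f. f a) ` F) \<sqsubseteq>\<^bsub>B\<^esub> z a \<longleftrightarrow> (\<forall>f\<in>F. f a \<sqsubseteq>\<^bsub>B\<^esub> z a)" if "a \<in> carrier A" for a
    by (subst cl_sup_le_iff) (use F z that right_homs_closed in auto)
  then show ?thesis by blast
qed

lemma rhom_cl: "complete_lattice (B \<lhd> A)"
proof (rule complete_lattice_supI)
  fix F assume "F \<subseteq> carrier (B \<lhd> A)"
  then have F: "F \<subseteq> right_homs A B" by simp
  show "\<exists>s\<in>carrier (B \<lhd> A). \<forall>z\<in>carrier (B \<lhd> A). s \<sqsubseteq>\<^bsub>B \<lhd> A\<^esub> z \<longleftrightarrow> (\<forall>a\<in>F. a \<sqsubseteq>\<^bsub>B \<lhd> A\<^esub> z)"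
    using right_homs_sup[OF F] rhom_sup_le_iff[OF F]
    by (intro bexI[of _ "\<lambda>a\<in>carrier A. \<Squnion>\<^bsub>B\<^esub> ((\<lambda>f. f a) ` F)"]) simp_all
next
  fix f g h assume "f \<sqsubseteq>\<^bsub>B \<lhd> A\<^esub> g" "g \<sqsubseteq>\<^bsub>B \<lhd> A\<^esub> h" "f \<in> carrier (B \<lhd> A)" "g \<in> carrier (B \<lhd> A)" "h \<in> carrier (B \<lhd> A)"
  then show "f \<sqsubseteq>\<^bsub>B \<lhd> A\<^esub> h"
    by (auto intro: cl_trans[OF bmod_cl[OF B], of "f a" "g a" "h a" for a] simp: right_homs_closed)
next
  fix f g assume "f \<sqsubseteq>\<^bsub>B \<lhd> A\<^esub> g" "g \<sqsubseteq>\<^bsub>B \<lhd> A\<^esub> f" "f \<in> carrier (B \<lhd> A)" "g \<in> carrier (B \<lhd> A)"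
  then show "f = g"
    by (intro right_homs_eqI) (auto intro: cl_antisym[OF bmod_cl[OF B]] right_homs_closed)
qed (auto simp: cl_refl right_homs_closed, simp add: rhom_def)

lemma rhom_sup:
  assumes "F \<subseteq> right_homs A B" "a \<in> carrier A"
  shows "(\<Squnion>\<^bsub>B \<lhd> A\<^esub> F) a = \<Squnion>\<^bsub>B\<^esub> ((\<lambda>f. f a) ` F)"
proof -
  have "\<Squnion>\<^bsub>B \<lhd> A\<^esub> F = (\<lambda>a\<in>carrier A. \<Squnion>\<^bsub>B\<^esub> ((\<lambda>f. f a) ` F))"
    by (rule cl_sup_eqI[OF rhom_cl]) (use assms right_homs_sup rhom_sup_le_iff in simp_all)
  then show ?thesis using assms by simp
qed

lemma sup_hom_rhom_eval: "a \<in> carrier A \<Longrightarrow> sup_hom (B \<lhd> A) B (\<lambda>f. f a)"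
  by (auto simp: sup_hom_def rhom_cl rhom_sup right_homs_closed)

lemma sup_hom_rhomI:
  assumes L: "complete_lattice L" and f: "\<And>l. l \<in> carrier L \<Longrightarrow> f l \<in> right_homs A B"
    and sp: "\<And>a. a \<in> carrier A \<Longrightarrow> sup_hom L B (\<lambda>l. f l a)"
  shows "sup_hom L (B \<lhd> A) f"
proof (rule sup_homI)
  fix S z assume S: "S \<subseteq> carrier L" and z: "z \<in> carrier (B \<lhd> A)"
  have "f (\<Squnion>\<^bsub>L\<^esub> S) a \<sqsubseteq>\<^bsub>B\<^esub> z a \<longleftrightarrow> (\<forall>l\<in>S. f l a \<sqsubseteq>\<^bsub>B\<^esub> z a)" if "a \<in> carrier A" for a
    using sup_hom_sup_le_iff[OF sp[OF that] S] right_homs_closed z that by simp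
  then show "f (\<Squnion>\<^bsub>L\<^esub> S) \<sqsubseteq>\<^bsub>B \<lhd> A\<^esub> z \<longleftrightarrow> (\<forall>l\<in>S. f l \<sqsubseteq>\<^bsub>B \<lhd> A\<^esub> z)" by auto
qed (use L f rhom_cl in simp_all)

lemma rhom_act_closed:
  assumes f: "f \<in> right_homs A B"
  shows "w \<in> carrier (src B) \<Longrightarrow> (\<lambda>a\<in>carrier A. lact B w (f a)) \<in> right_homs A B"
    and "x \<in> carrier (src A) \<Longrightarrow> (\<lambda>a\<in>carrier A. f (lact A x a)) \<in> right_homs A B"
proof -
  have fh: "sup_hom A B f" using f by (simp add: right_homs_iff)
  note [simp] = right_homs_closed[OF f]
  show "(\<lambda>a\<in>carrier A. lact B w (f a)) \<in> right_homs A B" if "w \<in> carrier (src B)"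
    using f that sup_hom_comp[OF fh lact_sup_hom[OF B that]]
    by (simp add: right_homs_iff sup_hom_restrict lact_ract)
  show "(\<lambda>a\<in>carrier A. f (lact A x a)) \<in> right_homs A B" if "x \<in> carrier (src A)"
    using f that sup_hom_comp[OF lact_sup_hom[OF A that] fh]
    by (simp add: right_homs_iff sup_hom_restrict lact_ract)
qed

lemma rhom_bmod: "bmod (B \<lhd> A)"
proof (rule bmodI)
  fix w assume w: "w \<in> carrier (src (B \<lhd> A))"
  show "sup_hom (B \<lhd> A) (B \<lhd> A) (lact (B \<lhd> A) w)"
  proof (rule sup_hom_rhomI[OF rhom_cl])
    fix a assume a: "a \<in> carrier A"
    show "sup_hom (B \<lhd> A) B (\<lambda>f. lact (B \<lhd> A) w f a)"
      using a w sup_hom_comp[OF sup_hom_rhom_eval lact_sup_hom[OF B, of w]] by simp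
  qed (use w rhom_act_closed in simp)
next
  fix f assume "f \<in> carrier (B \<lhd> A)"
  then have f: "f \<in> right_homs A B" by simp
  show "sup_hom (src (B \<lhd> A)) (B \<lhd> A) (\<lambda>w. lact (B \<lhd> A) w f)"
  proof (rule sup_hom_rhomI)
    fix a assume a: "a \<in> carrier A"
    show "sup_hom (src (B \<lhd> A)) B (\<lambda>w. lact (B \<lhd> A) w f a)"
      using a f right_homs_closed lact_sup_hom_src[OF B] by simp
  qed (use f rhom_act_closed in simp_all)
  have fh: "sup_hom A B f" using f by (simp add: right_homs_iff)
  show "sup_hom (tgt (B \<lhd> A)) (B \<lhd> A) (ract (B \<lhd> A) f)"
  proof (rule sup_hom_rhomI)
    fix a assume a: "a \<in> carrier A"
    show "sup_hom (tgt (B \<lhd> A)) B (\<lambda>x. ract (B \<lhd> A) f x a)"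
      using a sup_hom_comp[OF lact_sup_hom_src[OF A a] fh] by simp
  qed (use f rhom_act_closed in simp_all)
  show "lact (B \<lhd> A) \<top>\<^bsub>src (B \<lhd> A)\<^esub> f = f" "ract (B \<lhd> A) f \<top>\<^bsub>tgt (B \<lhd> A)\<^esub> = f"
    by (rule right_homs_eqI; use f rhom_act_closed right_homs_closed in simp)+
next
  fix x assume x: "x \<in> carrier (tgt (B \<lhd> A))"
  show "sup_hom (B \<lhd> A) (B \<lhd> A) (\<lambda>f. ract (B \<lhd> A) f x)"
  proof (rule sup_hom_rhomI[OF rhom_cl])
    fix a assume a: "a \<in> carrier A"
    show "sup_hom (B \<lhd> A) B (\<lambda>f. ract (B \<lhd> A) f x a)"
      using a x sup_hom_rhom_eval[of "lact A x a"] by simp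
  qed (use x rhom_act_closed in simp)
qed (auto intro!: restrict_ext simp: rhom_act_closed right_homs_closed lact_meet meet_commute[of "src A"])

lemma reval_bimap: "bimap (B \<lhd> A) A B (\<lambda>f a. f a)"
  by (rule bimapI) (simp_all add: sup_hom_rhom_eval right_homs_iff)

end

text \<open>Since locales are commutative, interchanging the two actions of a module gives a module, and
  this turns \<open>\<lhd>\<close> into \<open>\<rhd>\<close>.\<close>

definition mirror :: "('a, 'x, 'y) bimod \<Rightarrow> ('a, 'y, 'x) bimod" where
  "mirror A = \<lparr>carrier = carrier A, eq = eq A, le = le A, src = tgt A, tgt = src A,
     lact = (\<lambda>y a. ract A a y), ract = (\<lambda>a x. lact A x a)\<rparr>"

lemma mirror_simps [simp]:
  "carrier (mirror A) = carrier A" "src (mirror A) = tgt A" "tgt (mirror A) = src A"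
  "lact (mirror A) = (\<lambda>y a. ract A a y)" "ract (mirror A) = (\<lambda>a x. lact A x a)"
  by (simp_all add: mirror_def)

lemma mirror_le [simp]: "a \<sqsubseteq>\<^bsub>mirror A\<^esub> b \<longleftrightarrow> a \<sqsubseteq>\<^bsub>A\<^esub> b"
  by (simp add: mirror_def)

lemma sup_mirror [simp]: "\<Squnion>\<^bsub>mirror A\<^esub> S = \<Squnion>\<^bsub>A\<^esub> S"
  by (simp add: sup_def least_def Upper_def mirror_def)

lemma mirror_cl: "complete_lattice A \<Longrightarrow> complete_lattice (mirror A)"
proof (rule complete_lattice_supI)
  fix S assume "complete_lattice A" "S \<subseteq> carrier (mirror A)"
  then show "\<exists>s\<in>carrier (mirror A). \<forall>z\<in>carrier (mirror A). s \<sqsubseteq>\<^bsub>mirror A\<^esub> z \<longleftrightarrow> (\<forall>a\<in>S. a \<sqsubseteq>\<^bsub>mirror A\<^esub> z)"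
    by (intro bexI[of _ "\<Squnion>\<^bsub>A\<^esub> S"]) (simp_all add: mirror_def cl_sup_le_iff cl_sup_closed)
qed (auto simp: mirror_def cl_eq cl_refl intro: cl_trans cl_antisym)

lemma mirror_mirror [simp]: "mirror (mirror A) = A"
  by (simp add: mirror_def)

lemma mirror_cl_iff [simp]: "complete_lattice (mirror A) \<longleftrightarrow> complete_lattice A"
  using mirror_cl[of A] mirror_cl[of "mirror A"] by auto

lemma sup_hom_from_mirror [simp]: "sup_hom (mirror A) L f \<longleftrightarrow> sup_hom A L f"
  by (simp add: sup_hom_def)

lemma sup_hom_to_mirror [simp]: "sup_hom L (mirror A) f \<longleftrightarrow> sup_hom L A f"
  by (simp add: sup_hom_def)

lemma mirror_bmod [simp]: "bmod A \<Longrightarrow> bmod (mirror A)"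
  by (rule bmodI)
    (simp_all add: lact_ract lact_meet[symmetric] ract_meet[symmetric] meet_commute)

lemma left_homs_mirror: "left_homs A C = right_homs (mirror A) (mirror C)"
  by (simp add: left_homs_def right_homs_def sup_maps_def)

text \<open>This is an equality of records, so facts about right homomorphisms transfer by
  rewriting.\<close>

lemma lhom_mirror: "A \<rhd> C = mirror (mirror C \<lhd> mirror A)"
  by (simp add: lhom_def rhom_def mirror_def[of "\<lparr>carrier = _, eq = _, \<dots> = _\<rparr>"] left_homs_mirror)

context
  fixes A :: "('a, 'x, 'y) bimod" and C :: "('c, 'x, 'z) bimod"
  assumes A [simp]: "bmod A" and C [simp]: "bmod C" and AC [simp]: "src A = src C"
begin

lemma left_homs_iff:
  "f \<in> left_homs A C \<longleftrightarrow> sup_hom A C f \<and> f \<in> extensional (carrier A) \<and>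
     (\<forall>x\<in>carrier (src C). \<forall>a\<in>carrier A. f (lact A x a) = lact C x (f a))"
  by (simp add: left_homs_mirror right_homs_iff)

lemma left_homs_closed: "\<lbrakk>f \<in> left_homs A C; a \<in> carrier A\<rbrakk> \<Longrightarrow> f a \<in> carrier C"
  by (auto simp: left_homs_iff dest: sup_homD)

lemma lhom_bmod: "bmod (A \<rhd> C)"
  by (simp add: lhom_mirror rhom_bmod)

lemma sup_hom_lhom_eval: "a \<in> carrier A \<Longrightarrow> sup_hom (A \<rhd> C) C (\<lambda>f. f a)"
  using sup_hom_rhom_eval[of "mirror A" "mirror C" a] by (simp add: lhom_mirror)

lemma sup_hom_lhomI:
  assumes "complete_lattice L" and "\<And>l. l \<in> carrier L \<Longrightarrow> f l \<in> left_homs A C"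
    and "\<And>a. a \<in> carrier A \<Longrightarrow> sup_hom L C (\<lambda>l. f l a)"
  shows "sup_hom L (A \<rhd> C) f"
  using sup_hom_rhomI[of "mirror A" "mirror C" L f] assms by (simp add: lhom_mirror left_homs_mirror)

lemma lhom_act_closed:
  assumes "f \<in> left_homs A C"
  shows "z \<in> carrier (tgt C) \<Longrightarrow> (\<lambda>a\<in>carrier A. ract C (f a) z) \<in> left_homs A C"
    and "y \<in> carrier (tgt A) \<Longrightarrow> (\<lambda>a\<in>carrier A. f (ract A a y)) \<in> left_homs A C"
  using rhom_act_closed[of "mirror A" "mirror C" f] assms by (simp_all add: left_homs_mirror)

lemma leval_bimap: "bimap A (A \<rhd> C) C (\<lambda>a f. f a)"
  by (rule bimapI) (simp_all add: sup_hom_lhom_eval left_homs_iff)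

end

declare rhom_bmod [simp] lhom_bmod [simp]

subsection \<open>Evaluation, transposition and precomposition\<close>

lemma reval_simps [simp]: "Dom (reval B A) = (B \<lhd> A) \<otimes> A" "Cod (reval B A) = B"
  and leval_simps [simp]: "Dom (leval A C) = A \<otimes> (A \<rhd> C)" "Cod (leval A C) = C"
  by (simp_all add: reval_def leval_def)

lemma reval_pure [simp]:
  "\<lbrakk>bmod A; bmod B; tgt A = tgt B; f \<in> right_homs A B; a \<in> carrier A\<rbrakk> \<Longrightarrow>
    Map (reval B A) (pure_tensor (B \<lhd> A) A f a) = f a"
  by (simp add: reval_def sup_lift_pure reval_bimap)

lemma leval_pure [simp]:
  "\<lbrakk>bmod A; bmod C; src A = src C; f \<in> left_homs A C; a \<in> carrier A\<rbrakk> \<Longrightarrow>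
    Map (leval A C) (pure_tensor A (A \<rhd> C) a f) = f a"
  by (simp add: leval_def sup_lift_pure leval_bimap)

lemma reval_ok [simp]: "\<lbrakk>bmod A; bmod B; tgt A = tgt B\<rbrakk> \<Longrightarrow> cell_ok (reval B A)"
  unfolding reval_def by (rule tensor_lift_ok) (simp_all add: reval_bimap right_homs_iff)

lemma leval_ok [simp]: "\<lbrakk>bmod A; bmod C; src A = src C\<rbrakk> \<Longrightarrow> cell_ok (leval A C)"
  unfolding leval_def by (rule tensor_lift_ok) (simp_all add: leval_bimap left_homs_iff)

lemma rtranspose_simps [simp]:
  "Dom (rtranspose M P h) = M" "Cod (rtranspose M P h) = Cod h \<lhd> P"
  "m \<in> carrier M \<Longrightarrow> Map (rtranspose M P h) m = (\<lambda>p\<in>carrier P. Map h (pure_tensor M P m p))"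
  by (simp_all add: rtranspose_def)

lemma ltranspose_simps [simp]:
  "Dom (ltranspose P M h) = M" "Cod (ltranspose P M h) = P \<rhd> Cod h"
  "m \<in> carrier M \<Longrightarrow> Map (ltranspose P M h) m = (\<lambda>p\<in>carrier P. Map h (pure_tensor P M p m))"
  by (simp_all add: ltranspose_def)

text \<open>Equivariance over the two outer locales is inherited from \<open>h\<close> on pure
  tensors; over the middle locale, where the hom module acts by shifting the argument in
  \<open>P\<close>, it is the balancing of pure tensors.\<close>

lemma rtranspose_ok [simp]:
  assumes h: "cell_ok h" and Dh: "Dom h = M \<otimes> P" and M [simp]: "bmod M" and P [simp]: "bmod P"
    and MP: "tgt M = src P"
  shows "cell_ok (rtranspose M P h)"
proof -
  note D = cell_okD[OF h, unfolded Dh]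
  have [simp]: "src (Cod h) = src M" "tgt (Cod h) = tgt P" using D(3,4) by simp_all
  have l: "Map h (pure_tensor M P (lact M w m) p) = lact (Cod h) w (Map h (pure_tensor M P m p))"
    if "w \<in> carrier (src M)" "m \<in> carrier M" "p \<in> carrier P" for w m p
    using D(7)[of w "pure_tensor M P m p"] that MP by simp
  have r: "Map h (pure_tensor M P m (ract P p y)) = ract (Cod h) (Map h (pure_tensor M P m p)) y"
    if "y \<in> carrier (tgt P)" "m \<in> carrier M" "p \<in> carrier P" for y m p
    using D(8)[of y "pure_tensor M P m p"] that MP by simp
  have c: "(\<lambda>p\<in>carrier P. Map h (pure_tensor M P m p)) \<in> right_homs P (Cod h)" if "m \<in> carrier M" for m
    using that h MP sup_hom_comp[OF sup_hom_pure(2) D(5)]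
    by (simp add: right_homs_iff sup_hom_restrict r)
  have "sup_hom M (Cod h \<lhd> P) (Map (rtranspose M P h))"
  proof (rule sup_hom_rhomI)
    fix p assume p: "p \<in> carrier P"
    then show "sup_hom M (Cod h) (\<lambda>m. Map (rtranspose M P h) m p)"
      using sup_hom_comp[OF sup_hom_pure(1) D(5)] MP by (subst sup_hom_cong) auto
  qed (use h c in simp_all)
  moreover have "Map (rtranspose M P h) \<in> extensional (carrier M)" by (simp add: rtranspose_def)
  ultimately show ?thesis
    unfolding cell_ok_def[of "rtranspose M P h"] using h MP
    by (auto simp: l pure_balanced intro!: restrict_ext)
qed

lemma ltranspose_ok [simp]:
  assumes h: "cell_ok h" and Dh: "Dom h = P \<otimes> M" and M [simp]: "bmod M" and P [simp]: "bmod P"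
    and PM: "tgt P = src M"
  shows "cell_ok (ltranspose P M h)"
proof -
  note D = cell_okD[OF h, unfolded Dh]
  have [simp]: "src (Cod h) = src P" "tgt (Cod h) = tgt M" using D(3,4) by simp_all
  have l: "Map h (pure_tensor P M (lact P w p) m) = lact (Cod h) w (Map h (pure_tensor P M p m))"
    if "w \<in> carrier (src P)" "m \<in> carrier M" "p \<in> carrier P" for w m p
    using D(7)[of w "pure_tensor P M p m"] that PM by simp
  have r: "Map h (pure_tensor P M p (ract M m y)) = ract (Cod h) (Map h (pure_tensor P M p m)) y"
    if "y \<in> carrier (tgt M)" "m \<in> carrier M" "p \<in> carrier P" for y m p
    using D(8)[of y "pure_tensor P M p m"] that PM by simp
  have c: "(\<lambda>p\<in>carrier P. Map h (pure_tensor P M p m)) \<in> left_homs P (Cod h)" if "m \<in> carrier M" for m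
    using that h PM sup_hom_comp[OF sup_hom_pure(1) D(5)]
    by (simp add: left_homs_iff sup_hom_restrict l)
  have "sup_hom M (P \<rhd> Cod h) (Map (ltranspose P M h))"
  proof (rule sup_hom_lhomI)
    fix p assume p: "p \<in> carrier P"
    then show "sup_hom M (Cod h) (\<lambda>m. Map (ltranspose P M h) m p)"
      using sup_hom_comp[OF sup_hom_pure(2) D(5)] PM by (subst sup_hom_cong) auto
  qed (use h c in simp_all)
  moreover have "Map (ltranspose P M h) \<in> extensional (carrier M)" by (simp add: ltranspose_def)
  ultimately show ?thesis
    unfolding cell_ok_def[of "ltranspose P M h"] using h PM
    by (auto simp: r pure_balanced[symmetric] intro!: restrict_ext)
qed

lemma rprecomp_simps [simp]:
  "Dom (rprecomp B f) = B \<lhd> Cod f" "Cod (rprecomp B f) = B \<lhd> Dom f"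
  "g \<in> right_homs (Cod f) B \<Longrightarrow> Map (rprecomp B f) g = (\<lambda>a\<in>carrier (Dom f). g (Map f a))"
  by (simp_all add: rprecomp_def compose_def)

lemma lprecomp_simps [simp]:
  "Dom (lprecomp f B) = Cod f \<rhd> B" "Cod (lprecomp f B) = Dom f \<rhd> B"
  "g \<in> left_homs (Cod f) B \<Longrightarrow> Map (lprecomp f B) g = (\<lambda>a\<in>carrier (Dom f). g (Map f a))"
  by (simp_all add: lprecomp_def compose_def)

lemma rprecomp_ok [simp]:
  assumes f: "cell_ok f" and B [simp]: "bmod B" and fB [simp]: "tgt (Cod f) = tgt B"
  shows "cell_ok (rprecomp B f)"
proof -
  note D = cell_okD[OF f]
  have c: "(\<lambda>a\<in>carrier (Dom f). g (Map f a)) \<in> right_homs (Dom f) B" if "g \<in> right_homs (Cod f) B" for g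
    using that f sup_hom_comp[OF D(5), of B g] by (simp add: right_homs_iff sup_hom_restrict D(8))
  have "sup_hom (B \<lhd> Cod f) (B \<lhd> Dom f) (Map (rprecomp B f))"
  proof (rule sup_hom_rhomI)
    fix a assume a: "a \<in> carrier (Dom f)"
    then show "sup_hom (B \<lhd> Cod f) B (\<lambda>g. Map (rprecomp B f) g a)"
      using f by (subst sup_hom_cong[where g = "\<lambda>g. g (Map f a)"]) (simp_all add: sup_hom_rhom_eval)
  qed (use f c in simp_all)
  moreover have "Map (rprecomp B f) \<in> extensional (right_homs (Cod f) B)" by (simp add: rprecomp_def)
  ultimately show ?thesis
    unfolding cell_ok_def[of "rprecomp B f"] using f
    by (auto simp: rhom_act_closed D(7) intro!: restrict_ext)
qed

lemma lprecomp_ok [simp]: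
  assumes f: "cell_ok f" and B [simp]: "bmod B" and fB [simp]: "src (Cod f) = src B"
  shows "cell_ok (lprecomp f B)"
proof -
  note D = cell_okD[OF f]
  have c: "(\<lambda>a\<in>carrier (Dom f). g (Map f a)) \<in> left_homs (Dom f) B" if "g \<in> left_homs (Cod f) B" for g
    using that f sup_hom_comp[OF D(5), of B g] by (simp add: left_homs_iff sup_hom_restrict D(7))
  have "sup_hom (Cod f \<rhd> B) (Dom f \<rhd> B) (Map (lprecomp f B))"
  proof (rule sup_hom_lhomI)
    fix a assume a: "a \<in> carrier (Dom f)"
    then show "sup_hom (Cod f \<rhd> B) B (\<lambda>g. Map (lprecomp f B) g a)"
      using f by (subst sup_hom_cong[where g = "\<lambda>g. g (Map f a)"]) (simp_all add: sup_hom_lhom_eval)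
  qed (use f c in simp_all)
  moreover have "Map (lprecomp f B) \<in> extensional (left_homs (Cod f) B)" by (simp add: lprecomp_def)
  ultimately show ?thesis
    unfolding cell_ok_def[of "lprecomp f B"] using f
    by (auto simp: lhom_act_closed D(8) intro!: restrict_ext)
qed

section \<open>Duals of composites as hom modules\<close>

lemmas dual_act = lact_tensor_dual ract_tensor_dual

text \<open>
  \<open>Q'\<close> has the order and the actions of \<open>Q\<degree>\<close>. This covers both \<open>Q' = Q\<degree>\<close> and \<open>Q = Q'\<degree>\<close>; in the second case
  \<open>Q'\<close> and \<open>Q\<degree>\<close> are different records.
\<close>

definition opposite_pair :: "('a, 'x, 'y) bimod \<Rightarrow> ('a, 'y, 'x) bimod \<Rightarrow> bool" where
  "opposite_pair Q Q' \<longleftrightarrow> bmod Q \<and> bmod Q' \<and> src Q' = tgt Q \<and> tgt Q' = src Q \<and> carrier Q' = carrier Q \<and>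
     (\<forall>a\<in>carrier Q. \<forall>b\<in>carrier Q. a \<sqsubseteq>\<^bsub>Q'\<^esub> b \<longleftrightarrow> b \<sqsubseteq>\<^bsub>Q\<^esub> a) \<and>
     (\<forall>a\<in>carrier Q. \<forall>b\<in>carrier Q. \<forall>y\<in>carrier (tgt Q). a \<sqsubseteq>\<^bsub>Q\<^esub> lact Q' y b \<longleftrightarrow> ract Q a y \<sqsubseteq>\<^bsub>Q\<^esub> b) \<and>
     (\<forall>a\<in>carrier Q. \<forall>b\<in>carrier Q. \<forall>x\<in>carrier (src Q). a \<sqsubseteq>\<^bsub>Q\<^esub> ract Q' b x \<longleftrightarrow> lact Q x a \<sqsubseteq>\<^bsub>Q\<^esub> b)"

lemma opposite_pair_opposite [simp]: "bmod A \<Longrightarrow> opposite_pair A (A\<degree>)"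
  by (simp add: opposite_pair_def le_lact_opposite_iff le_ract_opposite_iff)

lemma opposite_opposite_pair [simp]: "bmod A \<Longrightarrow> opposite_pair (A\<degree>) A"
  by (simp add: opposite_pair_def le_lact_opposite_iff le_ract_opposite_iff)

text \<open>The adjunction supplies sup-preservation of \<open>F\<close>; that \<open>G\<close> is
  also a two-sided inverse gives the isomorphism. The explicit formula for \<open>inv2\<close> is
  recorded because the distributions use these isomorphisms in the inverse direction too.\<close>

lemma iso_ok_adjI:
  assumes f: "f = \<lparr>Dom = M, Cod = N, Map = (\<lambda>m\<in>carrier M. F m)\<rparr>"
    and [simp]: "bmod M" "bmod N" "src M = src N" "tgt M = tgt N"
    and F [simp]: "\<And>m. m \<in> carrier M \<Longrightarrow> F m \<in> carrier N" and G [simp]: "\<And>n. n \<in> carrier N \<Longrightarrow> G n \<in> carrier M"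
    and FG: "\<And>m n. m \<in> carrier M \<Longrightarrow> n \<in> carrier N \<Longrightarrow> F m \<sqsubseteq>\<^bsub>N\<^esub> n \<longleftrightarrow> m \<sqsubseteq>\<^bsub>M\<^esub> G n"
    and "\<And>m. m \<in> carrier M \<Longrightarrow> G (F m) = m" "\<And>n. n \<in> carrier N \<Longrightarrow> F (G n) = n"
    and "\<And>x m. \<lbrakk>x \<in> carrier (src N); m \<in> carrier M\<rbrakk> \<Longrightarrow> F (lact M x m) = lact N x (F m)"
    and "\<And>y m. \<lbrakk>y \<in> carrier (tgt N); m \<in> carrier M\<rbrakk> \<Longrightarrow> F (ract M m y) = ract N (F m) y"
  shows "iso_ok f \<and> (\<forall>n\<in>carrier N. Map (inv2 f) n = G n)"
proof -
  have "sup_hom M N (\<lambda>m\<in>carrier M. F m)"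
    unfolding sup_hom_restrict by (rule sup_hom_adjI[where g = G]) (simp_all add: FG)
  then have "cell_ok f" unfolding cell_ok_def f using assms by simp
  then have "iso_ok f" by (rule iso_okI_bij[where g = G]) (use assms in simp_all)
  moreover from this have "Map (inv2 f) n = G n" if "n \<in> carrier N" for n
    by (intro inv2_eqI) (use that assms in simp_all)
  ultimately show ?thesis by simp
qed

text \<open>A homomorphism into the opposite of \<open>Q\<close> and a saturated set are two
  presentations of the same relation: the section at \<open>p\<close> is the principal ideal of
  \<open>Q\<close> generated by \<open>h p\<close>, and conversely \<open>h p\<close> is recovered
  as a residual. Taking \<open>B\<close>, \<open>B\<degree>\<close> for \<open>Q\<close>,
  \<open>Q'\<close> gives \<open>rhom_to_dual\<close>, and taking \<open>A\<degree>\<close>,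
  \<open>A\<close> gives \<open>rhom_to_par\<close>.\<close>

lemma rhom_dual_iso:
  assumes P [simp]: "bmod P" and QQ': "opposite_pair Q Q'" and PQ [simp]: "tgt P = src Q"
    and f: "f = \<lparr>Dom = Q' \<lhd> P, Cod = (P \<otimes> Q)\<degree>,
      Map = (\<lambda>h\<in>carrier (Q' \<lhd> P). {(p, q). p \<in> carrier P \<and> q \<in> carrier Q \<and> h p \<sqsubseteq>\<^bsub>Q'\<^esub> q})\<rparr>"
  shows "iso_ok f \<and> (\<forall>W\<in>carrier ((P \<otimes> Q)\<degree>). Map (inv2 f) W = (\<lambda>p\<in>carrier P. lres Q p W))"
proof (rule iso_ok_adjI[OF f])
  have Q [simp]: "bmod Q" and Q' [simp]: "bmod Q'" and S [simp]: "src Q' = tgt Q" "tgt Q' = src Q"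
    and C [simp]: "carrier Q' = carrier Q"
    and le [simp]: "\<And>a b. a \<in> carrier Q \<Longrightarrow> b \<in> carrier Q \<Longrightarrow> a \<sqsubseteq>\<^bsub>Q'\<^esub> b \<longleftrightarrow> b \<sqsubseteq>\<^bsub>Q\<^esub> a"
    and l [simp]: "\<And>a b y. \<lbrakk>a \<in> carrier Q; b \<in> carrier Q; y \<in> carrier (tgt Q)\<rbrakk> \<Longrightarrow> a \<sqsubseteq>\<^bsub>Q\<^esub> lact Q' y b \<longleftrightarrow> ract Q a y \<sqsubseteq>\<^bsub>Q\<^esub> b"
    and r [simp]: "\<And>a b x. \<lbrakk>a \<in> carrier Q; b \<in> carrier Q; x \<in> carrier (src Q)\<rbrakk> \<Longrightarrow> a \<sqsubseteq>\<^bsub>Q\<^esub> ract Q' b x \<longleftrightarrow> lact Q x a \<sqsubseteq>\<^bsub>Q\<^esub> b"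
    using QQ' by (auto simp: opposite_pair_def)
  have [simp]: "ract Q' a x \<in> carrier Q" if "a \<in> carrier Q" "x \<in> carrier (src Q)" for a x
    using ract_closed[OF Q', of x a] that by simp
  have [simp]: "lact Q' y a \<in> carrier Q" if "a \<in> carrier Q" "y \<in> carrier (tgt Q)" for a y
    using lact_closed[OF Q', of y a] that by simp
  have hc [simp]: "h p \<in> carrier Q" if "h \<in> right_homs P Q'" "p \<in> carrier P" for h p
    using right_homs_closed[OF P Q' _ that] by simp
  note lr [simp] = le_lres_iff[OF P Q PQ, simplified] le_rres_iff[OF P Q PQ, simplified]
  let ?F = "\<lambda>h. {(p, q). p \<in> carrier P \<and> q \<in> carrier Q \<and> h p \<sqsubseteq>\<^bsub>Q'\<^esub> q}"
  let ?G = "\<lambda>W. \<lambda>p\<in>carrier P. lres Q p W"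
  show "bmod (Q' \<lhd> P)" "bmod ((P \<otimes> Q)\<degree>)" "src (Q' \<lhd> P) = src ((P \<otimes> Q)\<degree>)" "tgt (Q' \<lhd> P) = tgt ((P \<otimes> Q)\<degree>)"
    by simp_all
  have Fsat: "?F h \<in> carrier (P \<otimes> Q)" if h: "h \<in> right_homs P Q'" for h
  proof -
    have hs: "sup_hom P Q' h" and hr: "\<And>y p. y \<in> carrier (src Q) \<Longrightarrow> p \<in> carrier P \<Longrightarrow> h (ract P p y) = ract Q' (h p) y"
      using h by (auto simp: right_homs_iff)
    have "saturated P Q (?F h)"
    proof (rule saturatedI)
      fix q assume "q \<in> carrier Q"
      \<comment> \<open>The generator in the first variable is the adjoint of \<open>h\<close> with
        respect to the order of \<open>Q'\<close>; rewriting that order into the one of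
        \<open>Q\<close> would hide the adjunction.\<close>
      then show "\<exists>r\<in>carrier P. \<forall>p\<in>carrier P. (p, q) \<in> ?F h \<longleftrightarrow> p \<sqsubseteq>\<^bsub>P\<^esub> r"
        using hs by (intro bexI[of _ "right_adjoint P Q' h q"])
          (simp_all add: le_right_adjoint_iff right_adjoint_closed del: le)
    next
      fix p assume "p \<in> carrier P"
      then show "\<exists>r\<in>carrier Q. \<forall>q\<in>carrier Q. (p, q) \<in> ?F h \<longleftrightarrow> q \<sqsubseteq>\<^bsub>Q\<^esub> r"
        using h by (intro bexI[of _ "h p"]) simp_all
    qed (use h hr in auto)
    then show ?thesis by simp
  qed
  {
    fix h assume "h \<in> carrier (Q' \<lhd> P)"
    then have h: "h \<in> right_homs P Q'" by simp
    have FC: "?F h \<in> carrier (P \<otimes> Q)" by (rule Fsat[OF h])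
    then show "?F h \<in> carrier ((P \<otimes> Q)\<degree>)" by simp
    have m: "(p, q) \<in> ?F h \<longleftrightarrow> q \<sqsubseteq>\<^bsub>Q\<^esub> h p" if "p \<in> carrier P" "q \<in> carrier Q" for p q
      using that h by simp
    show "?G (?F h) = h"
    proof (rule extensionalityI[of _ "carrier P"])
      fix p assume p: "p \<in> carrier P"
      have "lres Q p (?F h) = h p"
        by (rule cl_eq_lowerI[OF bmod_cl[OF Q]])
          (use p h FC in \<open>simp_all del: le\<close>, use h in simp)
      then show "?G (?F h) p = h p" using p by simp
    qed (use h in \<open>simp_all add: right_homs_iff\<close>)
    fix W assume "W \<in> carrier ((P \<otimes> Q)\<degree>)"
    then have W: "W \<in> carrier (P \<otimes> Q)" by simp
    then have sub: "W \<subseteq> carrier P \<times> carrier Q" using saturatedD(1)[OF P Q PQ, of W] by simp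
    have "lres Q p W \<sqsubseteq>\<^bsub>Q\<^esub> h p \<longleftrightarrow> (\<forall>q\<in>carrier Q. (p, q) \<in> W \<longrightarrow> q \<sqsubseteq>\<^bsub>Q\<^esub> h p)" if "p \<in> carrier P" for p
      unfolding lres_def by (subst cl_sup_le_iff) (use h that in auto)
    moreover have "W \<subseteq> ?F h \<longleftrightarrow> (\<forall>p\<in>carrier P. \<forall>q\<in>carrier Q. (p, q) \<in> W \<longrightarrow> q \<sqsubseteq>\<^bsub>Q\<^esub> h p)"
      using sub h by auto
    ultimately show "?F h \<sqsubseteq>\<^bsub>(P \<otimes> Q)\<degree>\<^esub> W \<longleftrightarrow> h \<sqsubseteq>\<^bsub>Q' \<lhd> P\<^esub> ?G W"
      using h by simp
  next
    fix W assume "W \<in> carrier ((P \<otimes> Q)\<degree>)"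
    then have W: "W \<in> carrier (P \<otimes> Q)" by simp
    then have sub: "W \<subseteq> carrier P \<times> carrier Q" using saturatedD(1)[OF P Q PQ, of W] by simp
    \<comment> \<open>The two residuals of \<open>W\<close> form a Galois connection: for the
      reversed order on \<open>Q\<close>, both sides of the adjunction say that
      \<open>(p, q) \<in> W\<close>.\<close>
    have "sup_hom P Q' (\<lambda>p. lres Q p W)"
      by (rule sup_hom_adjI[where g = "rres P W"]) (use W in simp_all)
    moreover have "lres Q (ract P p y) W = ract Q' (lres Q p W) y"
      if "y \<in> carrier (src Q)" "p \<in> carrier P" for p y
      by (rule cl_eq_lowerI[OF bmod_cl[OF Q]])
        (use ract_closed[OF Q', of y "lres Q p W"] that W saturatedD(4)[OF P Q PQ, of W] in simp_all)
    ultimately show "?G W \<in> carrier (Q' \<lhd> P)"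
      by (simp add: right_homs_iff sup_hom_restrict)
    show "?F (?G W) = W"
      using W sub by (auto)
  next
    fix z h assume z: "z \<in> carrier (src ((P \<otimes> Q)\<degree>))" and "h \<in> carrier (Q' \<lhd> P)"
    then have h: "h \<in> right_homs P Q'" by simp
    have F: "?F h \<in> carrier (P \<otimes> Q)" by (rule Fsat[OF h])
    then show "?F (lact (Q' \<lhd> P) z h) = lact ((P \<otimes> Q)\<degree>) z (?F h)"
      using z h by (auto simp: dual_act)
  next
    fix x h assume x: "x \<in> carrier (tgt ((P \<otimes> Q)\<degree>))" and "h \<in> carrier (Q' \<lhd> P)"
    then have h: "h \<in> right_homs P Q'" by simp
    have F: "?F h \<in> carrier (P \<otimes> Q)" by (rule Fsat[OF h])
    then show "?F (ract (Q' \<lhd> P) h x) = ract ((P \<otimes> Q)\<degree>) (?F h) x"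
      using x h by (auto simp: dual_act)
  }
qed

section \<open>Left homomorphisms by mirroring: interchange of the tensor factors is the converse
  relation\<close>

lemma converse_tensor: "tgt P = src Q \<Longrightarrow> U\<inverse> \<in> carrier (mirror Q \<otimes> mirror P) \<longleftrightarrow> U \<in> carrier (P \<otimes> Q)"
  using saturated_iff[of "mirror Q" "mirror P" "U\<inverse>"] saturated_iff[of P Q U]
  by (auto simp: saturated_def simp del: saturated_iff)

text \<open>Taking converses is an order isomorphism between the saturated sets for the two orders
  of the factors, and it interchanges the dual actions. The inverse of \<open>f\<close> is therefore
  that of \<open>g\<close> after a converse.\<close>

lemma iso_mirror_converse:
  assumes g: "iso_ok g" and C: "Cod g = (mirror Q \<otimes> mirror P)\<degree>"
    and [simp]: "bmod P" "bmod Q" and PQ: "tgt P = src Q"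
    and f: "f = \<lparr>Dom = mirror (Dom g), Cod = (P \<otimes> Q)\<degree>, Map = (\<lambda>h\<in>carrier (mirror (Dom g)). (Map g h)\<inverse>)\<rparr>"
  shows "iso_ok f \<and> (\<forall>W\<in>carrier ((P \<otimes> Q)\<degree>). Map (inv2 f) W = Map (inv2 g) (W\<inverse>))"
proof (rule iso_ok_adjI[OF f])
  note D = cell_okD[OF iso_cell_ok[OF g], unfolded C]
  have PQ' [simp]: "tgt (mirror Q) = src (mirror P)" using PQ by simp
  have cv: "U\<inverse> \<in> carrier (P \<otimes> Q) \<longleftrightarrow> U \<in> carrier (mirror Q \<otimes> mirror P)" for U
    using converse_tensor[OF PQ, of "U\<inverse>"] by simp
  have gc: "Map g h \<in> carrier (mirror Q \<otimes> mirror P)" if "h \<in> carrier (Dom g)" for h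
    using sup_homD(3)[OF D(5) that] by simp
  have ic: "Map (inv2 g) (W\<inverse>) \<in> carrier (Dom g)" "Map g (Map (inv2 g) (W\<inverse>)) = W\<inverse>" if "W \<in> carrier (P \<otimes> Q)" for W
    using that g by (simp_all add: inv2_closed C converse_tensor[OF PQ])
  show "bmod (mirror (Dom g))" using D(1) by simp
  show "bmod ((P \<otimes> Q)\<degree>)" "src (mirror (Dom g)) = src ((P \<otimes> Q)\<degree>)" "tgt (mirror (Dom g)) = tgt ((P \<otimes> Q)\<degree>)"
    using D(3,4) PQ by simp_all
  show "(Map g h)\<inverse> \<sqsubseteq>\<^bsub>(P \<otimes> Q)\<degree>\<^esub> W \<longleftrightarrow> h \<sqsubseteq>\<^bsub>mirror (Dom g)\<^esub> Map (inv2 g) (W\<inverse>)"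
    if "h \<in> carrier (mirror (Dom g))" "W \<in> carrier ((P \<otimes> Q)\<degree>)" for h W
  proof -
    have h: "h \<in> carrier (Dom g)" and W: "W \<in> carrier (P \<otimes> Q)" using that by simp_all
    have "W\<inverse> \<subseteq> Map g h \<longleftrightarrow> h \<sqsubseteq>\<^bsub>Dom g\<^esub> Map (inv2 g) (W\<inverse>)"
      using sup_hom_mono[OF D(5) _ h ic(1)[OF W]] ic(2)[OF W] g h
        sup_hom_mono[OF cell_okD(5)[OF inv2_ok[OF g]], of "Map g h" "W\<inverse>"] gc[OF h] W
      by (auto simp: C converse_tensor[OF PQ])
    moreover have "W \<subseteq> (Map g h)\<inverse> \<longleftrightarrow> W\<inverse> \<subseteq> Map g h" by auto
    ultimately show ?thesis by simp
  qed
  show "(Map g (lact (mirror (Dom g)) z h))\<inverse> = lact ((P \<otimes> Q)\<degree>) z ((Map g h)\<inverse>)"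
    if "z \<in> carrier (src ((P \<otimes> Q)\<degree>))" "h \<in> carrier (mirror (Dom g))" for z h
    using that gc[of h] cv PQ by (auto simp: D(8) dual_act)
  show "(Map g (ract (mirror (Dom g)) h x))\<inverse> = ract ((P \<otimes> Q)\<degree>) ((Map g h)\<inverse>) x"
    if "x \<in> carrier (tgt ((P \<otimes> Q)\<degree>))" "h \<in> carrier (mirror (Dom g))" for x h
    using that gc[of h] cv PQ by (auto simp: D(7) dual_act)
  show "(Map g h)\<inverse> \<in> carrier ((P \<otimes> Q)\<degree>)" "Map (inv2 g) (((Map g h)\<inverse>)\<inverse>) = h"
    if "h \<in> carrier (mirror (Dom g))" for h using that g gc[of h] cv by simp_all
  show "Map (inv2 g) (W\<inverse>) \<in> carrier (mirror (Dom g))" "(Map g (Map (inv2 g) (W\<inverse>)))\<inverse> = W"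
    if "W \<in> carrier ((P \<otimes> Q)\<degree>)" for W using that ic[of W] by simp_all
qed

text \<open>\<open>Q \<rhd> P'\<close> is the mirror of \<open>mirror P' \<lhd> mirror Q\<close>, so
  the result for right homomorphisms applies; under the converse, \<open>lres\<close> turns into
  \<open>rres\<close>.\<close>

lemma lhom_dual_iso:
  assumes Q: "bmod Q" and PP': "opposite_pair P P'" and PQ: "tgt P = src Q"
    and f: "f = \<lparr>Dom = Q \<rhd> P', Cod = (P \<otimes> Q)\<degree>,
      Map = (\<lambda>h\<in>carrier (Q \<rhd> P'). {(p, q). p \<in> carrier P \<and> q \<in> carrier Q \<and> h q \<sqsubseteq>\<^bsub>P'\<^esub> p})\<rparr>"
  shows "iso_ok f \<and> (\<forall>W\<in>carrier ((P \<otimes> Q)\<degree>). Map (inv2 f) W = (\<lambda>q\<in>carrier Q. rres P W q))"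
proof -
  define g where "g = \<lparr>Dom = mirror P' \<lhd> mirror Q, Cod = (mirror Q \<otimes> mirror P)\<degree>,
    Map = (\<lambda>h\<in>carrier (mirror P' \<lhd> mirror Q).
      {(q, p). q \<in> carrier (mirror Q) \<and> p \<in> carrier (mirror P) \<and> h q \<sqsubseteq>\<^bsub>mirror P'\<^esub> p})\<rparr>"
  have P: "bmod P" "opposite_pair (mirror P) (mirror P')" using PP' by (auto simp: opposite_pair_def mirror_le)
  have g: "iso_ok g" "\<forall>W\<in>carrier (mirror Q \<otimes> mirror P). Map (inv2 g) W = (\<lambda>q\<in>carrier Q. lres (mirror P) q W)"
    using rhom_dual_iso[OF _ P(2) _ g_def] Q PQ by simp_all
  have "f = \<lparr>Dom = mirror (Dom g), Cod = (P \<otimes> Q)\<degree>, Map = (\<lambda>h\<in>carrier (mirror (Dom g)). (Map g h)\<inverse>)\<rparr>"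
    unfolding f g_def by (auto simp: lhom_mirror mirror_le intro!: restrict_ext)
  from iso_mirror_converse[OF g(1) _ P(1) Q PQ this] show ?thesis
    using g(2) by (auto simp: g_def converse_tensor[OF PQ] lres_def rres_def intro!: restrict_ext)
qed

lemma hom_to_dual_simps [simp]:
  "Dom (rhom_to_dual A B) = B\<degree> \<lhd> A" "Cod (rhom_to_dual A B) = (A \<otimes> B)\<degree>"
  "Dom (lhom_to_dual A B) = B \<rhd> A\<degree>" "Cod (lhom_to_dual A B) = (A \<otimes> B)\<degree>"
  "Dom (lhom_to_par A B) = A\<degree> \<rhd> B" "Cod (lhom_to_par A B) = A \<oplus> B"
  "Dom (rhom_to_par A B) = A \<lhd> B\<degree>" "Cod (rhom_to_par A B) = A \<oplus> B"
  by (simp_all add: rhom_to_dual_def lhom_to_dual_def lhom_to_par_def rhom_to_par_def)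

lemma hom_to_par_Map:
  "h \<in> left_homs (A\<degree>) B \<Longrightarrow>
    Map (lhom_to_par A B) h = {(b, a). b \<in> carrier B \<and> a \<in> carrier A \<and> h a \<sqsubseteq>\<^bsub>B\<^esub> b}"
  "h' \<in> right_homs (B\<degree>) A \<Longrightarrow>
    Map (rhom_to_par A B) h' = {(b, a). b \<in> carrier B \<and> a \<in> carrier A \<and> h' b \<sqsubseteq>\<^bsub>A\<^esub> a}"
  by (simp_all add: lhom_to_par_def rhom_to_par_def)

context
  fixes A :: "('a, 'x, 'y) bimod" and B :: "('b, 'y, 'z) bimod"
  assumes A: "bmod A" and B: "bmod B" and AB: "tgt A = src B"
begin

lemma rhom_to_dual_iso: "iso_ok (rhom_to_dual A B)"
  and inv2_rhom_to_dual: "U \<in> carrier (A \<otimes> B) \<Longrightarrow> Map (inv2 (rhom_to_dual A B)) U = (\<lambda>a\<in>carrier A. lres B a U)"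
  using rhom_dual_iso[OF A opposite_pair_opposite[OF B] AB refl] unfolding rhom_to_dual_def by simp_all

lemma lhom_to_dual_iso: "iso_ok (lhom_to_dual A B)"
  and inv2_lhom_to_dual: "U \<in> carrier (A \<otimes> B) \<Longrightarrow> Map (inv2 (lhom_to_dual A B)) U = (\<lambda>b\<in>carrier B. rres A U b)"
  using lhom_dual_iso[OF B opposite_pair_opposite[OF A] AB refl] unfolding lhom_to_dual_def by simp_all

lemma lhom_to_par_iso: "iso_ok (lhom_to_par A B)"
  and inv2_lhom_to_par: "W \<in> carrier (B\<degree> \<otimes> A\<degree>) \<Longrightarrow> Map (inv2 (lhom_to_par A B)) W = (\<lambda>a\<in>carrier A. rres (B\<degree>) W a)"
  using lhom_dual_iso[of "A\<degree>" "B\<degree>" B, OF _ _ _ refl] A B AB unfolding lhom_to_par_def par_def by simp_all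

lemma rhom_to_par_iso: "iso_ok (rhom_to_par A B)"
  and inv2_rhom_to_par: "W \<in> carrier (B\<degree> \<otimes> A\<degree>) \<Longrightarrow> Map (inv2 (rhom_to_par A B)) W = (\<lambda>b\<in>carrier B. lres (A\<degree>) b W)"
  using rhom_dual_iso[of "B\<degree>" "A\<degree>" A, OF _ _ _ refl] A B AB unfolding rhom_to_par_def par_def by simp_all

end

declare rhom_to_dual_iso [simp] lhom_to_dual_iso [simp] lhom_to_par_iso [simp] rhom_to_par_iso [simp]

section \<open>The linear distributions\<close>

lemma dist_left_simps [simp]: "Dom (\<delta>\<^sup>L A B C) = A \<otimes> (B \<oplus> C)" "Cod (\<delta>\<^sup>L A B C) = (A \<otimes> B) \<oplus> C"
  and dist_right_simps [simp]: "Dom (\<delta>\<^sup>R A B C) = (A \<oplus> B) \<otimes> C" "Cod (\<delta>\<^sup>R A B C) = A \<oplus> (B \<otimes> C)"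
  by (simp_all add: dist_left_def dist_right_def)

context
  fixes A :: "('a, 'x, 'y) bimod" and B :: "('b, 'y, 'z) bimod" and C :: "('c, 'z, 'w) bimod"
  assumes A [simp]: "bmod A" and B [simp]: "bmod B" and C [simp]: "bmod C"
    and AB [simp]: "tgt A = src B" and BC [simp]: "tgt B = src C"
begin

lemma dist_left_ok: "cell_ok (\<delta>\<^sup>L A B C)"
  by (simp add: dist_left_def)

lemma dist_right_ok: "cell_ok (\<delta>\<^sup>R A B C)"
  by (simp add: dist_right_def)

text \<open>Following \<open>a\<close> and \<open>W\<close> through the definition: \<open>W\<close>
  becomes the homomorphism \<open>H\<close> from \<open>B\<degree>\<close> to \<open>C\<close>, the
  double evaluation turns it into \<open>p \<mapsto> H (p a)\<close>, and precomposition replaces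
  \<open>p\<close> by \<open>a' \<mapsto> lres B a' U\<close>. The resulting map
  \<open>U \<mapsto> H (lres B a U)\<close> is then read as a set of pairs.\<close>

lemma dist_left_pure:
  assumes a: "a \<in> carrier A" and W: "W \<in> carrier (C\<degree> \<otimes> B\<degree>)"
  shows "Map (\<delta>\<^sup>L A B C) (pure_tensor A (B \<oplus> C) a W) =
    {(c, U). c \<in> carrier C \<and> U \<in> carrier (A \<otimes> B) \<and> (c, lres B a U) \<in> W}"
proof -
  \<comment> \<open>The supremum is taken in \<open>C\<degree>\<close>, so \<open>H b\<close> is the
    least \<open>c\<close> in the order of \<open>C\<close> with
    \<open>(c, b) \<in> W\<close>.\<close>
  define H where "H = (\<lambda>b\<in>carrier B. rres (C\<degree>) W b)"
  have H: "Map (inv2 (lhom_to_par B C)) W = H" using W by (simp add: inv2_lhom_to_par H_def)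
  have Hc [simp]: "H \<in> left_homs (B\<degree>) C"
    using inv2_closed[of "lhom_to_par B C" W] W by (simp add: H)
  let ?h = "inv2 (tensor_assoc (B\<degree> \<lhd> A) A (B\<degree> \<rhd> C)) \<Zsemi> (reval (B\<degree>) A \<otimes>\<^sub>2 id2 (B\<degree> \<rhd> C)) \<Zsemi> leval (B\<degree>) C"
  let ?t = "ltranspose (B\<degree> \<lhd> A) (A \<otimes> (B\<degree> \<rhd> C)) ?h"
  let ?p = "pure_tensor A (B\<degree> \<rhd> C) a H"
  have rc [simp]: "p a \<in> carrier B" if "p \<in> right_homs A (B\<degree>)" for p
    using right_homs_closed[of A "B\<degree>" p a] that a by simp
  have t: "Map ?t ?p = (\<lambda>p\<in>right_homs A (B\<degree>). H (p a))"
    using a by (auto intro!: restrict_ext)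
  have tc: "Map ?t ?p \<in> left_homs (B\<degree> \<lhd> A) C"
    using cell_closed[of ?t _ ?p] a by simp
  let ?g = "Map (lprecomp (inv2 (rhom_to_dual A B)) C) (Map ?t ?p)"
  have iU: "Map (inv2 (rhom_to_dual A B)) U \<in> right_homs A (B\<degree>)" if "U \<in> carrier (A \<otimes> B)" for U
    using inv2_closed[of "rhom_to_dual A B" U] that by simp
  have g: "?g U = rres (C\<degree>) W (lres B a U)" if U: "U \<in> carrier (A \<otimes> B)" for U
  proof -
    \<comment> \<open>The transposed map stays folded: only its membership in the hom module is
      required for evaluating the precomposition. Its value is inserted in the next step.\<close>
    have "?g U = Map ?t ?p (Map (inv2 (rhom_to_dual A B)) U)"
      using tc U by (simp del: ltranspose_simps)
    also have "\<dots> = H (Map (inv2 (rhom_to_dual A B)) U a)"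
      unfolding t using iU[OF U] by simp
    finally show ?thesis using U a by (simp add: inv2_rhom_to_dual H_def)
  qed
  have gc: "?g \<in> left_homs ((A \<otimes> B)\<degree>) C"
    using cell_closed[of "lprecomp (inv2 (rhom_to_dual A B)) C" _ "Map ?t ?p"] tc
    by (simp del: lprecomp_simps(3) ltranspose_simps(3))
  have "Map (\<delta>\<^sup>L A B C) (pure_tensor A (B \<oplus> C) a W) = Map (lhom_to_par (A \<otimes> B) C) ?g"
    using a W by (simp add: dist_left_def H del: ltranspose_simps(3) lprecomp_simps(3))
  also have "\<dots> = {(c, U). c \<in> carrier C \<and> U \<in> carrier (A \<otimes> B) \<and> ?g U \<sqsubseteq>\<^bsub>C\<^esub> c}"
    using gc by (simp only: hom_to_par_Map)
  also have "\<dots> = {(c, U). c \<in> carrier C \<and> U \<in> carrier (A \<otimes> B) \<and> (c, lres B a U) \<in> W}"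
    using le_rres_iff[of "C\<degree>" "B\<degree>" W] W by (auto simp: g)
  finally show ?thesis .
qed

text \<open>Now \<open>W\<close> becomes \<open>b \<mapsto> lres (A\<degree>) b W\<close>, the least
  \<open>a\<close> with \<open>(b, a) \<in> W\<close>, and the argument substituted for a
  homomorphism on \<open>C\<close> is \<open>c' \<mapsto> rres B U c'\<close>.\<close>

lemma dist_right_pure:
  assumes W: "W \<in> carrier (B\<degree> \<otimes> A\<degree>)" and c: "c \<in> carrier C"
  shows "Map (\<delta>\<^sup>R A B C) (pure_tensor (A \<oplus> B) C W c) =
    {(U, a). U \<in> carrier (B \<otimes> C) \<and> a \<in> carrier A \<and> (rres B U c, a) \<in> W}"
proof -
  define H where "H = (\<lambda>b\<in>carrier B. lres (A\<degree>) b W)"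
  have H: "Map (inv2 (rhom_to_par A B)) W = H" using W by (simp add: inv2_rhom_to_par H_def)
  have Hc [simp]: "H \<in> right_homs (B\<degree>) A"
    using inv2_closed[of "rhom_to_par A B" W] W by (simp add: H)
  let ?h = "tensor_assoc (A \<lhd> B\<degree>) C (C \<rhd> B\<degree>) \<Zsemi> (id2 (A \<lhd> B\<degree>) \<otimes>\<^sub>2 leval C (B\<degree>)) \<Zsemi> reval A (B\<degree>)"
  let ?t = "rtranspose ((A \<lhd> B\<degree>) \<otimes> C) (C \<rhd> B\<degree>) ?h"
  let ?p = "pure_tensor (A \<lhd> B\<degree>) C H c"
  have rc [simp]: "p c \<in> carrier B" if "p \<in> left_homs C (B\<degree>)" for p
    using left_homs_closed[of C "B\<degree>" p c] that c by simp
  have t: "Map ?t ?p = (\<lambda>p\<in>left_homs C (B\<degree>). H (p c))"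
    using c by (auto intro!: restrict_ext)
  have tc: "Map ?t ?p \<in> right_homs (C \<rhd> B\<degree>) A"
    using cell_closed[of ?t _ ?p] c by simp
  let ?g = "Map (rprecomp A (inv2 (lhom_to_dual B C))) (Map ?t ?p)"
  have iU: "Map (inv2 (lhom_to_dual B C)) U \<in> left_homs C (B\<degree>)" if "U \<in> carrier (B \<otimes> C)" for U
    using inv2_closed[of "lhom_to_dual B C" U] that by simp
  have g: "?g U = lres (A\<degree>) (rres B U c) W" if U: "U \<in> carrier (B \<otimes> C)" for U
  proof -
    have "?g U = Map ?t ?p (Map (inv2 (lhom_to_dual B C)) U)"
      using tc U by (simp del: rtranspose_simps)
    also have "\<dots> = H (Map (inv2 (lhom_to_dual B C)) U c)"
      unfolding t using iU[OF U] by simp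
    finally show ?thesis using U c by (simp add: inv2_lhom_to_dual H_def)
  qed
  have gc: "?g \<in> right_homs ((B \<otimes> C)\<degree>) A"
    using cell_closed[of "rprecomp A (inv2 (lhom_to_dual B C))" _ "Map ?t ?p"] tc
    by (simp del: rprecomp_simps(3) rtranspose_simps(3))
  have "Map (\<delta>\<^sup>R A B C) (pure_tensor (A \<oplus> B) C W c) = Map (rhom_to_par A (B \<otimes> C)) ?g"
    using c W by (simp add: dist_right_def H del: rtranspose_simps(3) rprecomp_simps(3))
  also have "\<dots> = {(U, a). U \<in> carrier (B \<otimes> C) \<and> a \<in> carrier A \<and> ?g U \<sqsubseteq>\<^bsub>A\<^esub> a}"
    using gc by (simp only: hom_to_par_Map)
  also have "\<dots> = {(U, a). U \<in> carrier (B \<otimes> C) \<and> a \<in> carrier A \<and> (rres B U c, a) \<in> W}"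
    using le_lres_iff[of "B\<degree>" "A\<degree>" W] W by (auto simp: g)
  finally show ?thesis .
qed

end

declare dist_left_ok [simp] dist_right_ok [simp]

lemma dist_left_mem [simp]:
  assumes "bmod A" "bmod B" "bmod C" "tgt A = src B" "tgt B = src C"
    and "a \<in> carrier A" "W \<in> carrier (C\<degree> \<otimes> B\<degree>)" "c \<in> carrier C" "U \<in> carrier (A \<otimes> B)"
  shows "(c, U) \<in> Map (\<delta>\<^sup>L A B C) (pure_tensor A (B \<oplus> C) a W) \<longleftrightarrow> (c, lres B a U) \<in> W"
  using assms by (simp add: dist_left_pure)

lemma dist_right_mem [simp]:
  assumes "bmod A" "bmod B" "bmod C" "tgt A = src B" "tgt B = src C"
    and "W \<in> carrier (B\<degree> \<otimes> A\<degree>)" "c \<in> carrier C" "a \<in> carrier A" "U \<in> carrier (B \<otimes> C)"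
  shows "(U, a) \<in> Map (\<delta>\<^sup>R A B C) (pure_tensor (A \<oplus> B) C W c) \<longleftrightarrow> (rres B U c, a) \<in> W"
  using assms by (simp add: dist_right_pure)

subsection \<open>Testing membership\<close>

lemma par_act:
  assumes "bmod A" "bmod B" "tgt A = src B" and W: "W \<in> carrier (B\<degree> \<otimes> A\<degree>)"
  shows "x \<in> carrier (src A) \<Longrightarrow>
      lact (A \<oplus> B) x W = {(b, a). b \<in> carrier B \<and> a \<in> carrier A \<and> (b, ract (A\<degree>) a x) \<in> W}"
    and "z \<in> carrier (tgt B) \<Longrightarrow>
      ract (A \<oplus> B) W z = {(b, a). b \<in> carrier B \<and> a \<in> carrier A \<and> (lact (B\<degree>) z b, a) \<in> W}"
  using assms by (simp_all add: par_def dual_act)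

lemma mem_adjoint_iff:
  assumes "cell_ok f" "Dom f = A \<otimes> B" "bmod A" "bmod B" "tgt A = src B"
    and "u \<in> carrier (Cod f)" "a \<in> carrier A" "b \<in> carrier B"
  shows "(a, b) \<in> Map (f\<degree>\<^sub>2) u \<longleftrightarrow> Map f (pure_tensor A B a b) \<sqsubseteq>\<^bsub>Cod f\<^esub> u"
proof -
  have "Map (f\<degree>\<^sub>2) u \<in> carrier (A \<otimes> B)" using assms by simp
  then have "(a, b) \<in> Map (f\<degree>\<^sub>2) u \<longleftrightarrow> pure_tensor A B a b \<subseteq> Map (f\<degree>\<^sub>2) u"
    using assms by (simp add: pure_le_iff)
  then show ?thesis using le_opposite2_iff[of f "pure_tensor A B a b" u] assms by simp
qed

text \<open>Two reversals meet here: membership puts a pure tensor inside \<open>Map f m\<close>,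
  which for the order of \<open>A \<oplus> B\<close> means that \<open>Map f m\<close> lies below
  it, and the adjunction moves \<open>f\<close> to the other side.\<close>

lemma mem_par_iff:
  assumes "cell_ok f" "Cod f = A \<oplus> B" "bmod A" "bmod B" "tgt A = src B"
    and "m \<in> carrier (Dom f)" "a \<in> carrier A" "b \<in> carrier B"
  shows "(b, a) \<in> Map f m \<longleftrightarrow> m \<sqsubseteq>\<^bsub>Dom f\<^esub> Map (f\<degree>\<^sub>2) (pure_tensor (B\<degree>) (A\<degree>) b a)"
proof -
  have "Map f m \<in> carrier (B\<degree> \<otimes> A\<degree>)" using assms by simp
  then have "(b, a) \<in> Map f m \<longleftrightarrow> pure_tensor (B\<degree>) (A\<degree>) b a \<subseteq> Map f m"
    using assms by (simp add: pure_le_iff)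
  then show ?thesis using le_opposite2_iff[of f m "pure_tensor (B\<degree>) (A\<degree>) b a"] assms by simp
qed

lemma par2_mem [simp]:
  assumes "cell_ok f" "cell_ok g" "tgt (Cod f) = src (Cod g)"
    and W: "W \<in> carrier ((Dom g)\<degree> \<otimes> (Dom f)\<degree>)" and "a \<in> carrier (Cod f)" "b \<in> carrier (Cod g)"
  shows "(b, a) \<in> Map (f \<oplus>\<^sub>2 g) W \<longleftrightarrow> (Map (g\<degree>\<^sub>2) b, Map (f\<degree>\<^sub>2) a) \<in> W"
  by (subst mem_par_iff[where A = "Cod f" and B = "Cod g"])
    (use assms in \<open>simp_all add: pure_le_iff opposite2_closed\<close>)

lemma par_assoc_mem [simp]:
  assumes "bmod A" "bmod B" "bmod C" "tgt A = src B" "tgt B = src C"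
    and "P \<in> carrier (C\<degree> \<otimes> (A \<oplus> B)\<degree>)" "a \<in> carrier A" "b \<in> carrier B" "c \<in> carrier C"
  shows "(pure_tensor (C\<degree>) (B\<degree>) c b, a) \<in> Map (par_assoc A B C) P \<longleftrightarrow>
    (c, pure_tensor (B\<degree>) (A\<degree>) b a) \<in> P"
  by (subst mem_par_iff[where A = A and B = "B \<oplus> C"]) (use assms in \<open>simp_all add: pure_le_iff\<close>)

text \<open>The unit isomorphisms of \<open>\<oplus>\<close> end in an arbitrary module, where there
  are no pairs to test, so their values are described by upper bounds.\<close>

lemma par_lunit_le_iff:
  assumes "bmod A" "W \<in> carrier (A\<degree> \<otimes> (bot_cell (src A))\<degree>)" "a \<in> carrier A"
  shows "Map (par_lunit A) W \<sqsubseteq>\<^bsub>A\<^esub> a \<longleftrightarrow> (a, \<top>\<^bsub>src A\<^esub>) \<in> W"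
  using le_opposite2_iff[of "par_lunit A" W a] assms by (simp add: pure_le_iff)

lemma par_runit_le_iff:
  assumes "bmod A" "W \<in> carrier ((bot_cell (tgt A))\<degree> \<otimes> A\<degree>)" "a \<in> carrier A"
  shows "Map (par_runit A) W \<sqsubseteq>\<^bsub>A\<^esub> a \<longleftrightarrow> (\<top>\<^bsub>tgt A\<^esub>, a) \<in> W"
  using le_opposite2_iff[of "par_runit A" W a] assms by (simp add: pure_le_iff)

lemma par_set_eqI:
  assumes "bmod A" "bmod B" "tgt A = src B"
    and "W \<in> carrier (B\<degree> \<otimes> A\<degree>)" "W' \<in> carrier (B\<degree> \<otimes> A\<degree>)"
    and "\<And>a b. \<lbrakk>a \<in> carrier A; b \<in> carrier B\<rbrakk> \<Longrightarrow> (b, a) \<in> W \<longleftrightarrow> (b, a) \<in> W'"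
  shows "W = W'"
  using assms saturatedD(1)[of "B\<degree>" "A\<degree>" W] saturatedD(1)[of "B\<degree>" "A\<degree>" W'] by auto

text \<open>The first component of a pair ranges over all \<open>V\<close> in
  \<open>B \<oplus> C\<close>. In the opposite module \<open>V\<close> is the supremum of its pure
  tensors, and saturation splits membership of \<open>(V, a)\<close> accordingly.\<close>

lemma par3_set_eqI:
  assumes [simp]: "bmod A" "bmod B" "bmod C" "tgt A = src B" "tgt B = src C"
    and W: "W \<in> carrier ((B \<oplus> C)\<degree> \<otimes> A\<degree>)" "W' \<in> carrier ((B \<oplus> C)\<degree> \<otimes> A\<degree>)"
    and eq: "\<And>a b c. \<lbrakk>a \<in> carrier A; b \<in> carrier B; c \<in> carrier C\<rbrakk> \<Longrightarrow>
      (pure_tensor (C\<degree>) (B\<degree>) c b, a) \<in> W \<longleftrightarrow> (pure_tensor (C\<degree>) (B\<degree>) c b, a) \<in> W'"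
  shows "W = W'"
proof (rule par_set_eqI[where A = A and B = "B \<oplus> C"])
  fix a V assume a: "a \<in> carrier A" and "V \<in> carrier (B \<oplus> C)"
  then have V: "V \<in> carrier (C\<degree> \<otimes> B\<degree>)" by simp
  note sub = saturatedD(1)[of "C\<degree>" "B\<degree>" V, simplified, OF V]
  let ?S = "(\<lambda>(c, b). pure_tensor (C\<degree>) (B\<degree>) c b) ` V"
  have S: "?S \<subseteq> carrier (C\<degree> \<otimes> B\<degree>)" using sub by auto
  have "V = \<Squnion>\<^bsub>C\<degree> \<otimes> B\<degree>\<^esub> ?S" using tensor_sup_pures[of "C\<degree>" "B\<degree>" V] V by simp
  also have "\<dots> = \<Squnion>\<^bsub>(B \<oplus> C)\<degree>\<^esub> ?S" unfolding par_def by (rule sup_opposite_opposite[OF S, symmetric])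
  finally have V_sup: "V = \<Squnion>\<^bsub>(B \<oplus> C)\<degree>\<^esub> ?S" .
  have "(V, a) \<in> U \<longleftrightarrow> (\<forall>(c, b)\<in>V. (pure_tensor (C\<degree>) (B\<degree>) c b, a) \<in> U)"
    if U: "U \<in> carrier ((B \<oplus> C)\<degree> \<otimes> A\<degree>)" for U
    by (subst V_sup, subst saturatedD(2)[of "(B \<oplus> C)\<degree>" "A\<degree>" U]) (use U S a in auto)
  moreover have "(\<forall>(c, b)\<in>V. (pure_tensor (C\<degree>) (B\<degree>) c b, a) \<in> W) \<longleftrightarrow>
      (\<forall>(c, b)\<in>V. (pure_tensor (C\<degree>) (B\<degree>) c b, a) \<in> W')"
    by (rule ball_cong[OF refl]) (use sub a eq in auto)
  ultimately show "(V, a) \<in> W \<longleftrightarrow> (V, a) \<in> W'" using W by simp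
qed (use W in simp_all)

lemma tensor_par_ext:
  assumes "cell_ok f" "cell_ok g" "Dom f = A \<otimes> B" "Dom g = A \<otimes> B" "Cod f = C \<oplus> D" "Cod g = C \<oplus> D"
    and "bmod A" "bmod B" "bmod C" "bmod D" "tgt A = src B" "tgt C = src D"
    and "\<And>a b c d. \<lbrakk>a \<in> carrier A; b \<in> carrier B; c \<in> carrier C; d \<in> carrier D\<rbrakk> \<Longrightarrow>
      (d, c) \<in> Map f (pure_tensor A B a b) \<longleftrightarrow> (d, c) \<in> Map g (pure_tensor A B a b)"
  shows "f = g"
  by (rule tensor_cell_ext[OF assms(1-4)]) (use assms in \<open>simp_all add: par_set_eqI[where A = C and B = D]\<close>)

lemma tensor3_par_ext:
  assumes "cell_ok f" "cell_ok g" "Dom f = (A \<otimes> B) \<otimes> E" "Dom g = (A \<otimes> B) \<otimes> E" "Cod f = C \<oplus> D" "Cod g = C \<oplus> D"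
    and "bmod A" "bmod B" "bmod C" "bmod D" "bmod E" "tgt A = src B" "tgt B = src E" "tgt C = src D"
    and "\<And>a b c d e. \<lbrakk>a \<in> carrier A; b \<in> carrier B; c \<in> carrier C; d \<in> carrier D; e \<in> carrier E\<rbrakk> \<Longrightarrow>
      (d, c) \<in> Map f (pure_tensor (A \<otimes> B) E (pure_tensor A B a b) e) \<longleftrightarrow>
      (d, c) \<in> Map g (pure_tensor (A \<otimes> B) E (pure_tensor A B a b) e)"
  shows "f = g"
  by (rule tensor3_cell_ext_left[where A = A and B = B and C = E])
    (use assms in \<open>simp_all add: par_set_eqI[where A = C and B = D]\<close>)

lemma tensor_par3_ext:
  assumes "cell_ok f" "cell_ok g" "Dom f = A \<otimes> B" "Dom g = A \<otimes> B" "Cod f = C \<oplus> (D \<oplus> E)" "Cod g = C \<oplus> (D \<oplus> E)"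
    and "bmod A" "bmod B" "bmod C" "bmod D" "bmod E" "tgt A = src B" "tgt C = src D" "tgt D = src E"
    and "\<And>a b c d e. \<lbrakk>a \<in> carrier A; b \<in> carrier B; c \<in> carrier C; d \<in> carrier D; e \<in> carrier E\<rbrakk> \<Longrightarrow>
      (pure_tensor (E\<degree>) (D\<degree>) e d, c) \<in> Map f (pure_tensor A B a b) \<longleftrightarrow>
      (pure_tensor (E\<degree>) (D\<degree>) e d, c) \<in> Map g (pure_tensor A B a b)"
  shows "f = g"
  by (rule tensor_cell_ext[OF assms(1-4)])
    (use assms in \<open>simp_all add: par3_set_eqI[where A = C and B = D and C = E]\<close>)

subsection \<open>Residuals and adjoints\<close>

text \<open>Both sides bound exactly those \<open>b\<close> for which the pair of
  \<open>Map f a\<close> and \<open>Map g b\<close> belongs to \<open>U\<close>.\<close>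

lemma lres_tensor2:
  assumes f: "cell_ok f" and g: "cell_ok g" and fg: "tgt (Cod f) = src (Cod g)"
    and "Dom g = B" "U \<in> carrier (Cod f \<otimes> Cod g)" "a \<in> carrier (Dom f)"
  shows "lres B a (Map ((f \<otimes>\<^sub>2 g)\<degree>\<^sub>2) U) = Map (g\<degree>\<^sub>2) (lres (Cod g) (Map f a) U)"
proof (rule cl_eq_lowerI)
  note [simp] = cell_okD(1,2)[OF f] cell_okD(1,2)[OF g] f g fg
  note lr = le_lres_iff[of "Dom f" "Dom g", simplified] le_lres_iff[of "Cod f" "Cod g", simplified]
  fix b assume "b \<in> carrier B"
  then show "b \<sqsubseteq>\<^bsub>B\<^esub> lres B a (Map ((f \<otimes>\<^sub>2 g)\<degree>\<^sub>2) U) \<longleftrightarrow> b \<sqsubseteq>\<^bsub>B\<^esub> Map (g\<degree>\<^sub>2) (lres (Cod g) (Map f a) U)"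
    using assms(4-) le_opposite2_iff[OF g, of b "lres (Cod g) (Map f a) U"]
      mem_adjoint_iff[of "f \<otimes>\<^sub>2 g" "Dom f" "Dom g" U a b]
    by (auto simp: lr pure_le_iff)
qed (use assms cell_okD(1,2)[OF g] in \<open>auto simp: opposite2_closed\<close>)

lemma rres_tensor2:
  assumes f: "cell_ok f" and g: "cell_ok g" and fg: "tgt (Cod f) = src (Cod g)"
    and "Dom f = A" "U \<in> carrier (Cod f \<otimes> Cod g)" "b \<in> carrier (Dom g)"
  shows "rres A (Map ((f \<otimes>\<^sub>2 g)\<degree>\<^sub>2) U) b = Map (f\<degree>\<^sub>2) (rres (Cod f) U (Map g b))"
proof (rule cl_eq_lowerI)
  note [simp] = cell_okD(1,2)[OF f] cell_okD(1,2)[OF g] f g fg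
  note lr = le_rres_iff[of "Dom f" "Dom g", simplified] le_rres_iff[of "Cod f" "Cod g", simplified]
  fix a assume "a \<in> carrier A"
  then show "a \<sqsubseteq>\<^bsub>A\<^esub> rres A (Map ((f \<otimes>\<^sub>2 g)\<degree>\<^sub>2) U) b \<longleftrightarrow> a \<sqsubseteq>\<^bsub>A\<^esub> Map (f\<degree>\<^sub>2) (rres (Cod f) U (Map g b))"
    using assms(4-) le_opposite2_iff[OF f, of a "rres (Cod f) U (Map g b)"]
      mem_adjoint_iff[of "f \<otimes>\<^sub>2 g" "Dom f" "Dom g" U a b]
    by (auto simp: lr pure_le_iff)
qed (use assms cell_okD(1,2)[OF f] in \<open>auto simp: opposite2_closed\<close>)

text \<open>An element \<open>b\<close> lies below either side exactly when \<open>x\<close> acting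
  on \<open>b\<close> stays below \<open>a\<close>.\<close>

lemma lres_tensor_lunit:
  assumes [simp]: "bmod A" "src A = X" "a \<in> carrier A" "x \<in> carrier X"
  shows "lres A x (Map ((tensor_lunit A)\<degree>\<^sub>2) a) = ract (A\<degree>) a x"
proof (rule cl_eq_lowerI)
  have [simp]: "is_locale X" using bmod_loc(1)[of A] by simp
  fix b assume [simp]: "b \<in> carrier A"
  show "b \<sqsubseteq>\<^bsub>A\<^esub> lres A x (Map ((tensor_lunit A)\<degree>\<^sub>2) a) \<longleftrightarrow> b \<sqsubseteq>\<^bsub>A\<^esub> ract (A\<degree>) a x"
    using le_lres_iff[of "top_cell X" A "Map ((tensor_lunit A)\<degree>\<^sub>2) a" x b]
      mem_adjoint_iff[of "tensor_lunit A" "top_cell X" A a x b]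
    by (simp add: le_ract_opposite_iff)
qed simp_all

lemma rres_tensor_runit:
  assumes [simp]: "bmod A" "tgt A = Y" "a \<in> carrier A" "y \<in> carrier Y"
  shows "rres A (Map ((tensor_runit A)\<degree>\<^sub>2) a) y = lact (A\<degree>) y a"
proof (rule cl_eq_lowerI)
  have [simp]: "is_locale Y" using bmod_loc(2)[of A] by simp
  fix b assume [simp]: "b \<in> carrier A"
  show "b \<sqsubseteq>\<^bsub>A\<^esub> rres A (Map ((tensor_runit A)\<degree>\<^sub>2) a) y \<longleftrightarrow> b \<sqsubseteq>\<^bsub>A\<^esub> lact (A\<degree>) y a"
    using le_rres_iff[of A "top_cell Y" "Map ((tensor_runit A)\<degree>\<^sub>2) a" b y]
      mem_adjoint_iff[of "tensor_runit A" A "top_cell Y" a b y]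
    by (simp add: le_lact_opposite_iff)
qed simp_all

context
  fixes A :: "('a, 'x, 'y) bimod" and B :: "('b, 'y, 'z) bimod" and C :: "('c, 'z, 'w) bimod"
  assumes A [simp]: "bmod A" and B [simp]: "bmod B" and C [simp]: "bmod C"
    and AB [simp]: "tgt A = src B" and BC [simp]: "tgt B = src C"
begin

text \<open>Currying: \<open>c\<close> lies below either side exactly when
  \<open>a \<otimes> (b \<otimes> c)\<close> lies below \<open>Q\<close>.\<close>

lemma lres_tensor_assoc:
  assumes [simp]: "Q \<in> carrier (A \<otimes> (B \<otimes> C))" "a \<in> carrier A" "b \<in> carrier B"
  shows "lres C (pure_tensor A B a b) (Map ((tensor_assoc A B C)\<degree>\<^sub>2) Q) = lres C b (lres (B \<otimes> C) a Q)"
proof (rule cl_eq_lowerI)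
  fix c assume [simp]: "c \<in> carrier C"
  have *: "lres (B \<otimes> C) a Q \<in> carrier (B \<otimes> C)" by simp
  show "c \<sqsubseteq>\<^bsub>C\<^esub> lres C (pure_tensor A B a b) (Map ((tensor_assoc A B C)\<degree>\<^sub>2) Q) \<longleftrightarrow>
      c \<sqsubseteq>\<^bsub>C\<^esub> lres C b (lres (B \<otimes> C) a Q)"
    using le_lres_iff[of "A \<otimes> B" C "Map ((tensor_assoc A B C)\<degree>\<^sub>2) Q" "pure_tensor A B a b" c]
      mem_adjoint_iff[of "tensor_assoc A B C" "A \<otimes> B" C Q "pure_tensor A B a b" c]
      le_lres_iff[of B C "lres (B \<otimes> C) a Q" b c] pure_le_iff[of B C "lres (B \<otimes> C) a Q" b c]
      le_lres_iff[of A "B \<otimes> C" Q a "pure_tensor B C b c"] *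
    by (simp add: pure_le_iff)
qed simp_all

lemma rres_tensor_assoc:
  assumes [simp]: "Q \<in> carrier (A \<otimes> (B \<otimes> C))" "b \<in> carrier B" "c \<in> carrier C"
  shows "rres A (rres (A \<otimes> B) (Map ((tensor_assoc A B C)\<degree>\<^sub>2) Q) c) b = rres A Q (pure_tensor B C b c)"
proof (rule cl_eq_lowerI)
  let ?V = "Map ((tensor_assoc A B C)\<degree>\<^sub>2) Q"
  fix a assume [simp]: "a \<in> carrier A"
  have *: "rres (A \<otimes> B) ?V c \<in> carrier (A \<otimes> B)" by simp
  show "a \<sqsubseteq>\<^bsub>A\<^esub> rres A (rres (A \<otimes> B) ?V c) b \<longleftrightarrow> a \<sqsubseteq>\<^bsub>A\<^esub> rres A Q (pure_tensor B C b c)"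
    using le_rres_iff[of "A \<otimes> B" C ?V "pure_tensor A B a b" c]
      mem_adjoint_iff[of "tensor_assoc A B C" "A \<otimes> B" C Q "pure_tensor A B a b" c]
      le_rres_iff[of A B "rres (A \<otimes> B) ?V c" a b] pure_le_iff[of A B "rres (A \<otimes> B) ?V c" a b]
      le_rres_iff[of A "B \<otimes> C" Q a "pure_tensor B C b c"] *
    by (simp add: pure_le_iff)
qed simp_all

lemma mem_dist_left_adjoint:
  assumes [simp]: "a \<in> carrier A" "W \<in> carrier (C\<degree> \<otimes> B\<degree>)" "c \<in> carrier C" "U \<in> carrier (A \<otimes> B)"
  shows "(a, W) \<in> Map ((\<delta>\<^sup>L A B C)\<degree>\<^sub>2) (pure_tensor (C\<degree>) ((A \<otimes> B)\<degree>) c U) \<longleftrightarrow> (c, lres B a U) \<in> W"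
proof -
  have *: "Map (\<delta>\<^sup>L A B C) (pure_tensor A (B \<oplus> C) a W) \<in> carrier (C\<degree> \<otimes> (A \<otimes> B)\<degree>)"
    by simp
  show ?thesis
    using * pure_le_iff[of "C\<degree>" "(A \<otimes> B)\<degree>" "Map (\<delta>\<^sup>L A B C) (pure_tensor A (B \<oplus> C) a W)" c U]
    by (subst mem_adjoint_iff[where A = A and B = "B \<oplus> C"]) simp_all
qed

lemma mem_dist_right_adjoint:
  assumes [simp]: "W \<in> carrier (B\<degree> \<otimes> A\<degree>)" "c \<in> carrier C" "a \<in> carrier A" "U \<in> carrier (B \<otimes> C)"
  shows "(W, c) \<in> Map ((\<delta>\<^sup>R A B C)\<degree>\<^sub>2) (pure_tensor ((B \<otimes> C)\<degree>) (A\<degree>) U a) \<longleftrightarrow> (rres B U c, a) \<in> W"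
proof -
  have *: "Map (\<delta>\<^sup>R A B C) (pure_tensor (A \<oplus> B) C W c) \<in> carrier ((B \<otimes> C)\<degree> \<otimes> A\<degree>)"
    by simp
  show ?thesis
    using * pure_le_iff[of "(B \<otimes> C)\<degree>" "A\<degree>" "Map (\<delta>\<^sup>R A B C) (pure_tensor (A \<oplus> B) C W c)" U a]
    by (subst mem_adjoint_iff[where A = "A \<oplus> B" and B = C]) simp_all
qed

text \<open>For the order of \<open>B \<oplus> C\<close>, an element \<open>W\<close> lies below
  either side exactly when \<open>(c, lres B a U) \<in> W\<close>. That the result is pure again is
  what lets the associator of \<open>\<oplus>\<close> be applied to it.\<close>

lemma lres_dist_left:
  assumes [simp]: "a \<in> carrier A" "c \<in> carrier C" "U \<in> carrier (A \<otimes> B)"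
  shows "lres (B \<oplus> C) a (Map ((\<delta>\<^sup>L A B C)\<degree>\<^sub>2) (pure_tensor (C\<degree>) ((A \<otimes> B)\<degree>) c U)) =
    pure_tensor (C\<degree>) (B\<degree>) c (lres B a U)"
proof (rule cl_eq_lowerI)
  let ?V = "Map ((\<delta>\<^sup>L A B C)\<degree>\<^sub>2) (pure_tensor (C\<degree>) ((A \<otimes> B)\<degree>) c U)"
  fix W assume "W \<in> carrier (B \<oplus> C)"
  then have [simp]: "W \<in> carrier (C\<degree> \<otimes> B\<degree>)" by simp
  show "W \<sqsubseteq>\<^bsub>B \<oplus> C\<^esub> lres (B \<oplus> C) a ?V \<longleftrightarrow> W \<sqsubseteq>\<^bsub>B \<oplus> C\<^esub> pure_tensor (C\<degree>) (B\<degree>) c (lres B a U)"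
    using le_lres_iff[of A "B \<oplus> C" ?V a W] mem_dist_left_adjoint[of a W c U]
      pure_le_iff[of "C\<degree>" "B\<degree>" W c "lres B a U"] by simp
qed (use lres_closed[of "B \<oplus> C"] in simp_all)

lemma rres_dist_right:
  assumes [simp]: "c \<in> carrier C" "a \<in> carrier A" "U \<in> carrier (B \<otimes> C)"
  shows "rres (A \<oplus> B) (Map ((\<delta>\<^sup>R A B C)\<degree>\<^sub>2) (pure_tensor ((B \<otimes> C)\<degree>) (A\<degree>) U a)) c =
    pure_tensor (B\<degree>) (A\<degree>) (rres B U c) a"
proof (rule cl_eq_lowerI)
  let ?V = "Map ((\<delta>\<^sup>R A B C)\<degree>\<^sub>2) (pure_tensor ((B \<otimes> C)\<degree>) (A\<degree>) U a)"
  fix W assume "W \<in> carrier (A \<oplus> B)"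
  then have [simp]: "W \<in> carrier (B\<degree> \<otimes> A\<degree>)" by simp
  show "W \<sqsubseteq>\<^bsub>A \<oplus> B\<^esub> rres (A \<oplus> B) ?V c \<longleftrightarrow> W \<sqsubseteq>\<^bsub>A \<oplus> B\<^esub> pure_tensor (B\<degree>) (A\<degree>) (rres B U c) a"
    using le_rres_iff[of "A \<oplus> B" C ?V W c] mem_dist_right_adjoint[of W c a U]
      pure_le_iff[of "B\<degree>" "A\<degree>" W "rres B U c" a] by simp
qed (use rres_closed[of "A \<oplus> B"] in simp_all)

text \<open>Here the residual is taken by an element \<open>W\<close> of
  \<open>A \<oplus> B\<close>, which leaves no pure tensor. The condition
  \<open>(rres B S c, a) \<in> W\<close> is solved for its first component, whose least value is
  \<open>rres (B\<degree>) W a\<close>, and the Galois connection between the residuals of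
  \<open>S\<close> isolates \<open>c\<close>.\<close>

lemma lres_dist_right:
  assumes [simp]: "W \<in> carrier (B\<degree> \<otimes> A\<degree>)" "a \<in> carrier A" "S \<in> carrier (B \<otimes> C)"
  shows "lres C W (Map ((\<delta>\<^sup>R A B C)\<degree>\<^sub>2) (pure_tensor ((B \<otimes> C)\<degree>) (A\<degree>) S a)) = lres C (rres (B\<degree>) W a) S"
proof (rule cl_eq_lowerI)
  let ?V = "Map ((\<delta>\<^sup>R A B C)\<degree>\<^sub>2) (pure_tensor ((B \<otimes> C)\<degree>) (A\<degree>) S a)"
  fix c assume [simp]: "c \<in> carrier C"
  have *: "rres (B\<degree>) W a \<in> carrier B" using rres_closed[of "B\<degree>" W a] by (simp add: opposite_cl)
  have "c \<sqsubseteq>\<^bsub>C\<^esub> lres C W ?V \<longleftrightarrow> (rres B S c, a) \<in> W"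
    using le_lres_iff[of "A \<oplus> B" C ?V W c] mem_dist_right_adjoint[of W c a S] by simp
  also have "\<dots> \<longleftrightarrow> rres (B\<degree>) W a \<sqsubseteq>\<^bsub>B\<^esub> rres B S c"
    using le_rres_iff[of "B\<degree>" "A\<degree>" W "rres B S c" a] by simp
  also have "\<dots> \<longleftrightarrow> c \<sqsubseteq>\<^bsub>C\<^esub> lres C (rres (B\<degree>) W a) S"
    using le_rres_iff[of B C S "rres (B\<degree>) W a" c] le_lres_iff[of B C S "rres (B\<degree>) W a" c] * by simp
  finally show "c \<sqsubseteq>\<^bsub>C\<^esub> lres C W ?V \<longleftrightarrow> c \<sqsubseteq>\<^bsub>C\<^esub> lres C (rres (B\<degree>) W a) S" .
qed simp_all

end

subsection \<open>Naturality of the linear distributions\<close>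

text \<open>On \<open>a\<close> and \<open>W\<close>, tested at \<open>(c, U)\<close>, both sides
  ask whether the adjoint of \<open>h\<close> at \<open>c\<close>, paired with the adjoint of
  \<open>g\<close> at \<open>lres (Cod g) (Map f a) U\<close>, belongs to \<open>W\<close>;
  \<open>lres_tensor2\<close> identifies the two forms.\<close>

lemma dist_left_natural:
  assumes [simp]: "cell_ok f" "cell_ok g" "cell_ok h" "tgt (Cod f) = src (Cod g)" "tgt (Cod g) = src (Cod h)"
  shows "(f \<otimes>\<^sub>2 (g \<oplus>\<^sub>2 h)) \<Zsemi> \<delta>\<^sup>L (Cod f) (Cod g) (Cod h)
    = \<delta>\<^sup>L (Dom f) (Dom g) (Dom h) \<Zsemi> ((f \<otimes>\<^sub>2 g) \<oplus>\<^sub>2 h)"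
  by (rule tensor_par_ext[where A = "Dom f" and B = "Dom g \<oplus> Dom h" and C = "Cod f \<otimes> Cod g" and D = "Cod h"])
    (simp_all add: lres_tensor2 opposite2_closed)

lemma dist_right_natural:
  assumes [simp]: "cell_ok f" "cell_ok g" "cell_ok h" "tgt (Cod f) = src (Cod g)" "tgt (Cod g) = src (Cod h)"
  shows "((f \<oplus>\<^sub>2 g) \<otimes>\<^sub>2 h) \<Zsemi> \<delta>\<^sup>R (Cod f) (Cod g) (Cod h)
    = \<delta>\<^sup>R (Dom f) (Dom g) (Dom h) \<Zsemi> (f \<oplus>\<^sub>2 (g \<otimes>\<^sub>2 h))"
  by (rule tensor_par_ext[where A = "Dom f \<oplus> Dom g" and B = "Dom h" and C = "Cod f" and D = "Cod g \<otimes> Cod h"])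
    (simp_all add: rres_tensor2 opposite2_closed)

subsection \<open>Coherence with the units\<close>

text \<open>Both sides test \<open>(b, ract (A\<degree>) a x) \<in> W\<close>: on the left through
  the residual of the unit, on the right through the action on \<open>A \<oplus> B\<close>.\<close>

lemma dist_left_lunit:
  assumes [simp]: "bmod A" "bmod B" "tgt A = src B" "src A = X"
  shows "\<delta>\<^sup>L (top_cell X) A B \<Zsemi> (tensor_lunit A \<oplus>\<^sub>2 id2 B) = tensor_lunit (A \<oplus> B)"
proof -
  have [simp]: "is_locale X" using bmod_loc(1)[of A] by simp
  show ?thesis
    by (rule tensor_par_ext[where A = "top_cell X" and B = "A \<oplus> B" and C = A and D = B])
      (simp_all add: lres_tensor_lunit par_act)
qed

lemma dist_right_runit:
  assumes [simp]: "bmod A" "bmod B" "tgt A = src B" "tgt B = Z"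
  shows "\<delta>\<^sup>R A B (top_cell Z) \<Zsemi> (id2 A \<oplus>\<^sub>2 tensor_runit B) = tensor_runit (A \<oplus> B)"
proof -
  have [simp]: "is_locale Z" using bmod_loc(2)[of B] by simp
  show ?thesis
    by (rule tensor_par_ext[where A = "A \<oplus> B" and B = "top_cell Z" and C = A and D = B])
      (simp_all add: rres_tensor_runit par_act)
qed

text \<open>The values lie in \<open>A \<otimes> B\<close> and are compared by their upper bounds
  \<open>U\<close>; both are below \<open>U\<close> exactly when
  \<open>(\<top>, lres B a U) \<in> W\<close>.\<close>

lemma dist_left_par_runit:
  assumes [simp]: "bmod A" "bmod B" "tgt A = src B" "tgt B = Z"
  shows "\<delta>\<^sup>L A B (bot_cell Z) \<Zsemi> par_runit (A \<otimes> B) = id2 A \<otimes>\<^sub>2 par_runit B" (is "?l = ?r")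
proof -
  have [simp]: "is_locale Z" using bmod_loc(2)[of B] by simp
  show ?thesis
  proof (rule tensor_cell_ext[where A = A and B = "B \<oplus> bot_cell Z"])
    fix a W assume [simp]: "a \<in> carrier A" and "W \<in> carrier (B \<oplus> bot_cell Z)"
    then have [simp]: "W \<in> carrier ((bot_cell Z)\<degree> \<otimes> B\<degree>)" by simp
    let ?p = "pure_tensor A (B \<oplus> bot_cell Z) a W"
    show "Map ?l ?p = Map ?r ?p"
    proof (rule cl_eq_upperI[of "A \<otimes> B"])
      fix U assume [simp]: "U \<in> carrier (A \<otimes> B)"
      show "Map ?l ?p \<sqsubseteq>\<^bsub>A \<otimes> B\<^esub> U \<longleftrightarrow> Map ?r ?p \<sqsubseteq>\<^bsub>A \<otimes> B\<^esub> U"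
        using par_runit_le_iff[of "A \<otimes> B" "Map (\<delta>\<^sup>L A B (bot_cell Z)) ?p" U]
          par_runit_le_iff[of B W "lres B a U"] le_lres_iff[of A B U a "Map (par_runit B) W"]
        by (simp add: pure_le_iff)
    qed simp_all
  qed simp_all
qed

lemma dist_right_par_lunit:
  assumes [simp]: "bmod A" "bmod B" "tgt A = src B" "src A = X"
  shows "\<delta>\<^sup>R (bot_cell X) A B \<Zsemi> par_lunit (A \<otimes> B) = par_lunit A \<otimes>\<^sub>2 id2 B" (is "?l = ?r")
proof -
  have [simp]: "is_locale X" using bmod_loc(1)[of A] by simp
  show ?thesis
  proof (rule tensor_cell_ext[where A = "bot_cell X \<oplus> A" and B = B])
    fix W b assume [simp]: "b \<in> carrier B" and "W \<in> carrier (bot_cell X \<oplus> A)"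
    then have [simp]: "W \<in> carrier (A\<degree> \<otimes> (bot_cell X)\<degree>)" by simp
    let ?p = "pure_tensor (bot_cell X \<oplus> A) B W b"
    show "Map ?l ?p = Map ?r ?p"
    proof (rule cl_eq_upperI[of "A \<otimes> B"])
      fix U assume [simp]: "U \<in> carrier (A \<otimes> B)"
      show "Map ?l ?p \<sqsubseteq>\<^bsub>A \<otimes> B\<^esub> U \<longleftrightarrow> Map ?r ?p \<sqsubseteq>\<^bsub>A \<otimes> B\<^esub> U"
        using par_lunit_le_iff[of "A \<otimes> B" "Map (\<delta>\<^sup>R (bot_cell X) A B) ?p" U]
          par_lunit_le_iff[of A W "rres A U b"] le_rres_iff[of A B U "Map (par_lunit A) W" b]
        by (simp add: pure_le_iff)
    qed simp_all
  qed simp_all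
qed

subsection \<open>Coherence with associativity\<close>

context
  fixes A :: "('a, 'x, 'y) bimod" and B :: "('b, 'y, 'z) bimod" and C :: "('c, 'z, 'w) bimod"
    and D :: "('d, 'w, 'v) bimod"
  assumes A [simp]: "bmod A" and B [simp]: "bmod B" and C [simp]: "bmod C" and D [simp]: "bmod D"
    and AB [simp]: "tgt A = src B" and BC [simp]: "tgt B = src C" and CD [simp]: "tgt C = src D"
begin

text \<open>Two successive distributions take the residual by \<open>a\<close> and then by
  \<open>b\<close>, a single one takes it by \<open>a \<otimes> b\<close>; currying of residuals
  makes these agree.\<close>

lemma dist_left_tensor_assoc:
  "\<delta>\<^sup>L (A \<otimes> B) C D \<Zsemi> (tensor_assoc A B C \<oplus>\<^sub>2 id2 D)
    = tensor_assoc A B (C \<oplus> D) \<Zsemi> (id2 A \<otimes>\<^sub>2 \<delta>\<^sup>L B C D) \<Zsemi> \<delta>\<^sup>L A (B \<otimes> C) D"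
  by (rule tensor3_par_ext[where A = A and B = B and E = "C \<oplus> D" and C = "A \<otimes> (B \<otimes> C)" and D = D])
    (simp_all add: lres_tensor_assoc)

lemma dist_right_tensor_assoc:
  "tensor_assoc (A \<oplus> B) C D \<Zsemi> \<delta>\<^sup>R A B (C \<otimes> D)
    = (\<delta>\<^sup>R A B C \<otimes>\<^sub>2 id2 D) \<Zsemi> \<delta>\<^sup>R A (B \<otimes> C) D \<Zsemi> (id2 A \<oplus>\<^sub>2 tensor_assoc B C D)"
  by (rule tensor3_par_ext[where A = "A \<oplus> B" and B = C and E = D and C = A and D = "B \<otimes> (C \<otimes> D)"])
    (simp_all add: rres_tensor_assoc)

text \<open>Tested at the pure tensor of \<open>d\<close> and \<open>c\<close> paired with
  \<open>U\<close>, both sides ask for \<open>d\<close> paired with the pure tensor of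
  \<open>c\<close> and \<open>lres B a U\<close>. The two-step side arrives there because the
  adjoint of \<open>\<delta>\<^sup>L\<close> has a pure residual.\<close>

lemma dist_left_par_assoc:
  "\<delta>\<^sup>L A (B \<oplus> C) D \<Zsemi> (\<delta>\<^sup>L A B C \<oplus>\<^sub>2 id2 D) \<Zsemi> par_assoc (A \<otimes> B) C D
    = (id2 A \<otimes>\<^sub>2 par_assoc B C D) \<Zsemi> \<delta>\<^sup>L A B (C \<oplus> D)"
  by (rule tensor_par3_ext[where A = A and B = "(B \<oplus> C) \<oplus> D" and C = "A \<otimes> B" and D = C and E = D])
    (simp_all add: lres_dist_left)

lemma dist_right_par_assoc:
  "(par_assoc A B C \<otimes>\<^sub>2 id2 D) \<Zsemi> \<delta>\<^sup>R A (B \<oplus> C) D \<Zsemi> (id2 A \<oplus>\<^sub>2 \<delta>\<^sup>R B C D)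
    = \<delta>\<^sup>R (A \<oplus> B) C D \<Zsemi> par_assoc A B (C \<otimes> D)"
  by (rule tensor_par3_ext[where A = "(A \<oplus> B) \<oplus> C" and B = D and C = A and D = B and E = "C \<otimes> D"])
    (simp_all add: rres_dist_right)

text \<open>\<open>\<delta>\<^sup>L\<close> changes only the second component of a tested pair, to a
  residual by an element of \<open>A\<close>, and \<open>\<delta>\<^sup>R\<close> only the first, to
  a residual by an element of \<open>D\<close>. The order of the two steps is therefore
  irrelevant.\<close>

lemma dist_left_dist_right_tensor:
  "tensor_assoc A (B \<oplus> C) D \<Zsemi> (id2 A \<otimes>\<^sub>2 \<delta>\<^sup>R B C D) \<Zsemi> \<delta>\<^sup>L A B (C \<otimes> D)
    = (\<delta>\<^sup>L A B C \<otimes>\<^sub>2 id2 D) \<Zsemi> \<delta>\<^sup>R (A \<otimes> B) C D"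
  by (rule tensor3_par_ext[where A = A and B = "B \<oplus> C" and E = D and C = "A \<otimes> B" and D = "C \<otimes> D"])
    (simp_all)

text \<open>Both distributions work in the middle here, on the same \<open>S\<close> in
  \<open>B \<otimes> C\<close>, so their effects do not simply decouple. Each side is brought to the
  form \<open>(d, lres C w S) \<in> R\<close>, where \<open>w\<close> is determined by
  \<open>W\<close> and \<open>a\<close>.\<close>

lemma dist_left_dist_right_par:
  "\<delta>\<^sup>L (A \<oplus> B) C D \<Zsemi> (\<delta>\<^sup>R A B C \<oplus>\<^sub>2 id2 D) \<Zsemi> par_assoc A (B \<otimes> C) D
    = \<delta>\<^sup>R A B (C \<oplus> D) \<Zsemi> (id2 A \<oplus>\<^sub>2 \<delta>\<^sup>L B C D)"
proof (rule tensor_par3_ext[where A = "A \<oplus> B" and B = "C \<oplus> D" and C = A and D = "B \<otimes> C" and E = D])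
  fix W R a S d assume "W \<in> carrier (A \<oplus> B)" "R \<in> carrier (C \<oplus> D)"
    and [simp]: "a \<in> carrier A" "S \<in> carrier (B \<otimes> C)" "d \<in> carrier D"
  then have [simp]: "W \<in> carrier (B\<degree> \<otimes> A\<degree>)" "R \<in> carrier (D\<degree> \<otimes> C\<degree>)" by simp_all
  let ?p = "pure_tensor (A \<oplus> B) (C \<oplus> D) W R"
  \<comment> \<open>\<open>w\<close> is the least \<open>b\<close> with
    \<open>(b, a) \<in> W\<close>, so membership of \<open>(b, a)\<close> in \<open>W\<close> turns
    into an inequality for \<open>b\<close>, to which the residuals of the adjoint \<open>?V\<close>
    apply.\<close>
  let ?w = "rres (B\<degree>) W a" and ?V = "Map ((\<delta>\<^sup>L B C D)\<degree>\<^sub>2) (pure_tensor (D\<degree>) ((B \<otimes> C)\<degree>) d S)"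
  have w: "?w \<in> carrier B" using rres_closed[of "B\<degree>" W a] by (simp add: opposite_cl)
  have "(rres B ?V R, a) \<in> W \<longleftrightarrow> ?w \<sqsubseteq>\<^bsub>B\<^esub> rres B ?V R"
    using le_rres_iff[of "B\<degree>" "A\<degree>" W "rres B ?V R" a] by simp
  also have "\<dots> \<longleftrightarrow> (d, lres C ?w S) \<in> R"
    using le_rres_iff[of B "C \<oplus> D" ?V ?w R] mem_dist_left_adjoint[of B C D ?w R d S] w by simp
  finally show "(pure_tensor (D\<degree>) ((B \<otimes> C)\<degree>) d S, a) \<in>
        Map (\<delta>\<^sup>L (A \<oplus> B) C D \<Zsemi> (\<delta>\<^sup>R A B C \<oplus>\<^sub>2 id2 D) \<Zsemi> par_assoc A (B \<otimes> C) D) ?p \<longleftrightarrow>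
      (pure_tensor (D\<degree>) ((B \<otimes> C)\<degree>) d S, a) \<in> Map (\<delta>\<^sup>R A B (C \<oplus> D) \<Zsemi> (id2 A \<oplus>\<^sub>2 \<delta>\<^sup>L B C D)) ?p"
    by (simp add: lres_dist_right)
qed simp_all

end

text \<open>Three consecutive 2-cells serve associativity in the hom-categories, two serve
  interchange, and four composable modules serve the pentagons and the distribution axioms. The free
  carrier types allow composites such as \<open>A \<otimes> B\<close> in place of
  \<open>A\<close>.\<close>

theorem theorem7p3:
  fixes X :: "'x gorder" and Y :: "'y gorder" and Z :: "'z gorder"
    and W :: "'w gorder" and V :: "'v gorder"
    and A :: "('a, 'x, 'y) bimod" and A' :: "('a1, 'x, 'y) bimod"
    and A'' :: "('a2, 'x, 'y) bimod" and A''' :: "('a3, 'x, 'y) bimod"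
    and B :: "('b, 'y, 'z) bimod" and B' :: "('b1, 'y, 'z) bimod" and B'' :: "('b2, 'y, 'z) bimod"
    and C :: "('c, 'z, 'w) bimod" and C' :: "('c1, 'z, 'w) bimod"
    and D :: "('d, 'w, 'v) bimod"
    and f :: "('a, 'a1, 'x, 'y) cell" and f' :: "('a1, 'a2, 'x, 'y) cell"
    and f'' :: "('a2, 'a3, 'x, 'y) cell"
    and g :: "('b, 'b1, 'y, 'z) cell" and g' :: "('b1, 'b2, 'y, 'z) cell"
    and h :: "('c, 'c1, 'z, 'w) cell"
  assumes "is_locale X" and "is_locale Y" and "is_locale Z" and "is_locale W" and "is_locale V"
    and "bimodule X Y A" and "bimodule X Y A'" and "bimodule X Y A''" and "bimodule X Y A'''"
    and "bimodule Y Z B" and "bimodule Y Z B'" and "bimodule Y Z B''"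
    and "bimodule Z W C" and "bimodule Z W C'"
    and "bimodule W V D"
    and "f :\<^sub>2 A \<rightarrow> A'" and "f' :\<^sub>2 A' \<rightarrow> A''" and "f'' :\<^sub>2 A'' \<rightarrow> A'''"
    and "g :\<^sub>2 B \<rightarrow> B'" and "g' :\<^sub>2 B' \<rightarrow> B''"
    and "h :\<^sub>2 C \<rightarrow> C'"
  shows
   "\<comment> \<open>hom-categories\<close>
    (id2 A :\<^sub>2 A \<rightarrow> A) \<and>
    (f \<Zsemi> f' :\<^sub>2 A \<rightarrow> A'') \<and>
    id2 A \<Zsemi> f = f \<and>
    f \<Zsemi> id2 A' = f \<and>
    f \<Zsemi> f' \<Zsemi> f'' = f \<Zsemi> (f' \<Zsemi> f'') \<and>
    \<comment> \<open>first bicategory structure: composition, units\<close>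
    bimodule X X (top_cell X) \<and>
    bimodule X Z (A \<otimes> B) \<and>
    (f \<otimes>\<^sub>2 g :\<^sub>2 A \<otimes> B \<rightarrow> A' \<otimes> B') \<and>
    id2 A \<otimes>\<^sub>2 id2 B = id2 (A \<otimes> B) \<and>
    (f \<Zsemi> f') \<otimes>\<^sub>2 (g \<Zsemi> g') = (f \<otimes>\<^sub>2 g) \<Zsemi> (f' \<otimes>\<^sub>2 g') \<and>
    \<comment> \<open>natural associativity and unit isomorphisms\<close>
    (tensor_assoc A B C :\<^sub>2 (A \<otimes> B) \<otimes> C \<cong> A \<otimes> (B \<otimes> C)) \<and>
    (tensor_lunit A :\<^sub>2 top_cell X \<otimes> A \<cong> A) \<and>
    (tensor_runit A :\<^sub>2 A \<otimes> top_cell Y \<cong> A) \<and>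
    ((f \<otimes>\<^sub>2 g) \<otimes>\<^sub>2 h) \<Zsemi> tensor_assoc A' B' C' = tensor_assoc A B C \<Zsemi> (f \<otimes>\<^sub>2 (g \<otimes>\<^sub>2 h)) \<and>
    (id2 (top_cell X) \<otimes>\<^sub>2 f) \<Zsemi> tensor_lunit A' = tensor_lunit A \<Zsemi> f \<and>
    (f \<otimes>\<^sub>2 id2 (top_cell Y)) \<Zsemi> tensor_runit A' = tensor_runit A \<Zsemi> f \<and>
    \<comment> \<open>pentagon and triangle\<close>
    (tensor_assoc A B C \<otimes>\<^sub>2 id2 D) \<Zsemi> tensor_assoc A (B \<otimes> C) D \<Zsemi> (id2 A \<otimes>\<^sub>2 tensor_assoc B C D)
      = tensor_assoc (A \<otimes> B) C D \<Zsemi> tensor_assoc A B (C \<otimes> D) \<and>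
    tensor_assoc A (top_cell Y) B \<Zsemi> (id2 A \<otimes>\<^sub>2 tensor_lunit B) = tensor_runit A \<otimes>\<^sub>2 id2 B \<and>
    \<comment> \<open>second bicategory structure: composition, units\<close>
    bimodule X X (bot_cell X) \<and>
    bimodule X Z (A \<oplus> B) \<and>
    (lhom_to_par A B :\<^sub>2 A\<degree> \<rhd> B \<cong> A \<oplus> B) \<and>
    (f \<oplus>\<^sub>2 g :\<^sub>2 A \<oplus> B \<rightarrow> A' \<oplus> B') \<and>
    id2 A \<oplus>\<^sub>2 id2 B = id2 (A \<oplus> B) \<and>
    (f \<Zsemi> f') \<oplus>\<^sub>2 (g \<Zsemi> g') = (f \<oplus>\<^sub>2 g) \<Zsemi> (f' \<oplus>\<^sub>2 g') \<and>
    \<comment> \<open>natural associativity and unit isomorphisms\<close>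
    (par_assoc A B C :\<^sub>2 (A \<oplus> B) \<oplus> C \<cong> A \<oplus> (B \<oplus> C)) \<and>
    (par_lunit A :\<^sub>2 bot_cell X \<oplus> A \<cong> A) \<and>
    (par_runit A :\<^sub>2 A \<oplus> bot_cell Y \<cong> A) \<and>
    ((f \<oplus>\<^sub>2 g) \<oplus>\<^sub>2 h) \<Zsemi> par_assoc A' B' C' = par_assoc A B C \<Zsemi> (f \<oplus>\<^sub>2 (g \<oplus>\<^sub>2 h)) \<and>
    (id2 (bot_cell X) \<oplus>\<^sub>2 f) \<Zsemi> par_lunit A' = par_lunit A \<Zsemi> f \<and>
    (f \<oplus>\<^sub>2 id2 (bot_cell Y)) \<Zsemi> par_runit A' = par_runit A \<Zsemi> f \<and>
    \<comment> \<open>pentagon and triangle\<close>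
    (par_assoc A B C \<oplus>\<^sub>2 id2 D) \<Zsemi> par_assoc A (B \<oplus> C) D \<Zsemi> (id2 A \<oplus>\<^sub>2 par_assoc B C D)
      = par_assoc (A \<oplus> B) C D \<Zsemi> par_assoc A B (C \<oplus> D) \<and>
    par_assoc A (bot_cell Y) B \<Zsemi> (id2 A \<oplus>\<^sub>2 par_lunit B) = par_runit A \<oplus>\<^sub>2 id2 B \<and>
    \<comment> \<open>natural linear distributions\<close>
    (\<delta>\<^sup>L A B C :\<^sub>2 A \<otimes> (B \<oplus> C) \<rightarrow> (A \<otimes> B) \<oplus> C) \<and>
    (\<delta>\<^sup>R A B C :\<^sub>2 (A \<oplus> B) \<otimes> C \<rightarrow> A \<oplus> (B \<otimes> C)) \<and>
    (f \<otimes>\<^sub>2 (g \<oplus>\<^sub>2 h)) \<Zsemi> \<delta>\<^sup>L A' B' C' = \<delta>\<^sup>L A B C \<Zsemi> ((f \<otimes>\<^sub>2 g) \<oplus>\<^sub>2 h) \<and>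
    ((f \<oplus>\<^sub>2 g) \<otimes>\<^sub>2 h) \<Zsemi> \<delta>\<^sup>R A' B' C' = \<delta>\<^sup>R A B C \<Zsemi> (f \<oplus>\<^sub>2 (g \<otimes>\<^sub>2 h)) \<and>
    \<comment> \<open>coherence: units\<close>
    \<delta>\<^sup>L (top_cell X) A B \<Zsemi> (tensor_lunit A \<oplus>\<^sub>2 id2 B) = tensor_lunit (A \<oplus> B) \<and>
    \<delta>\<^sup>R A B (top_cell Z) \<Zsemi> (id2 A \<oplus>\<^sub>2 tensor_runit B) = tensor_runit (A \<oplus> B) \<and>
    \<delta>\<^sup>L A B (bot_cell Z) \<Zsemi> par_runit (A \<otimes> B) = id2 A \<otimes>\<^sub>2 par_runit B \<and>
    \<delta>\<^sup>R (bot_cell X) A B \<Zsemi> par_lunit (A \<otimes> B) = par_lunit A \<otimes>\<^sub>2 id2 B \<and>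
    \<comment> \<open>coherence: associativity\<close>
    \<delta>\<^sup>L (A \<otimes> B) C D \<Zsemi> (tensor_assoc A B C \<oplus>\<^sub>2 id2 D)
      = tensor_assoc A B (C \<oplus> D) \<Zsemi> (id2 A \<otimes>\<^sub>2 \<delta>\<^sup>L B C D) \<Zsemi> \<delta>\<^sup>L A (B \<otimes> C) D \<and>
    tensor_assoc (A \<oplus> B) C D \<Zsemi> \<delta>\<^sup>R A B (C \<otimes> D)
      = (\<delta>\<^sup>R A B C \<otimes>\<^sub>2 id2 D) \<Zsemi> \<delta>\<^sup>R A (B \<otimes> C) D \<Zsemi> (id2 A \<oplus>\<^sub>2 tensor_assoc B C D) \<and>
    \<delta>\<^sup>L A (B \<oplus> C) D \<Zsemi> (\<delta>\<^sup>L A B C \<oplus>\<^sub>2 id2 D) \<Zsemi> par_assoc (A \<otimes> B) C D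
      = (id2 A \<otimes>\<^sub>2 par_assoc B C D) \<Zsemi> \<delta>\<^sup>L A B (C \<oplus> D) \<and>
    (par_assoc A B C \<otimes>\<^sub>2 id2 D) \<Zsemi> \<delta>\<^sup>R A (B \<oplus> C) D \<Zsemi> (id2 A \<oplus>\<^sub>2 \<delta>\<^sup>R B C D)
      = \<delta>\<^sup>R (A \<oplus> B) C D \<Zsemi> par_assoc A B (C \<otimes> D) \<and>
    tensor_assoc A (B \<oplus> C) D \<Zsemi> (id2 A \<otimes>\<^sub>2 \<delta>\<^sup>R B C D) \<Zsemi> \<delta>\<^sup>L A B (C \<otimes> D)
      = (\<delta>\<^sup>L A B C \<otimes>\<^sub>2 id2 D) \<Zsemi> \<delta>\<^sup>R (A \<otimes> B) C D \<and>
    \<delta>\<^sup>L (A \<oplus> B) C D \<Zsemi> (\<delta>\<^sup>R A B C \<oplus>\<^sub>2 id2 D) \<Zsemi> par_assoc A (B \<otimes> C) D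
      = \<delta>\<^sup>R A B (C \<oplus> D) \<Zsemi> (id2 A \<oplus>\<^sub>2 \<delta>\<^sup>L B C D)"
proof -
  have [simp]: "bmod A" "bmod A'" "bmod A''" "bmod A'''" "bmod B" "bmod B'" "bmod B''" "bmod C" "bmod C'" "bmod D"
    and [simp]: "src A = X" "src A' = X" "src A'' = X" "src A''' = X" "tgt A = Y" "tgt A' = Y" "tgt A'' = Y" "tgt A''' = Y"
      "src B = Y" "src B' = Y" "src B'' = Y" "tgt B = Z" "tgt B' = Z" "tgt B'' = Z"
      "src C = Z" "src C' = Z" "tgt C = W" "tgt C' = W" "src D = W" "tgt D = V"
    and [simp]: "is_locale X" "is_locale Y" "is_locale Z"
    using assms by (simp_all add: bimodule_iff_bmod)
  have [simp]: "cell_ok f" "Dom f = A" "Cod f = A'" "cell_ok f'" "Dom f' = A'" "Cod f' = A''"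
    "cell_ok f''" "Dom f'' = A''" "Cod f'' = A'''" "cell_ok g" "Dom g = B" "Cod g = B'"
    "cell_ok g'" "Dom g' = B'" "Cod g' = B''" "cell_ok h" "Dom h = C" "Cod h = C'"
    using assms by (simp_all add: is_cell_iff)
  \<comment> \<open>The naturality laws speak about \<open>Dom\<close> and \<open>Cod\<close>;
    instantiating and simplifying them beforehand makes them match the conjuncts, which name the
    modules.\<close>
  note natural = tensor_assoc_natural[of f g h, simplified] tensor_lunit_natural[of f, simplified]
    tensor_runit_natural[of f, simplified] par_assoc_natural[of f g h, simplified]
    par_lunit_natural[of f, simplified] par_runit_natural[of f, simplified]
    dist_left_natural[of f g h, simplified] dist_right_natural[of f g h, simplified]
  show ?thesis
    \<comment> \<open>Equations are closed by their lemma, with the typing premises left to the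
      simplifier; the remaining conjuncts are typing and isomorphism statements, translated to
      \<open>bmod\<close>, \<open>cell_ok\<close> and \<open>iso_ok\<close>.\<close>
    by (intro conjI;
        ((rule natural id2_vcomp vcomp_id2 vcomp_assoc tensor2_id2 tensor2_vcomp tensor_pentagon tensor_triangle
            par2_id2 par2_vcomp par_pentagon par_triangle dist_left_lunit dist_right_runit
            dist_left_par_runit dist_right_par_lunit dist_left_tensor_assoc dist_right_tensor_assoc
            dist_left_par_assoc dist_right_par_assoc dist_left_dist_right_tensor dist_left_dist_right_par; (simp; fail))
        | simp add: bimodule_iff_bmod is_cell_iff is_iso_iff))
qed

end
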